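(* Let $\omega=\omega(t,u)$ be an eigenvalue of the linear Hamiltonian system $$W(z)^{-1}\left(J\hat y'(z)-\Phi(z,t,u)\hat y(z)\right)=\omega\,\hat y(z),\quad 0<z<1,$$ with $J$, $W$, $\Phi$ as in the context, and suppose that $\omega(t,u)$ depends analytically on the parameters $(t,u)\in S$ in some domain $S\subset\mathbb{R}^2$. Then $\omega(t,u)$ solves the quasilinear partial differential equation $$\frac{\partial\omega}{\partial t}+2\omega\cdot\frac{\partial\omega}{\partial u}=2(\mu+1)^2\frac{\tanh u}{\cosh^2u}+\mathrm{e}^{2t}\sinh(2u)+\mathrm{e}^t\cosh u$$ on $S$. Moreover, $\lambda=(\mu+1)(\mu-2\mathrm{e}^t\sinh u)$ is an eigenvalue of the spheroidal wave equation $$\frac{\mathrm{d}}{\mathrm{d}x}\left((1-x^2)\frac{\mathrm{d}}{\mathrm{d}x}w(x)\right)+\left(\lambda+\gamma^2(1-x^2)-\frac{\mu^2}{1-x^2}\right)w(x)=0,\quad -1<x<1,$$ for $\gamma=\mathrm{e}^t$ if and only if the equation $\omega(t,u)=\mathrm{e}^t\cosh u-(\mu+1)\tanh u$ is satisfied for some $(t,u)\in S$.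
   Context: Fix a real number $\mu\ge0$ and set $\alpha:=\frac12(\mu+1)$. For $0<z<1$ and $(t,u)\in\mathbb{R}^2$ define $$J:=\begin{pmatrix}0&-1\\1&0\end{pmatrix},\qquad W(z):=\begin{pmatrix}\frac{1}{1-z}&0\\0&\frac1z\end{pmatrix},$$ $$\Phi(z,t,u):=\begin{pmatrix}2\mathrm{e}^t\cosh u+\frac{2\alpha\tanh u-\mathrm{e}^t\cosh u}{1-z}&-\frac{\alpha}{z}+\frac{\alpha}{1-z}+2\mathrm{e}^t\sinh u\\-\frac{\alpha}{z}+\frac{\alpha}{1-z}+2\mathrm{e}^t\sinh u&2\mathrm{e}^t\cosh u-\frac{2\alpha\tanh u+\mathrm{e}^t\cosh u}{z}\end{pmatrix}.$$ Let $L^2_W((0,1),\mathbb{C}^2)$ be the Hilbert space of functions $f:(0,1)\to\mathbb{C}^2$ with $\int_0^1 f(z)^*W(z)f(z)\,\mathrm{d}z<\infty$. An eigenvalue of the linear Hamiltonian system for the parameters $(t,u)$ is an eigenvalue of the self-adjoint operator $\hat y\mapsto W^{-1}(J\hat y'-\Phi(\cdot,t,u)\hat y)$ in $L^2_W((0,1),\mathbb{C}^2)$ whose domain consists of all $\hat y\in L^2_W((0,1),\mathbb{C}^2)$ that are locally absolutely continuous on $(0,1)$ and for which $W^{-1}(J\hat y'-\Phi\hat y)\in L^2_W((0,1),\mathbb{C}^2)$ (the differential expression is in the limit point case at both endpoints, so this is its only self-adjoint realization). A number $\lambda\in\mathbb{C}$ is called an eigenvalue of the spheroidal wave equation (for given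 $\gamma^2$ and $\mu$) if the equation has a nontrivial bounded solution $w$ on $(-1,1)$.
   Formalization: "If" is proved for the given ω at each (t,u) in S; in "only if", ω(t,u) is replaced by some eigenvalue of the Hamiltonian system at the same (t,u), since a fixed branch ω may be a different eigenvalue from the one satisfying the equation. *)

theory Defs
  imports "HOL-Analysis.Analysis"
begin

text \<open>Real analyticity in two variables: local expansion into an (unconditionally) convergent
  double power series. For open \<open>S\<close> the square of side \<open>2 * r\<close> can always be shrunk to lie in
  \<open>S\<close>, so values of \<open>f\<close> outside \<open>S\<close> are irrelevant.\<close>

definition real_analytic2_on :: "(real \<times> real \<Rightarrow> real) \<Rightarrow> (real \<times> real) set \<Rightarrow> bool" where
  "real_analytic2_on f S \<longleftrightarrow>
     (\<forall>(t, u) \<in> S. \<exists>r > 0. \<exists>a :: nat \<Rightarrow> nat \<Rightarrow> real. \<forall>h k. \<bar>h\<bar> < r \<and> \<bar>k\<bar> < r \<longrightarrow>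
        ((\<lambda>(i, j). a i j * h ^ i * k ^ j) has_sum f (t + h, u + k)) UNIV)"

text \<open>The library constant \<open>absolutely_continuous\<close> is about measures; this is the
  epsilon-delta notion for functions. A pair \<open>(a, b)\<close> in \<open>P\<close> encodes the interval
  from \<open>a\<close> to \<open>b\<close>.\<close>

definition abs_continuous_on :: "real set \<Rightarrow> (real \<Rightarrow> 'a::metric_space) \<Rightarrow> bool" where
  "abs_continuous_on K f \<longleftrightarrow>
     (\<forall>\<epsilon> > 0. \<exists>\<delta> > 0. \<forall>P. finite P \<and> (\<forall>(a, b) \<in> P. a \<le> b \<and> {a..b} \<subseteq> K) \<and>
        disjoint_family_on (\<lambda>(a, b). {a<..<b}) P \<and> (\<Sum>(a, b) \<in> P. b - a) < \<delta> \<longrightarrow>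
        (\<Sum>(a, b) \<in> P. dist (f a) (f b)) < \<epsilon>)"

definition locally_abs_continuous_on :: "real set \<Rightarrow> (real \<Rightarrow> 'a::metric_space) \<Rightarrow> bool" where
  "locally_abs_continuous_on I f \<longleftrightarrow>
     (\<forall>a b. a \<le> b \<and> {a..b} \<subseteq> I \<longrightarrow> abs_continuous_on {a..b} f)"

definition J_mat :: "complex^2^2" where
  "J_mat = vector [vector [0, -1], vector [1, 0]]"

definition W_mat :: "real \<Rightarrow> complex^2^2" where
  "W_mat z = vector [vector [complex_of_real (1 / (1 - z)), 0],
                     vector [0, complex_of_real (1 / z)]]"

definition Phi_mat :: "real \<Rightarrow> real \<Rightarrow> real \<Rightarrow> real \<Rightarrow> complex^2^2" where
  "Phi_mat \<mu> z t u =
    (let \<alpha> = (\<mu> + 1) / 2;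
         p = 2 * exp t * cosh u + (2 * \<alpha> * tanh u - exp t * cosh u) / (1 - z);
         q = - \<alpha> / z + \<alpha> / (1 - z) + 2 * exp t * sinh u;
         s = 2 * exp t * cosh u - (2 * \<alpha> * tanh u + exp t * cosh u) / z
     in vector [vector [complex_of_real p, complex_of_real q],
                vector [complex_of_real q, complex_of_real s]])"

definition L2_W :: "(real \<Rightarrow> complex^2) set" where
  "L2_W = {f. f \<in> borel_measurable (lebesgue_on {0<..<1}) \<and>
     integrable (lebesgue_on {0<..<1})
       (\<lambda>z. \<Sum>i\<in>UNIV. cnj (f z $ i) * (W_mat z *v f z) $ i)}"

text \<open>\<open>vector_derivative\<close> is unspecified where \<open>y\<close> is not differentiable; for locally absolutely
  continuous \<open>y\<close> this is a null set, and the expression is only used up to null sets.\<close>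

definition ham_expr :: "real \<Rightarrow> real \<Rightarrow> real \<Rightarrow> (real \<Rightarrow> complex^2) \<Rightarrow> real \<Rightarrow> complex^2" where
  "ham_expr \<mu> t u y z =
     matrix_inv (W_mat z) *v (J_mat *v vector_derivative y (at z) - Phi_mat \<mu> z t u *v y z)"

definition ham_domain :: "real \<Rightarrow> real \<Rightarrow> real \<Rightarrow> (real \<Rightarrow> complex^2) set" where
  "ham_domain \<mu> t u =
     {y \<in> L2_W. locally_abs_continuous_on {0<..<1} y \<and> ham_expr \<mu> t u y \<in> L2_W}"

text \<open>Elements of the Hilbert space are represented by functions, so its equalities become
  equalities almost everywhere.\<close>

definition ham_eigenvalue :: "real \<Rightarrow> real \<Rightarrow> real \<Rightarrow> complex \<Rightarrow> bool" where
  "ham_eigenvalue \<mu> t u \<omega> \<longleftrightarrow>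
     (\<exists>y \<in> ham_domain \<mu> t u.
        \<not> (AE z in lebesgue_on {0<..<1}. y z = 0) \<and>
        (AE z in lebesgue_on {0<..<1}. ham_expr \<mu> t u y z = \<omega> *s y z))"

text \<open>The second argument is the square of the parameter \<open>\<gamma>\<close> of the equation, and \<open>w'\<close> is the
  derivative of \<open>w\<close>.\<close>

definition spheroidal_solution ::
    "real \<Rightarrow> real \<Rightarrow> complex \<Rightarrow> (real \<Rightarrow> complex) \<Rightarrow> bool" where
  "spheroidal_solution \<mu> \<gamma>2 lam w \<longleftrightarrow>
     (\<exists>w'. \<forall>x \<in> {-1<..<1}.
        (w has_vector_derivative w' x) (at x) \<and>
        (\<exists>d. ((\<lambda>x. complex_of_real (1 - x\<^sup>2) * w' x) has_vector_derivative d) (at x) \<and>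
             d + (lam + complex_of_real (\<gamma>2 * (1 - x\<^sup>2) - \<mu>\<^sup>2 / (1 - x\<^sup>2))) * w x = 0))"

definition spheroidal_eigenvalue :: "real \<Rightarrow> real \<Rightarrow> complex \<Rightarrow> bool" where
  "spheroidal_eigenvalue \<mu> \<gamma>2 lam \<longleftrightarrow>
     (\<exists>w. spheroidal_solution \<mu> \<gamma>2 lam w \<and> bounded (w ` {-1<..<1}) \<and>
          (\<exists>x \<in> {-1<..<1}. w x \<noteq> 0))"

end

theory Submission
  imports Defs
begin

text \<open>
  Put \<open>\<alpha> = (\<mu> + 1) / 2\<close>, \<open>c = exp t * cosh u\<close>, \<open>\<sigma> = exp t * sinh u\<close> and \<open>\<tau> = tanh u\<close>. For real \<open>\<omega>\<close> the
  system is a real canonical system for \<open>y = (f, g)\<close> whose coefficients have simple poles at \<open>0\<close> and \<open>1\<close>,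
  with exponents \<open>\<alpha>\<close> and \<open>- \<alpha>\<close> at both of them. As \<open>\<alpha> \<ge> 1 / 2\<close>, only the multiples of the recessive
  (Frobenius) solution \<open>z powr \<alpha> * (power series)\<close> are square integrable near such a point
  (\<open>limit_point_L2\<close>), and the reflection \<open>z \<mapsto> 1 - z\<close> reduces the point \<open>1\<close> to the point \<open>0\<close>. So the
  eigenfunctions are the solutions that are recessive at both ends, and there they are bounded by
  \<open>sqrt (min z (1 - z))\<close>.

  The differential equation for \<open>\<omega>\<close> is a consequence of two facts. The Feynman-Hellmann formula
  (\<open>feynman_hellmann\<close>) states that the integrals of \<open>y\<^sup>T (\<partial>\<Phi>/\<partial>t + \<omega>\<^sub>t W) y\<close> and of
  \<open>y\<^sup>T (\<partial>\<Phi>/\<partial>u + \<omega>\<^sub>u W) y\<close> over the unit interval are zero. And the system belongs to an isomonodromic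
  family: if \<open>R\<close> is the right-hand side of the differential equation and the parameters move in the direction
  \<open>\<partial>\<^sub>t + 2 \<omega> \<partial>\<^sub>u\<close> while \<open>\<omega>\<close> moves with speed \<open>R\<close>, then the coefficient matrix changes by an infinitesimal
  gauge transformation that is linear in \<open>z\<close>. In terms of quadratic forms,
  \<open>y\<^sup>T (\<partial>\<Phi>/\<partial>t + 2 \<omega> \<partial>\<Phi>/\<partial>u + R W) y\<close> is the derivative of a quadratic form in \<open>y\<close> that vanishes at both
  ends (\<open>isomonodromic_derivative\<close>). The difference of the two statements says that \<open>\<omega>\<^sub>t + 2 \<omega> \<omega>\<^sub>u - R\<close>
  times the squared norm of \<open>y\<close> is zero (\<open>eigenvalue_pde\<close>). The limit in the Feynman-Hellmann formula needs
  eigenfunctions that depend continuously on the parameters; this comes from the Frobenius series, whose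
  coefficients have a common majorant (\<open>frobenius_coeff_bound\<close>).

  If \<open>\<omega> = c - (\<mu> + 1) * \<tau>\<close>, then the equation for \<open>g'\<close> has no pole in front of \<open>f\<close>, so \<open>f\<close> can be
  eliminated. The second order equation for \<open>g\<close> becomes the spheroidal wave equation by the substitution
  \<open>g z = sqrt (z * (1 - z)) * w (2 * z - 1)\<close> (\<open>potential_spheroidal\<close>), and \<open>w\<close> is bounded if and only if \<open>g\<close> is
  recessive at both ends (\<open>limit_point_sqrt_bound\<close>).

  An eigenfunction of the operator is only locally absolutely continuous and satisfies the equation only almost
  everywhere, in a form that says nothing at points where it is not differentiable. That it is nevertheless
  a classical solution is shown first (\<open>classical_solution_of_ae_solution\<close>).
\<close>

section \<open>Absolutely continuous solutions are classical\<close>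

definition variation_below :: "real set \<Rightarrow> (real \<Rightarrow> 'a::metric_space) \<Rightarrow> real \<Rightarrow> real \<Rightarrow> bool" where
  "variation_below K f \<epsilon> \<delta> \<longleftrightarrow>
     (\<forall>P. finite P \<and> (\<forall>(a, b) \<in> P. a \<le> b \<and> {a..b} \<subseteq> K) \<and>
        disjoint_family_on (\<lambda>(a, b). {a<..<b}) P \<and> (\<Sum>(a, b) \<in> P. b - a) < \<delta> \<longrightarrow>
        (\<Sum>(a, b) \<in> P. dist (f a) (f b)) < \<epsilon>)"

lemma abs_continuous_on_iff_variation_below:
  "abs_continuous_on K f \<longleftrightarrow> (\<forall>\<epsilon>>0. \<exists>\<delta>>0. variation_below K f \<epsilon> \<delta>)"
  unfolding abs_continuous_on_def variation_below_def ..

lemma abs_continuous_onD: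
  "abs_continuous_on K f \<Longrightarrow> 0 < \<epsilon> \<Longrightarrow> \<exists>\<delta>>0. variation_below K f \<epsilon> \<delta>"
  by (simp add: abs_continuous_on_iff_variation_below)

lemma variation_belowD:
  assumes "variation_below K f \<epsilon> \<delta>" "finite P" "\<And>a b. (a, b) \<in> P \<Longrightarrow> a \<le> b \<and> {a..b} \<subseteq> K"
    "disjoint_family_on (\<lambda>(a, b). {a<..<b}) P" "(\<Sum>(a, b) \<in> P. b - a) < \<delta>"
  shows "(\<Sum>(a, b) \<in> P. dist (f a) (f b)) < \<epsilon>"
  using assms(2-5) assms(1)[unfolded variation_below_def, rule_format, of P] by fast

lemma lipschitz_imp_abs_continuous_on:
  assumes "\<And>x y. x \<in> K \<Longrightarrow> y \<in> K \<Longrightarrow> dist (f x) (f y) \<le> L * \<bar>x - y\<bar>"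
  shows "abs_continuous_on K f"
  unfolding abs_continuous_on_def
proof (intro allI impI)
  fix \<epsilon> :: real assume "\<epsilon> > 0"
  define M where "M = \<bar>L\<bar> + 1"
  have M: "M > 0" "L \<le> M" by (auto simp: M_def)
  show "\<exists>\<delta>>0. \<forall>P. finite P \<and> (\<forall>(a, b)\<in>P. a \<le> b \<and> {a..b} \<subseteq> K) \<and>
          disjoint_family_on (\<lambda>(a, b). {a<..<b}) P \<and> (\<Sum>(a, b)\<in>P. b - a) < \<delta> \<longrightarrow>
          (\<Sum>(a, b)\<in>P. dist (f a) (f b)) < \<epsilon>"
  proof (intro exI[of _ "\<epsilon> / M"] conjI allI impI)
    show "\<epsilon> / M > 0" using \<open>\<epsilon> > 0\<close> M by simp
  next
    fix P assume P: "finite P \<and> (\<forall>(a, b)\<in>P. a \<le> b \<and> {a..b} \<subseteq> K) \<and>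
          disjoint_family_on (\<lambda>(a, b). {a<..<b}) P \<and> (\<Sum>(a, b)\<in>P. b - a) < \<epsilon> / M"
    have "(\<Sum>(a, b)\<in>P. dist (f a) (f b)) \<le> (\<Sum>(a, b)\<in>P. M * (b - a))"
    proof (rule sum_mono, clarify)
      fix a b assume "(a, b) \<in> P"
      then have "a \<le> b" "a \<in> K" "b \<in> K" using P by force+
      then have "dist (f a) (f b) \<le> L * (b - a)" using assms[of a b] by simp
      also have "\<dots> \<le> M * (b - a)" using M \<open>a \<le> b\<close> by (intro mult_right_mono) auto
      finally show "dist (f a) (f b) \<le> M * (b - a)" .
    qed
    also have "\<dots> = M * (\<Sum>(a, b)\<in>P. b - a)" by (simp add: sum_distrib_left case_prod_unfold)
    also have "\<dots> < M * (\<epsilon> / M)" using P M by (intro mult_strict_left_mono) auto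
    finally show "(\<Sum>(a, b)\<in>P. dist (f a) (f b)) < \<epsilon>" using M by simp
  qed
qed

lemma abs_continuous_on_diff:
  fixes f g :: "real \<Rightarrow> 'a::real_normed_vector"
  assumes f: "abs_continuous_on K f" and g: "abs_continuous_on K g"
  shows "abs_continuous_on K (\<lambda>x. f x - g x)"
  unfolding abs_continuous_on_def
proof (intro allI impI)
  fix \<epsilon> :: real assume "\<epsilon> > 0"
  then have e2: "\<epsilon> / 2 > 0" by simp
  obtain d1 where d1: "d1 > 0" "variation_below K f (\<epsilon> / 2) d1"
      using abs_continuous_onD[OF f e2] by blast
  obtain d2 where d2: "d2 > 0" "variation_below K g (\<epsilon> / 2) d2"
      using abs_continuous_onD[OF g e2] by blast
  show "\<exists>\<delta>>0. \<forall>P. finite P \<and> (\<forall>(a, b)\<in>P. a \<le> b \<and> {a..b} \<subseteq> K) \<and>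
          disjoint_family_on (\<lambda>(a, b). {a<..<b}) P \<and> (\<Sum>(a, b)\<in>P. b - a) < \<delta> \<longrightarrow>
          (\<Sum>(a, b)\<in>P. dist (f a - g a) (f b - g b)) < \<epsilon>"
  proof (intro exI[of _ "min d1 d2"] conjI allI impI)
    show "min d1 d2 > 0" using d1 d2 by simp
  next
    fix P assume P: "finite P \<and> (\<forall>(a, b)\<in>P. a \<le> b \<and> {a..b} \<subseteq> K) \<and>
          disjoint_family_on (\<lambda>(a, b). {a<..<b}) P \<and> (\<Sum>(a, b)\<in>P. b - a) < min d1 d2"
    have "(\<Sum>(a, b)\<in>P. dist (f a - g a) (f b - g b))
        \<le> (\<Sum>(a, b)\<in>P. dist (f a) (f b) + dist (g a) (g b))"
    proof (rule sum_mono, clarify)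
      fix a b
      show "dist (f a - g a) (f b - g b) \<le> dist (f a) (f b) + dist (g a) (g b)"
        using norm_triangle_ineq4[of "f a - f b" "g a - g b"] by (simp add: dist_norm algebra_simps)
    qed
    also have "\<dots> = (\<Sum>(a, b)\<in>P. dist (f a) (f b)) + (\<Sum>(a, b)\<in>P. dist (g a) (g b))"
      by (simp add: sum.distrib case_prod_unfold)
    also have "\<dots> < \<epsilon> / 2 + \<epsilon> / 2"
      by (intro add_strict_mono variation_belowD[OF d1(2)] variation_belowD[OF d2(2)]) (use P in auto)
    finally show "(\<Sum>(a, b)\<in>P. dist (f a - g a) (f b - g b)) < \<epsilon>" by simp
  qed
qed

lemma abs_continuous_imp_continuous_on:
  assumes f: "abs_continuous_on {a..b} f"
  shows "continuous_on {a..b} f"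
  unfolding continuous_on_iff
proof (intro ballI allI impI)
  fix x e :: real assume x: "x \<in> {a..b}" and "e > 0"
  obtain d where d: "d > 0" "variation_below {a..b} f e d"
      using abs_continuous_onD[OF f \<open>e > 0\<close>] by blast
  show "\<exists>d>0. \<forall>x'\<in>{a..b}. dist x' x < d \<longrightarrow> dist (f x') (f x) < e"
  proof (intro exI[of _ d] conjI ballI impI)
    fix y assume y: "y \<in> {a..b}" "dist y x < d"
    define u v where "u = min x y" and "v = max x y"
    have uv: "u \<le> v" "u \<in> {a..b}" "v \<in> {a..b}" "v - u < d"
      using x y by (auto simp: u_def v_def dist_real_def)
    have "(\<Sum>(a, b) \<in> {(u, v)}. dist (f a) (f b)) < e"
      by (rule variation_belowD[OF d(2)]) (use uv in \<open>auto simp: disjoint_family_on_def\<close>)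
    then show "dist (f y) (f x) < e"
      by (cases "x \<le> y") (simp_all add: u_def v_def dist_commute)
  qed (use d in auto)
qed

text \<open>Cousin's lemma supplies a division fine for a gauge that is small at the points of \<open>E\<close>
  (absolute continuity controls the total increment there) and that makes difference quotients
  small elsewhere.\<close>

lemma abs_continuous_zero_derivative_imp_const:
  fixes f :: "real \<Rightarrow> 'a::real_normed_vector"
  assumes ac: "abs_continuous_on {a..b} f" and E: "negligible E" and ab: "a \<le> b"
    and der: "\<And>x. x \<in> {a<..<b} - E \<Longrightarrow> (f has_vector_derivative 0) (at x)"
  shows "f a = f b"
proof -
  have "norm (f b - f a) \<le> \<epsilon> + \<epsilon> * (b - a)" if "\<epsilon> > 0" for \<epsilon> :: real
  proof -
    obtain d where d: "d > 0" "variation_below {a..b} f \<epsilon> d"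
      using abs_continuous_onD[OF ac \<open>\<epsilon> > 0\<close>] by blast
    define E' where "E' = E \<union> {a, b}"
    have E': "negligible E'" unfolding E'_def using E by auto
    obtain U where U: "open U" "E' \<subseteq> U" "U - E' \<in> lmeasurable" "emeasure lebesgue (U - E') < ennreal d"
      using sets_lebesgue_outer_open[OF negligible_imp_sets[OF E'] \<open>d > 0\<close>] by blast
    have U2: "U \<in> lmeasurable" "measure lebesgue U < d"
    proof -
      have sU: "U \<in> sets lebesgue" using U(1) by simp
      have "E' \<in> null_sets lebesgue" using E' by (simp add: negligible_iff_null_sets)
      then have "emeasure lebesgue (U - E') = emeasure lebesgue U"
        by (rule emeasure_Diff_null_set) (rule sU)
      then have em: "emeasure lebesgue U < ennreal d" using U(4) by simp
      then show lm: "U \<in> lmeasurable" using sU by (intro fmeasurableI) (auto intro: less_trans)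
      show "measure lebesgue U < d" using em \<open>d > 0\<close>
        by (simp add: emeasure_eq_measure2[OF lm] ennreal_less_iff)
    qed
    have ex: "\<exists>r>0. (x \<in> E' \<longrightarrow> ball x r \<subseteq> U) \<and>
            (x \<in> {a..b} - E' \<longrightarrow> (\<forall>y. \<bar>y - x\<bar> < r \<longrightarrow> norm (f y - f x) \<le> \<epsilon> * \<bar>y - x\<bar>))" for x
    proof (cases "x \<in> E'")
      case True
      then have "x \<in> U" using U(2) by blast
      then obtain s where "s > 0" "ball x s \<subseteq> U" using openE[OF U(1)] by blast
      then show ?thesis using True by blast
    next
      case False
      show ?thesis
      proof (cases "x \<in> {a..b}")
        case True
        then have "x \<in> {a<..<b} - E" using False by (auto simp: E'_def)
        then have "(f has_vector_derivative 0) (at x)" by (rule der)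
        then have "\<forall>e>0. \<exists>d>0. \<forall>y. norm (y - x) < d \<longrightarrow>
            norm (f y - f x - (y - x) *\<^sub>R 0) \<le> e * norm (y - x)"
          unfolding has_vector_derivative_def has_derivative_at_alt by auto
        then obtain r where "r > 0" "\<forall>y. norm (y - x) < r \<longrightarrow> norm (f y - f x) \<le> \<epsilon> * norm (y - x)"
          using \<open>\<epsilon> > 0\<close> by fastforce
        then show ?thesis using False by auto
      qed (use False in \<open>auto intro: exI[of _ 1]\<close>)
    qed
    obtain r where r: "\<And>x. r x > 0" "\<And>x. x \<in> E' \<Longrightarrow> ball x (r x) \<subseteq> U"
       "\<And>x y. x \<in> {a..b} - E' \<Longrightarrow> \<bar>y - x\<bar> < r x \<Longrightarrow> norm (f y - f x) \<le> \<epsilon> * \<bar>y - x\<bar>"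
      using ex by metis
    have "gauge (\<lambda>x. ball x (r x))" using r(1) by (auto simp: gauge_def)
    then obtain p where p: "p tagged_division_of {a..b}" "(\<lambda>x. ball x (r x)) fine p"
      using fine_division_exists_real by blast
    have finp: "finite p" using tagged_division_ofD(1)[OF p(1)] .
    have K: "\<exists>u v. K = {u..v} \<and> u \<le> v \<and> Inf K = u \<and> Sup K = v \<and> x \<in> {u..v} \<and> {u..v} \<subseteq> {a..b} \<and> {u..v} \<subseteq> ball x (r x)"
      if xK: "(x, K) \<in> p" for x K
    proof -
      obtain u v where uv: "K = cbox u v" using tagged_division_ofD(4)[OF p(1) xK] by blast
      moreover have "x \<in> K" "K \<subseteq> {a..b}" using tagged_division_ofD(2,3)[OF p(1) that] by blast+
      moreover have "K \<subseteq> ball x (r x)" using p(2) that by (auto simp: fine_def)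
      ultimately show ?thesis by (intro exI[of _ u] exI[of _ v]) auto
    qed
    define p1 where "p1 = {xk \<in> p. fst xk \<in> E'}"
    define p2 where "p2 = {xk \<in> p. fst xk \<notin> E'}"
    have pp: "p = p1 \<union> p2" "p1 \<inter> p2 = {}" "finite p1" "finite p2" using finp by (auto simp: p1_def p2_def)
    have "f b - f a = (\<Sum>(x, K)\<in>p. f (Sup K) - f (Inf K))"
      using additive_tagged_division_1[OF ab p(1), of f] by simp
    also have "norm \<dots> \<le> (\<Sum>(x, K)\<in>p. norm (f (Sup K) - f (Inf K)))"
      by (rule order_trans[OF norm_sum]) (auto intro!: sum_mono)
    also have "\<dots> = (\<Sum>(x, K)\<in>p1. norm (f (Sup K) - f (Inf K))) + (\<Sum>(x, K)\<in>p2. norm (f (Sup K) - f (Inf K)))"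
      using pp by (simp add: sum.union_disjoint)
    also have "(\<Sum>(x, K)\<in>p2. norm (f (Sup K) - f (Inf K))) \<le> (\<Sum>(x, K)\<in>p2. \<epsilon> * (Sup K - Inf K))"
    proof (rule sum_mono, clarify)
      fix x K assume "(x, K) \<in> p2"
      then have xK: "(x, K) \<in> p" "x \<notin> E'" by (auto simp: p2_def)
      obtain u v where uv: "K = {u..v}" "u \<le> v" "Inf K = u" "Sup K = v" "x \<in> {u..v}" "{u..v} \<subseteq> {a..b}" "{u..v} \<subseteq> ball x (r x)"
        using K[OF xK(1)] by blast
      have x: "x \<in> {a..b} - E'" using uv xK by auto
      have "u \<in> {u..v}" "v \<in> {u..v}" using uv by auto
      then have "u \<in> ball x (r x)" "v \<in> ball x (r x)" using uv(7) by blast+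
      then have "norm (f u - f x) \<le> \<epsilon> * \<bar>u - x\<bar>" "norm (f v - f x) \<le> \<epsilon> * \<bar>v - x\<bar>"
        by (auto intro!: r(3)[OF x] simp: dist_real_def)
      moreover have "norm (f v - f u) \<le> norm (f v - f x) + norm (f u - f x)"
        using norm_triangle_ineq4[of "f v - f x" "f u - f x"] by simp
      ultimately have "norm (f v - f u) \<le> \<epsilon> * \<bar>u - x\<bar> + \<epsilon> * \<bar>v - x\<bar>" by linarith
      also have "\<dots> = \<epsilon> * (v - u)" using uv by (simp add: algebra_simps)
      finally show "norm (f (Sup K) - f (Inf K)) \<le> \<epsilon> * (Sup K - Inf K)" using uv by simp
    qed
    also have "\<dots> \<le> (\<Sum>(x, K)\<in>p. \<epsilon> * (Sup K - Inf K))"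
      by (rule sum_mono2) (use finp \<open>\<epsilon> > 0\<close> K in \<open>force simp: p2_def\<close>)+
    also have "\<dots> = \<epsilon> * (b - a)"
      using additive_tagged_division_1[OF ab p(1), of "\<lambda>x. x"]
      by (simp add: sum_distrib_left[symmetric] case_prod_unfold)
    also have "(\<Sum>(x, K)\<in>p1. norm (f (Sup K) - f (Inf K))) < \<epsilon>"
    proof -
      define h where "h = (\<lambda>(x::real, K::real set). (Inf K, Sup K))"
      have inter: "{Inf K<..<Sup K} \<inter> {Inf K'<..<Sup K'} = {}"
        if xK: "(x, K) \<in> p" "(x', K') \<in> p" "(x, K) \<noteq> (x', K')" for x K x' K'
      proof -
        have "interior K \<inter> interior K' = {}" using tagged_division_ofD(5)[OF p(1) xK] by blast
        moreover obtain u v where "K = {u..v}" "Inf K = u" "Sup K = v" using K[OF xK(1)] by blast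
        moreover obtain u' v' where "K' = {u'..v'}" "Inf K' = u'" "Sup K' = v'" using K[OF xK(2)] by blast
        ultimately show ?thesis by simp
      qed
      have deg: "Inf K = Sup K" if "xk \<in> p1" "xk' \<in> p1" "xk \<noteq> xk'" "h xk = h xk'" "xk = (x, K)" for xk xk' x K
        using inter[of x K "fst xk'" "snd xk'"] that K[of x K] by (auto simp: p1_def h_def case_prod_unfold)
      have reindex: "(\<Sum>(x, K)\<in>p1. F (Inf K) (Sup K)) = (\<Sum>(u, v)\<in>h ` p1. F u v)"
        if "\<And>u. F u u = 0" for F :: "real \<Rightarrow> real \<Rightarrow> real"
      proof -
        have "(\<Sum>(u, v)\<in>h ` p1. F u v) = sum ((\<lambda>(u, v). F u v) \<circ> h) p1"
        proof (rule sum.reindex_nontrivial)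
          fix xk xk' assume *: "xk \<in> p1" "xk' \<in> p1" "xk \<noteq> xk'" "h xk = h xk'"
          obtain x K where "xk = (x, K)" by (cases xk)
          then show "(\<lambda>(u, v). F u v) (h xk) = 0"
            using deg[OF *, of x K] that by (simp add: h_def)
        qed (rule pp)
        then show ?thesis by (simp add: h_def case_prod_unfold)
      qed
      have disj: "disjoint_family_on (\<lambda>(a, b). {a<..<b}) (h ` p1)"
        unfolding disjoint_family_on_def
      proof (intro ballI impI)
        fix m n assume *: "m \<in> h ` p1" "n \<in> h ` p1" "m \<noteq> n"
        obtain x K x' K' where "(x, K) \<in> p1" "m = h (x, K)" "(x', K') \<in> p1" "n = h (x', K')"
          using * by fastforce
        then show "(case m of (a, b) \<Rightarrow> {a<..<b}) \<inter> (case n of (a, b) \<Rightarrow> {a<..<b}) = {}"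
          using inter[of x K x' K'] \<open>m \<noteq> n\<close> by (auto simp: h_def p1_def)
      qed
      have hp1: "u \<le> v \<and> {u..v} \<subseteq> {a..b} \<and> {u..v} \<subseteq> U" if uv: "(u, v) \<in> h ` p1" for u v
      proof -
        from uv obtain x K where xK: "(x, K) \<in> p" "x \<in> E'" "(u, v) = h (x, K)"
          by (auto simp: p1_def)
        from K[OF xK(1)] obtain u' v' where uv': "u' \<le> v'" "Inf K = u'" "Sup K = v'"
          "{u'..v'} \<subseteq> {a..b}" "{u'..v'} \<subseteq> ball x (r x)" by blast
        have "u = u'" "v = v'" using xK(3) uv' by (auto simp: h_def)
        then show ?thesis using uv' r(2)[OF xK(2)] by blast
      qed
      have "(\<Sum>(u, v)\<in>h ` p1. dist (f u) (f v)) < \<epsilon>"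
      proof (rule variation_belowD[OF d(2)])
        show "finite (h ` p1)" using pp by simp
        show "u \<le> v \<and> {u..v} \<subseteq> {a..b}" if "(u, v) \<in> h ` p1" for u v
          using hp1[OF that] by blast
        have "(\<Sum>(u, v)\<in>h ` p1. v - u) = (\<Sum>w\<in>h ` p1. measure lebesgue ((\<lambda>(u, v). {u<..<v}) w))"
          by (rule sum.cong) (use hp1 in auto)
        also have "\<dots> = measure lebesgue (\<Union>w\<in>h ` p1. (\<lambda>(u, v). {u<..<v}) w)"
        proof (rule measure_finite_Union[symmetric])
          show "finite (h ` p1)" using pp by simp
          show "disjoint_family_on (\<lambda>(u, v). {u<..<v}) (h ` p1)" by (rule disj)
          show "emeasure lebesgue (case w of (u, v) \<Rightarrow> {u<..<v}) \<noteq> \<infinity>" if "w \<in> h ` p1" for w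
            using hp1[of "fst w" "snd w"] that by (simp add: case_prod_unfold)
        qed (auto simp: case_prod_unfold)
        also have "\<dots> \<le> measure lebesgue U"
        proof (rule measure_mono_fmeasurable)
          have "{u<..<v} \<subseteq> U" if "(u, v) \<in> h ` p1" for u v
            using hp1[OF that] greaterThanLessThan_subseteq_atLeastAtMost_iff[of u v u v] by blast
          then show "(\<Union>w\<in>h ` p1. (\<lambda>(u, v). {u<..<v}) w) \<subseteq> U"
            by (intro UN_least) (simp add: case_prod_unfold)
          show "(\<Union>w\<in>h ` p1. (\<lambda>(u, v). {u<..<v}) w) \<in> sets lebesgue"
            by (intro sets.finite_UN) (use pp in \<open>auto simp: case_prod_unfold\<close>)
        qed (rule U2)
        also have "\<dots> < d" by (rule U2)
        finally show "(\<Sum>(u, v)\<in>h ` p1. v - u) < d" .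
      qed (rule disj)
      moreover have "(\<Sum>(u, v)\<in>h ` p1. dist (f u) (f v)) = (\<Sum>(x, K)\<in>p1. dist (f (Inf K)) (f (Sup K)))"
        by (rule reindex[symmetric]) simp
      ultimately show ?thesis by (simp add: dist_norm norm_minus_commute case_prod_unfold)
    qed
    finally show ?thesis by simp
  qed
  note * = this
  have "norm (f b - f a) \<le> 0"
  proof (rule field_le_epsilon)
    fix e :: real assume "e > 0"
    have "norm (f b - f a) \<le> e / (1 + (b - a)) + e / (1 + (b - a)) * (b - a)"
      by (rule *) (use \<open>e > 0\<close> ab in auto)
    also have "\<dots> = e / (1 + (b - a)) * (1 + (b - a))" by (simp only: distrib_left mult_1_right)
    also have "\<dots> = e" using ab by simp
    finally show "norm (f b - f a) \<le> 0 + e" by simp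
  qed
  then show ?thesis by simp
qed

lemma lipschitz_of_bounded_vector_derivative:
  fixes f :: "real \<Rightarrow> 'a::real_normed_vector"
  assumes der: "\<And>x. x \<in> {a..b} \<Longrightarrow> (f has_vector_derivative f' x) (at x within {a..b})"
    and bd: "\<And>x. x \<in> {a..b} \<Longrightarrow> norm (f' x) \<le> L" and xy: "x \<in> {a..b}" "y \<in> {a..b}"
  shows "norm (f x - f y) \<le> L * \<bar>x - y\<bar>"
proof -
  have "norm (f x - f y) \<le> L * norm (x - y)"
  proof (rule differentiable_bound[of "{a..b}" f "\<lambda>x h. h *\<^sub>R f' x"])
    fix u assume u: "u \<in> {a..b}"
    show "(f has_derivative (\<lambda>h. h *\<^sub>R f' u)) (at u within {a..b})"
      using der[OF u] by (simp add: has_vector_derivative_def)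
    have "onorm (\<lambda>h. h *\<^sub>R f' u) = norm (f' u)"
      using onorm_scaleR_left[of "\<lambda>h::real. h" "f' u"] by (simp add: onorm_id)
    then show "onorm (\<lambda>h. h *\<^sub>R f' u) \<le> L" using bd[OF u] by simp
  qed (use xy in auto)
  then show ?thesis by simp
qed

text \<open>The difference of \<open>y\<close> and an antiderivative of \<open>G\<close> is absolutely continuous and has derivative zero
  almost everywhere.\<close>

lemma abs_continuous_ftc:
  fixes y :: "real \<Rightarrow> 'a::euclidean_space"
  assumes ac: "abs_continuous_on {a..b} y" and E: "negligible E" and ab: "a \<le> b"
    and G: "continuous_on {a..b} G"
    and der: "\<And>x. x \<in> {a<..<b} - E \<Longrightarrow> (y has_vector_derivative G x) (at x)"
  shows "y b - y a = integral {a..b} G"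
proof -
  define \<Gamma> where "\<Gamma> = (\<lambda>x. integral {a..x} G)"
  have d\<Gamma>: "(\<Gamma> has_vector_derivative G x) (at x within {a..b})" if "x \<in> {a..b}" for x
    unfolding \<Gamma>_def by (rule integral_has_vector_derivative[OF G that])
  obtain L where L: "\<And>x. x \<in> {a..b} \<Longrightarrow> norm (G x) \<le> L"
    using compact_imp_bounded[OF compact_continuous_image[OF G compact_Icc]]
    unfolding bounded_iff by blast
  have ac\<Gamma>: "abs_continuous_on {a..b} \<Gamma>"
    using lipschitz_of_bounded_vector_derivative[OF d\<Gamma> L]
    by (intro lipschitz_imp_abs_continuous_on[where L = L]) (simp add: dist_norm)
  have "y a - \<Gamma> a = y b - \<Gamma> b"
  proof (rule abs_continuous_zero_derivative_imp_const[OF abs_continuous_on_diff[OF ac ac\<Gamma>] E ab])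
    fix x assume x: "x \<in> {a<..<b} - E"
    then have "(\<Gamma> has_vector_derivative G x) (at x)"
      using d\<Gamma>[of x] by (auto simp: at_within_Icc_at)
    from has_vector_derivative_diff[OF der[OF x] this]
    show "((\<lambda>x. y x - \<Gamma> x) has_vector_derivative 0) (at x)" by simp
  qed
  then show ?thesis by (simp add: \<Gamma>_def)
qed

text \<open>Every point of the complement lies in a maximal gap. The gaps are enumerated by the rational numbers that
  they contain; a gap that occurred before is replaced by an empty interval, so that the enumerated intervals
  are disjoint.\<close>

lemma complementary_gaps:
  fixes Z :: "real set"
  assumes Z: "closed Z" "a \<in> Z" "b \<in> Z" "Z \<subseteq> {a..b}"
  obtains L R :: "nat \<Rightarrow> real" where
    "\<And>n. L n \<le> R n" "disjoint_family (\<lambda>n. {L n<..<R n})" "\<And>n. {L n<..<R n} \<inter> Z = {}"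
    "{a..b} - Z \<subseteq> (\<Union>n. {L n<..<R n})" "\<And>n. {L n<..<R n} \<subseteq> {a..b}" "\<And>n. L n < R n \<Longrightarrow> L n \<in> Z"
proof -
  have bdd: "bdd_above Z" "bdd_below Z" using Z(4) by (auto intro: bdd_above_mono bdd_below_mono)
  have "\<exists>l r. l \<in> Z \<and> r \<in> Z \<and> l < z \<and> z < r \<and> {l<..<r} \<inter> Z = {}" if z: "z \<in> {a..b} - Z" for z
  proof -
    have l: "Sup (Z \<inter> {..z}) \<in> Z \<inter> {..z}"
      by (rule closed_contains_Sup) (use z Z bdd in \<open>auto intro!: closed_Int\<close>)
    have r: "Inf (Z \<inter> {z..}) \<in> Z \<inter> {z..}"
      by (rule closed_contains_Inf) (use z Z bdd in \<open>auto intro!: closed_Int\<close>)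
    have "x \<notin> Z" if "x \<in> {Sup (Z \<inter> {..z})<..<Inf (Z \<inter> {z..})}" for x
    proof
      assume "x \<in> Z"
      show False
      proof (cases "x \<le> z")
        case True
        then have "x \<le> Sup (Z \<inter> {..z})" using \<open>x \<in> Z\<close> by (intro cSup_upper) auto
        then show False using that by simp
      next
        case False
        then have "Inf (Z \<inter> {z..}) \<le> x" using \<open>x \<in> Z\<close> by (intro cInf_lower) auto
        then show False using that by simp
      qed
    qed
    then show ?thesis using l r z
      by (intro exI[of _ "Sup (Z \<inter> {..z})"] exI[of _ "Inf (Z \<inter> {z..})"]) (auto simp: less_le)
  qed
  then obtain l r where lr: "\<And>z. z \<in> {a..b} - Z \<Longrightarrow>
      l z \<in> Z \<and> r z \<in> Z \<and> l z < z \<and> z < r z \<and> {l z<..<r z} \<inter> Z = {}" by metis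
  have same: "l w = l z \<and> r w = r z"
    if z: "z \<in> {a..b} - Z" and w: "w \<in> {a..b} - Z" and i: "w \<in> {l z<..<r z}" for z w
  proof -
    note A = lr[OF z] and B = lr[OF w]
    have "l w \<notin> {l z<..<r z}" "l z \<notin> {l w<..<r w}" "r w \<notin> {l z<..<r z}" "r z \<notin> {l w<..<r w}"
      using A B by auto
    then show ?thesis using A B i by auto
  qed
  define q where "q = from_nat_into (\<rat> :: real set)"
  have q: "range q = \<rat>" unfolding q_def
    by (rule range_from_nat_into) (use countable_rat in auto)
  define new where "new n \<longleftrightarrow> q n \<in> {a..b} - Z \<and> (\<forall>m<n. q m \<in> {a..b} - Z \<longrightarrow> l (q m) \<noteq> l (q n))" for n
  define L where "L n = (if new n then l (q n) else 0)" for n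
  define R where "R n = (if new n then r (q n) else 0)" for n
  show ?thesis
  proof
    show "L n \<le> R n" for n using lr[of "q n"] by (auto simp: L_def R_def new_def)
    show "{L n<..<R n} \<inter> Z = {}" for n using lr[of "q n"] by (auto simp: L_def R_def new_def)
    have LR: "L n \<in> Z \<and> R n \<in> Z" if "L n < R n" for n
      using lr[of "q n"] that by (auto simp: L_def R_def new_def split: if_splits)
    then show "L n < R n \<Longrightarrow> L n \<in> Z" for n by blast
    show sub: "{L n<..<R n} \<subseteq> {a..b}" for n
    proof (cases "L n < R n")
      case True
      then have "L n \<in> {a..b}" "R n \<in> {a..b}" using LR Z(4) by blast+
      then show ?thesis by auto
    qed auto
    show "disjoint_family (\<lambda>n. {L n<..<R n})"
      unfolding disjoint_family_on_def
    proof (intro ballI impI, rule ccontr)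
      fix m n assume "m \<noteq> n" and "{L m<..<R m} \<inter> {L n<..<R n} \<noteq> {}"
      then obtain x where x: "x \<in> {L m<..<R m}" "x \<in> {L n<..<R n}" by blast
      then have new: "new m" "new n" by (auto simp: L_def R_def split: if_splits)
      then have qm: "q m \<in> {a..b} - Z" and qn: "q n \<in> {a..b} - Z" by (auto simp: new_def)
      have xm: "x \<in> {l (q m)<..<r (q m)}" and xn: "x \<in> {l (q n)<..<r (q n)}"
        using x new by (auto simp: L_def R_def)
      have "x \<in> {a..b}" using x sub by blast
      moreover have "x \<notin> Z" using xm lr[OF qm] by blast
      ultimately have xZ: "x \<in> {a..b} - Z" by blast
      have "l (q m) = l (q n)" using same[OF qm xZ xm] same[OF qn xZ xn] by simp
      moreover have "m < n \<or> n < m" using \<open>m \<noteq> n\<close> by auto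
      ultimately show False using new qm qn unfolding new_def by metis
    qed
    show "{a..b} - Z \<subseteq> (\<Union>n. {L n<..<R n})"
    proof
      fix z assume z: "z \<in> {a..b} - Z"
      obtain x where x: "x \<in> \<rat>" "l z < x" "x < r z"
        using Rats_dense_in_real[of "l z" "r z"] lr[OF z] by auto
      then have xi: "x \<in> {l z<..<r z}" by simp
      have xZ: "x \<in> {a..b} - Z" using lr[OF z] xi Z(4) by force
      define P where "P n \<longleftrightarrow> q n \<in> {a..b} - Z \<and> l (q n) = l x" for n
      obtain n0 where "q n0 = x" using x q by (metis imageE)
      then have "P n0" using xZ by (simp add: P_def)
      then have P: "P (LEAST n. P n)" by (rule LeastI)
      define n where "n = (LEAST n. P n)"
      have qn: "q n \<in> {a..b} - Z" "l (q n) = l x" using P by (auto simp: P_def n_def)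
      have "new n" unfolding new_def
      proof (intro conjI allI impI)
        fix m assume "m < n" "q m \<in> {a..b} - Z"
        then show "l (q m) \<noteq> l (q n)" using not_less_Least[of m P] qn by (auto simp: n_def P_def)
      qed (use qn in auto)
      have "l x = l z" "r x = r z" using same[OF z xZ xi] by auto
      have lz: "l (q n) = l z" using qn \<open>l x = l z\<close> by simp
      have "r (q n) = r z"
      proof -
        have "r z \<notin> {l (q n)<..<r (q n)}" "r (q n) \<notin> {l z<..<r z}"
          using lr[OF z] lr[OF qn(1)] by auto
        then show ?thesis using lr[OF z] lr[OF qn(1)] lz by auto
      qed
      then have "z \<in> {L n<..<R n}" using \<open>new n\<close> lz lr[OF z] by (simp add: L_def R_def)
      then show "z \<in> (\<Union>n. {L n<..<R n})" by blast
    qed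
  qed
qed

text \<open>For each \<open>N\<close>, blow up every gap of \<open>Z\<close> by the factor \<open>1 + 2 * N\<close>. The lengths of the blown up gaps are summable,
  so by the Borel-Cantelli lemma almost every point lies in only finitely many of them, and the remaining
  gaps are shorter than \<open>1 / N\<close> times their distance to the point.\<close>

lemma infdist_closed_little_o_ae:
  fixes Z :: "real set"
  assumes Z: "closed Z" "Z \<subseteq> {a..b}"
  shows "negligible {x \<in> Z. \<not> (\<forall>\<epsilon>>0. \<exists>\<delta>>0. \<forall>z. \<bar>z - x\<bar> < \<delta> \<longrightarrow> infdist z Z \<le> \<epsilon> * \<bar>z - x\<bar>)}"
    (is "negligible ?bad")
proof (cases "Z = {}")
  case False
  have bdd: "bdd_above Z" "bdd_below Z" using Z(2) by (auto intro: bdd_above_mono bdd_below_mono)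
  define p where "p = Inf Z" define q where "q = Sup Z"
  have pq: "p \<in> Z" "q \<in> Z" using closed_contains_Inf closed_contains_Sup Z(1) False bdd
    by (auto simp: p_def q_def)
  have Zpq: "Z \<subseteq> {p..q}" using bdd by (auto simp: p_def q_def intro: cInf_lower cSup_upper)
  obtain L R :: "nat \<Rightarrow> real" where LR: "\<And>n. L n \<le> R n" "disjoint_family (\<lambda>n. {L n<..<R n})"
    "\<And>n. {L n<..<R n} \<inter> Z = {}" "{p..q} - Z \<subseteq> (\<Union>n. {L n<..<R n})" "\<And>n. {L n<..<R n} \<subseteq> {p..q}"
    "\<And>n. L n < R n \<Longrightarrow> L n \<in> Z"
    by (rule complementary_gaps[OF Z(1) pq Zpq]) auto
  have summ: "summable (\<lambda>n. R n - L n)"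
  proof (rule bounded_imp_summable)
    fix n
    have "(\<Sum>k\<le>n. R k - L k) = (\<Sum>k\<le>n. measure lborel {L k<..<R k})"
      using LR(1) by simp
    also have "\<dots> = measure lborel (\<Union>k\<in>{..n}. {L k<..<R k})"
    proof (rule measure_finite_Union[symmetric])
      show "disjoint_family_on (\<lambda>k. {L k<..<R k}) {..n}"
        using LR(2) by (rule disjoint_family_on_mono[rotated]) simp
    qed (use LR(1) in auto)
    also have "\<dots> \<le> measure lborel {p..q}"
      by (rule measure_mono_fmeasurable) (use LR(5) pq Zpq in \<open>auto simp: fmeasurable_def\<close>)
    finally show "(\<Sum>k\<le>n. R k - L k) \<le> measure lborel {p..q}" .
  qed (use LR(1) in simp)
  \<comment> \<open>Points whose distance to the \<open>n\<close>-th gap is at most \<open>N\<close> times its length.\<close>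
  define F where "F N n = {L n - real N * (R n - L n)..R n + real N * (R n - L n)}" for N n
  have F: "L n - real N * (R n - L n) \<le> R n + real N * (R n - L n)" for N n
  proof -
    have "0 \<le> real N * (R n - L n)" using LR(1)[of n] by simp
    then show ?thesis using LR(1)[of n] by linarith
  qed
  have ae: "AE x in lborel. \<forall>N. eventually (\<lambda>n. x \<notin> F N n) sequentially"
    unfolding AE_all_countable
  proof
    fix N
    have "AE x in lborel. eventually (\<lambda>n. x \<in> space lborel - F N n) sequentially"
    proof (rule borel_cantelli_AE1)
      show "summable (\<lambda>n. measure lborel (F N n))"
        using summable_mult[OF summ, of "1 + 2 * real N"] F
        by (simp add: F_def algebra_simps)
    qed (use F in \<open>auto simp: F_def\<close>)
    then show "AE x in lborel. eventually (\<lambda>n. x \<notin> F N n) sequentially" by simp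
  qed
  have "countable ({p, q} \<union> range L \<union> range R)" by simp
  then have "AE x in lborel. x \<notin> {p, q} \<union> range L \<union> range R"
    by (intro AE_not_in countable_imp_null_set_lborel)
  with ae have "AE x in lborel. x \<notin> ?bad"
  proof eventually_elim
    case (elim x)
    show ?case
    proof
      assume "x \<in> ?bad"
      then have xZ: "x \<in> Z" and "\<exists>\<epsilon>>0. \<forall>\<delta>>0. \<exists>z. \<bar>z - x\<bar> < \<delta> \<and> \<epsilon> * \<bar>z - x\<bar> < infdist z Z"
        by (auto simp: not_le)
      then obtain \<epsilon> where \<epsilon>: "\<epsilon> > 0" "\<And>\<delta>. \<delta> > 0 \<Longrightarrow> \<exists>z. \<bar>z - x\<bar> < \<delta> \<and> \<epsilon> * \<bar>z - x\<bar> < infdist z Z"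
        by blast
      obtain N where N: "1 / \<epsilon> < real N" using reals_Archimedean2 by blast
      then have N0: "real N > 0" using \<epsilon>(1) by (meson divide_pos_pos less_trans zero_less_one)
      obtain n0 where n0: "\<And>n. n \<ge> n0 \<Longrightarrow> x \<notin> F N n"
        using elim(1) unfolding eventually_sequentially by blast
      have xpq: "p < x" "x < q" using xZ Zpq elim(2) by (auto simp: less_le)
      define d where "d n = max (L n - x) (x - R n)" for n
      have d: "d n > 0" for n
      proof -
        have "x \<notin> {L n<..<R n}" "x \<noteq> L n" "x \<noteq> R n" using LR(3) xZ elim(2) by blast+
        then show ?thesis by (auto simp: d_def less_max_iff_disj)
      qed
      define \<delta> where "\<delta> = Min ({x - p, q - x} \<union> d ` {..<n0})"
      have "\<delta> > 0" using xpq d by (auto simp: \<delta>_def)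
      then obtain z where z: "\<bar>z - x\<bar> < \<delta>" "\<epsilon> * \<bar>z - x\<bar> < infdist z Z" using \<epsilon>(2) by blast
      have "\<delta> \<le> x - p" "\<delta> \<le> q - x" unfolding \<delta>_def by (rule Min_le; simp)+
      then have "z \<in> {p..q}" using z(1) by auto
      have "z \<notin> Z"
      proof
        assume "z \<in> Z"
        then have "infdist z Z = 0" by simp
        then show False using z(2) \<epsilon>(1) by (simp add: mult_less_0_iff)
      qed
      then obtain n where n: "z \<in> {L n<..<R n}" using \<open>z \<in> {p..q}\<close> LR(4) by blast
      have "\<not> n < n0"
      proof
        assume "n < n0"
        then have "\<delta> \<le> d n" unfolding \<delta>_def by (intro Min_le) auto
        then show False using z(1) n by (auto simp: d_def split: if_splits simp: max_def)
      qed
      then have "x \<notin> F N n" using n0 by simp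
      then have "real N * (R n - L n) \<le> \<bar>z - x\<bar>" using n by (auto simp: F_def)
      moreover have "infdist z Z \<le> R n - L n"
      proof -
        have "infdist z Z \<le> dist z (L n)" by (rule infdist_le) (use LR(6)[of n] n in auto)
        then show ?thesis using n by (simp add: dist_real_def)
      qed
      ultimately have "real N * infdist z Z \<le> \<bar>z - x\<bar>"
        using N0 by (smt (verit) mult_left_mono)
      moreover have "\<bar>z - x\<bar> \<le> real N * (\<epsilon> * \<bar>z - x\<bar>)"
      proof -
        have "1 \<le> real N * \<epsilon>" using N \<epsilon>(1) by (simp add: field_simps)
        then show ?thesis using mult_right_mono[of 1 "real N * \<epsilon>" "\<bar>z - x\<bar>"] by (simp add: mult.assoc)
      qed
      moreover have "real N * (\<epsilon> * \<bar>z - x\<bar>) < real N * infdist z Z"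
        using z(2) N0 by simp
      ultimately show False by linarith
    qed
  qed
  then have "AE x in lebesgue. x \<notin> ?bad" by (rule AE_completion)
  then show ?thesis
    by (simp add: negligible_iff_null_sets AE_iff_null_sets eventually_ae_filter)
       (metis (no_types, lifting) completion.complete2 mem_Collect_eq subsetI)
qed simp

text \<open>The one value that the derivative takes wherever it does not exist.\<close>

lemma vector_derivative_eq_default:
  assumes "\<nexists>d. (f has_vector_derivative d) F"
  shows "vector_derivative f F = (SOME d. False)"
  using assms by (simp add: vector_derivative_def)

text \<open>Where \<open>y\<close> is not differentiable, the equation says that \<open>G\<close> has the default value of an undefined
  derivative; in the application \<open>G\<close> is linear in \<open>y\<close>, and then \<open>y\<close> lies there on a smooth curve \<open>c\<close>. Hence
  the set \<open>Z\<close> on which \<open>G\<close> has this value is harmless: it is closed, \<open>y\<close> solves the equation between its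
  points, and therefore \<open>y\<close> is differentiable, with the derivative of \<open>c\<close>, at almost every point of \<open>Z\<close>.
  So \<open>y\<close> is differentiable almost everywhere and the fundamental theorem of calculus applies. The finite set
  \<open>X\<close> takes up the points at which the curve has a pole.\<close>

theorem classical_solution_of_ae_solution:
  fixes y G c :: "real \<Rightarrow> 'a::euclidean_space"
  assumes ac: "locally_abs_continuous_on {p<..<q} y"
    and G: "continuous_on {p<..<q} G"
    and ae: "AE z in lebesgue_on {p<..<q}. vector_derivative y (at z) = G z"
    and X: "finite X"
    and c: "\<And>z. z \<in> {p<..<q} - X \<Longrightarrow> (c has_vector_derivative c' z) (at z)"
      "continuous_on ({p<..<q} - X) c'"
    and yc: "\<And>z. \<lbrakk>z \<in> {p<..<q} - X; G z = (SOME d. False)\<rbrakk> \<Longrightarrow> y z = c z"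
    and z: "z \<in> {p<..<q}"
  shows "(y has_vector_derivative G z) (at z)"
proof -
  have "AE z in lebesgue. z \<in> {p<..<q} \<longrightarrow> vector_derivative y (at z) = G z"
    using ae by (simp add: AE_restrict_space_iff)
  then obtain E where E: "E \<in> null_sets lebesgue"
      "{z. \<not> (z \<in> {p<..<q} \<longrightarrow> vector_derivative y (at z) = G z)} \<subseteq> E"
    unfolding eventually_ae_filter by auto
  then have E: "negligible E" "\<And>z. z \<in> {p<..<q} - E \<Longrightarrow> vector_derivative y (at z) = G z"
    by (auto simp: negligible_iff_null_sets)
  define D0 :: 'a where "D0 = (SOME d. False)"
  define a where "a = (p + z) / 2" define b where "b = (z + q) / 2"
  have ab: "p < a" "a < z" "z < b" "b < q" using z by (auto simp: a_def b_def)
  have sub: "{a..b} \<subseteq> {p<..<q}" using ab by auto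
  have acab: "abs_continuous_on {u..v} y" if "a \<le> u" "u \<le> v" "v \<le> b" for u v
  proof -
    have "u \<le> v \<and> {u..v} \<subseteq> {p<..<q}" using that ab by auto
    then show ?thesis using ac unfolding locally_abs_continuous_on_def by blast
  qed
  have Gab: "continuous_on {u..v} G" if "a \<le> u" "v \<le> b" for u v
    by (rule continuous_on_subset[OF G]) (use that ab in auto)
  define Z where "Z = {x \<in> {a..b}. G x = D0}"
  have Z: "closed Z" "Z \<subseteq> {a..b}"
  proof -
    have "closed ({a..b} \<inter> G -` {D0})"
      by (rule continuous_closed_preimage[OF Gab]) auto
    then show "closed Z" by (simp add: Z_def vimage_def Int_def)
  qed (auto simp: Z_def)
  have diff: "(y has_vector_derivative G x) (at x)" if "x \<in> {a..b} - E" "x \<notin> Z" for x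
  proof -
    have x: "x \<in> {p<..<q} - E" using that sub by blast
    have "\<exists>d. (y has_vector_derivative d) (at x)"
    proof (rule ccontr)
      assume "\<nexists>d. (y has_vector_derivative d) (at x)"
      then have "G x = D0" using vector_derivative_eq_default[of y "at x"] E(2)[OF x] by (simp add: D0_def)
      then show False using that by (simp add: Z_def)
    qed
    then obtain d where d: "(y has_vector_derivative d) (at x)" by blast
    then have "vector_derivative y (at x) = d" by (rule vector_derivative_at)
    then show ?thesis using E(2)[OF x] d by simp
  qed
  define B where "B = {x \<in> Z. \<not> (\<forall>\<epsilon>>0. \<exists>\<delta>>0. \<forall>z. \<bar>z - x\<bar> < \<delta> \<longrightarrow> infdist z Z \<le> \<epsilon> * \<bar>z - x\<bar>)}"
  have B: "negligible B" unfolding B_def by (rule infdist_closed_little_o_ae[OF Z])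
  obtain K1 where K1: "\<And>x. x \<in> {a..b} \<Longrightarrow> norm (G x) \<le> K1"
    using compact_imp_bounded[OF compact_continuous_image[OF Gab[OF order_refl order_refl] compact_Icc]]
    unfolding bounded_iff by blast
  have "norm (G z) \<le> K1" using ab by (intro K1) auto
  then have K1_0: "K1 \<ge> 0" by (rule order_trans[OF norm_ge_zero])
  \<comment> \<open>At almost every point of \<open>Z\<close> the function \<open>y\<close> has the same tangent as \<open>c\<close>: between two
    consecutive points of \<open>Z\<close> it solves the equation, so it cannot move away from \<open>c\<close> by more
    than a multiple of the distance to \<open>Z\<close>.\<close>
  have diffZ: "(y has_vector_derivative c' x) (at x)" if x: "x \<in> {a<..<b} - X" "x \<in> Z - B" for x
  proof -
    have "open ({a<..<b} - X)" using X by (intro open_Diff finite_imp_closed) auto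
    then obtain d where d: "d > 0" "ball x d \<subseteq> {a<..<b} - X" using x(1) openE by blast
    define r where "r = d / 2"
    have r: "r > 0" "{x - r..x + r} \<subseteq> {a<..<b} - X"
      using d by (auto simp: r_def subset_iff dist_real_def)
    have rab: "w \<in> {a<..<b} \<and> w \<notin> X" if "w \<in> {x - r..x + r}" for w using r(2) that by blast
    have rsub: "{x - r..x + r} \<subseteq> {p<..<q} - X"
    proof
      fix w assume "w \<in> {x - r..x + r}"
      from rab[OF this] show "w \<in> {p<..<q} - X" using ab by auto
    qed
    obtain K2 where K2: "\<And>w. w \<in> {x - r..x + r} \<Longrightarrow> norm (c' w) \<le> K2"
      using compact_imp_bounded[OF compact_continuous_image[OF continuous_on_subset[OF c(2) rsub] compact_Icc]]
      unfolding bounded_iff by blast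
    have "x \<in> {x - r..x + r}" using r by simp
    then have "norm (c' x) \<le> K2" by (rule K2)
    then have K2_0: "K2 \<ge> 0" by (rule order_trans[OF norm_ge_zero])
    have est: "norm (y w - c w) \<le> (K1 + K2) * infdist w Z" if w: "\<bar>w - x\<bar> < r / 2" for w
    proof -
      have "Z \<noteq> {}" using x by blast
      then obtain v where v: "v \<in> Z" "infdist w Z = dist w v"
        using infdist_attains_inf[OF Z(1)] by metis
      have "infdist w Z \<le> dist w x" using x by (intro infdist_le) blast
      then have "dist w v \<le> dist w x" using v(2) by simp
      then have vx: "\<bar>v - x\<bar> < r" using w unfolding dist_real_def by linarith
      have "\<bar>w - x\<bar> < r" using w by linarith
      then have vr: "v \<in> {x - r..x + r}" "w \<in> {x - r..x + r}" using vx by auto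
      have free: "\<xi> \<notin> Z" if "\<xi> \<in> {min v w<..<max v w}" for \<xi>
      proof
        assume "\<xi> \<in> Z"
        then have "infdist w Z \<le> dist w \<xi>" by (rule infdist_le)
        then show False using that v by (auto simp: dist_real_def min_def max_def split: if_splits)
      qed
      have vw: "a \<le> min v w" "max v w \<le> b" using rab[OF vr(1)] rab[OF vr(2)] by auto
      have "y (max v w) - y (min v w) = integral {min v w..max v w} G"
        by (rule abs_continuous_ftc[OF acab E(1) _ Gab]) (use vw free in \<open>auto intro!: diff\<close>)
      moreover have "norm (integral {min v w..max v w} G) \<le> K1 * (max v w - min v w)"
      proof (rule integral_bound)
        show "norm (G t) \<le> K1" if "t \<in> {min v w..max v w}" for t
          by (rule K1) (use that vw in \<open>meson atLeastAtMost_iff order_trans\<close>)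
      qed (use vw Gab in auto)
      ultimately have "norm (y (max v w) - y (min v w)) \<le> K1 * (max v w - min v w)" by simp
      then have 1: "norm (y v - y w) \<le> K1 * \<bar>w - v\<bar>"
        by (cases "v \<le> w") (simp_all add: norm_minus_commute[of "y v"])
      have 2: "norm (c v - c w) \<le> K2 * \<bar>v - w\<bar>"
      proof (rule lipschitz_of_bounded_vector_derivative[OF _ K2 vr])
        fix w assume "w \<in> {x - r..x + r}"
        then have "w \<in> {p<..<q} - X" using rsub by blast
        then show "(c has_vector_derivative c' w) (at w within {x - r..x + r})"
          using has_vector_derivative_at_within[OF c(1)] by blast
      qed
      have "y v = c v" using yc[OF subsetD[OF rsub vr(1)]] v(1) by (simp add: Z_def D0_def)
      then have "y w - c w = (c v - c w) - (y v - y w)" by simp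
      then have "norm (y w - c w) \<le> norm (c v - c w) + norm (y v - y w)"
        using norm_triangle_ineq4[of "c v - c w" "y v - y w"] by simp
      also have "\<dots> \<le> (K1 + K2) * \<bar>w - v\<bar>" using 1 2 by (simp add: algebra_simps abs_minus_commute)
      finally show ?thesis using v by (simp add: dist_real_def)
    qed
    have yx: "y x = c x" using yc[of x] x ab by (auto simp: Z_def D0_def)
    have yc0: "((\<lambda>w. y w - c w) has_vector_derivative 0) (at x)"
      unfolding has_vector_derivative_def has_derivative_at_alt
    proof (intro conjI allI impI)
      fix e :: real assume "e > 0"
      then have "e / (K1 + K2 + 1) > 0" using K1_0 K2_0 by simp
      then obtain \<delta> where \<delta>: "\<delta> > 0" "\<And>w. \<bar>w - x\<bar> < \<delta> \<Longrightarrow> infdist w Z \<le> e / (K1 + K2 + 1) * \<bar>w - x\<bar>"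
        using x(2) unfolding B_def by blast
      show "\<exists>d>0. \<forall>w. norm (w - x) < d \<longrightarrow>
          norm (y w - c w - (y x - c x) - (w - x) *\<^sub>R 0) \<le> e * norm (w - x)"
      proof (intro exI[of _ "min \<delta> (r / 2)"] conjI allI impI)
        fix w assume w: "norm (w - x) < min \<delta> (r / 2)"
        have "norm (y w - c w) \<le> (K1 + K2) * infdist w Z" using est w by simp
        also have "\<dots> \<le> (K1 + K2 + 1) * infdist w Z" by (intro mult_right_mono infdist_nonneg) simp
        also have "\<dots> \<le> (K1 + K2 + 1) * (e / (K1 + K2 + 1) * \<bar>w - x\<bar>)"
          using \<delta>(2)[of w] w K1_0 K2_0 by (intro mult_left_mono) auto
        also have "\<dots> = e * \<bar>w - x\<bar>" using K1_0 K2_0 by simp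
        finally show "norm (y w - c w - (y x - c x) - (w - x) *\<^sub>R 0) \<le> e * norm (w - x)"
          using yx by simp
      qed (use \<delta> r in auto)
    qed (auto intro: bounded_linear_scaleR_left)
    have "x \<in> {p<..<q} - X" using x ab by auto
    from has_vector_derivative_add[OF yc0 c(1)[OF this]] show ?thesis by simp
  qed
  have N: "negligible (E \<union> X \<union> B)" using E(1) X B by (simp add: negligible_finite)
  have der: "(y has_vector_derivative G x) (at x)" if x: "x \<in> {a<..<b} - (E \<union> X \<union> B)" for x
  proof (cases "x \<in> Z")
    case True
    have "x \<in> {a<..<b} - X" "x \<in> Z - B" using True x by auto
    then have "(y has_vector_derivative c' x) (at x)" by (rule diffZ)
    moreover have "x \<in> {p<..<q} - E" using x ab by auto
    then have "vector_derivative y (at x) = G x" by (rule E(2))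
    ultimately show ?thesis using vector_derivative_at[of y "c' x" x] by simp
  next
    case False
    then show ?thesis using x by (intro diff) auto
  qed
  have eq: "y x = y a + integral {a..x} G" if "x \<in> {a..b}" for x
  proof -
    have "y x - y a = integral {a..x} G"
      by (rule abs_continuous_ftc[OF acab N _ Gab]) (use that in \<open>auto intro!: der\<close>)
    then show ?thesis by (simp add: algebra_simps)
  qed
  have "((\<lambda>x. y a + integral {a..x} G) has_vector_derivative G z) (at z within {a..b})"
  proof -
    have "((\<lambda>x. integral {a..x} G) has_vector_derivative G z) (at z within {a..b})"
      by (rule integral_has_vector_derivative[OF Gab]) (use ab in auto)
    from has_vector_derivative_add[OF has_vector_derivative_const this] show ?thesis by simp
  qed
  then have "(y has_vector_derivative G z) (at z within {a..b})"
    by (rule has_vector_derivative_transform[rotated 2]) (use ab in \<open>auto simp: eq[symmetric]\<close>)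
  then show ?thesis using ab by (simp add: at_within_Icc_at)
qed

section \<open>The canonical system and its Frobenius solution\<close>

definition diag_coeff :: "real \<Rightarrow> real \<Rightarrow> real \<Rightarrow> real" where
  "diag_coeff \<alpha> \<sigma> z = - \<alpha> / z + \<alpha> / (1 - z) + 2 * \<sigma>"

definition offdiag_coeff :: "real \<Rightarrow> real \<Rightarrow> real \<Rightarrow> real \<Rightarrow> real" where
  "offdiag_coeff c k0 k1 z = 2 * c + k0 / z + k1 / (1 - z)"

text \<open>The Hamiltonian system for real \<open>\<omega>\<close> has \<open>k1 = m0 = 0\<close>, and its reflection has \<open>k0 = m1 = 0\<close>. Allowing poles
  at both ends in both off-diagonal coefficients makes the family closed under reflection, so that only the
  point \<open>0\<close> has to be studied. The condition \<open>k0 * m0 = 0\<close> below keeps the exponents at \<open>0\<close> equal to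
  \<open>\<alpha>\<close> and \<open>- \<alpha>\<close>.\<close>

definition canonical_solution ::
  "real \<Rightarrow> real \<Rightarrow> real \<Rightarrow> real \<Rightarrow> real \<Rightarrow> real \<Rightarrow> real \<Rightarrow> (real \<Rightarrow> real) \<Rightarrow> (real \<Rightarrow> real) \<Rightarrow> bool" where
  "canonical_solution \<alpha> \<sigma> c k0 k1 m0 m1 f g \<longleftrightarrow>
     (\<forall>z\<in>{0<..<1}.
        (f has_real_derivative diag_coeff \<alpha> \<sigma> z * f z + offdiag_coeff c k0 k1 z * g z) (at z) \<and>
        (g has_real_derivative - offdiag_coeff c m0 m1 z * f z - diag_coeff \<alpha> \<sigma> z * g z) (at z))"

lemma canonical_solution_reflect:
  assumes "canonical_solution \<alpha> \<sigma> c k0 k1 m0 m1 f g"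
  shows "canonical_solution \<alpha> (- \<sigma>) c k1 k0 m1 m0 (\<lambda>z. f (1 - z)) (\<lambda>z. - g (1 - z))"
  unfolding canonical_solution_def
proof (intro ballI conjI)
  fix z :: real assume z: "z \<in> {0<..<1}"
  then have "1 - z \<in> {0<..<1}" by auto
  with assms have
    f: "(f has_real_derivative diag_coeff \<alpha> \<sigma> (1 - z) * f (1 - z) + offdiag_coeff c k0 k1 (1 - z) * g (1 - z)) (at (1 - z))" and
    g: "(g has_real_derivative - offdiag_coeff c m0 m1 (1 - z) * f (1 - z) - diag_coeff \<alpha> \<sigma> (1 - z) * g (1 - z)) (at (1 - z))"
    unfolding canonical_solution_def by blast+
  have d: "((\<lambda>z. 1 - z) has_real_derivative - 1) (at z)" by (auto intro!: derivative_eq_intros)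
  show "((\<lambda>z. f (1 - z)) has_real_derivative
      diag_coeff \<alpha> (- \<sigma>) z * f (1 - z) + offdiag_coeff c k1 k0 z * - g (1 - z)) (at z)"
    using DERIV_chain2[OF f d] z by (simp add: diag_coeff_def offdiag_coeff_def algebra_simps)
  show "((\<lambda>z. - g (1 - z)) has_real_derivative
      - offdiag_coeff c m1 m0 z * f (1 - z) - diag_coeff \<alpha> (- \<sigma>) z * - g (1 - z)) (at z)"
    using DERIV_minus[OF DERIV_chain2[OF g d]] z by (simp add: diag_coeff_def offdiag_coeff_def algebra_simps)
qed

context
  fixes \<alpha> :: real
begin

text \<open>The coefficients \<open>(a n, b n)\<close> of the factor of \<open>z powr \<alpha>\<close>, paired with their predecessors because
  multiplication by \<open>z * (1 - z)\<close> turns the system into a recursion of depth two. The initial value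
  is the eigenvector of the residue matrix for the exponent \<open>\<alpha>\<close>; the quotients are Cramer's rule for
  \<open>\<alpha> + n\<close> minus the residue matrix, whose determinant is \<open>n * (n + 2 * \<alpha>)\<close> when \<open>k0 * m0 = 0\<close>.\<close>

fun frobenius_coeffs :: "real \<Rightarrow> real \<Rightarrow> real \<Rightarrow> real \<Rightarrow> real \<Rightarrow> real \<Rightarrow> nat \<Rightarrow> (real \<times> real) \<times> (real \<times> real)" where
  "frobenius_coeffs \<sigma> c k0 k1 m0 m1 0 = ((k0, 2 * \<alpha>), (0, 0))"
| "frobenius_coeffs \<sigma> c k0 k1 m0 m1 (Suc n) =
    (let ((a1, b1), (a2, b2)) = frobenius_coeffs \<sigma> c k0 k1 m0 m1 n;
         r = (real n + 3 * \<alpha> + 2 * \<sigma>) * a1 + (2 * c + k1 - k0) * b1 - 2 * \<sigma> * a2 - 2 * c * b2;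
         s = (real n - \<alpha> - 2 * \<sigma>) * b1 - (2 * c + m1 - m0) * a1 + 2 * c * a2 + 2 * \<sigma> * b2;
         N = real (Suc n)
     in (((N * r + k0 * s) / (N * (N + 2 * \<alpha>)), ((N + 2 * \<alpha>) * s - m0 * r) / (N * (N + 2 * \<alpha>))), (a1, b1)))"

definition "frobenius_a \<sigma> c k0 k1 m0 m1 n = fst (fst (frobenius_coeffs \<sigma> c k0 k1 m0 m1 n))"
definition "frobenius_b \<sigma> c k0 k1 m0 m1 n = snd (fst (frobenius_coeffs \<sigma> c k0 k1 m0 m1 n))"
definition "frobenius_a' \<sigma> c k0 k1 m0 m1 n = fst (snd (frobenius_coeffs \<sigma> c k0 k1 m0 m1 n))"
definition "frobenius_b' \<sigma> c k0 k1 m0 m1 n = snd (snd (frobenius_coeffs \<sigma> c k0 k1 m0 m1 n))"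

end

text \<open>Grows like \<open>n powr D\<close>, so that the power series with these coefficients converges in the unit disc.\<close>

definition frobenius_majorant :: "real \<Rightarrow> real \<Rightarrow> nat \<Rightarrow> real" where
  "frobenius_majorant T D n = T * (\<Prod>k<n. 1 + D / real (Suc k))"

lemma frobenius_majorant_Suc:
  "frobenius_majorant T D (Suc n) = (1 + D / real (Suc n)) * frobenius_majorant T D n"
  by (simp add: frobenius_majorant_def)

lemma frobenius_majorant_nonneg: "0 \<le> T \<Longrightarrow> 0 \<le> D \<Longrightarrow> 0 \<le> frobenius_majorant T D n"
  unfolding frobenius_majorant_def by (intro mult_nonneg_nonneg prod_nonneg) auto

lemma frobenius_majorant_Suc_ge:
  "0 \<le> T \<Longrightarrow> 0 \<le> D \<Longrightarrow> frobenius_majorant T D n \<le> frobenius_majorant T D (Suc n)"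
  using mult_right_mono[of 1 "1 + D / real (Suc n)" "frobenius_majorant T D n"]
  by (simp add: frobenius_majorant_Suc frobenius_majorant_nonneg)

lemma summable_frobenius_majorant:
  assumes "0 \<le> T" "0 \<le> D" "\<bar>x\<bar> < 1"
  shows "summable (\<lambda>n. frobenius_majorant T D n * \<bar>x\<bar> ^ n)"
proof -
  define c where "c = (1 + \<bar>x\<bar>) / 2"
  have c: "\<bar>x\<bar> < c" "c < 1" using assms by (auto simp: c_def)
  obtain N where N: "D / (c - \<bar>x\<bar>) < real N" using reals_Archimedean2 by blast
  show ?thesis
  proof (rule summable_ratio_test[OF c(2)])
    fix n assume n: "n \<ge> N"
    have "D / (c - \<bar>x\<bar>) < real (Suc n)" using N n by simp
    then have "D / real (Suc n) \<le> c - \<bar>x\<bar>" using c(1) by (simp add: field_simps)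
    moreover have "D / real (Suc n) * \<bar>x\<bar> \<le> D / real (Suc n) * 1"
      using assms by (intro mult_left_mono) auto
    ultimately have "(1 + D / real (Suc n)) * \<bar>x\<bar> \<le> c" by (simp add: algebra_simps)
    then have "(1 + D / real (Suc n)) * \<bar>x\<bar> * (frobenius_majorant T D n * \<bar>x\<bar> ^ n)
         \<le> c * (frobenius_majorant T D n * \<bar>x\<bar> ^ n)"
      using assms by (intro mult_right_mono mult_nonneg_nonneg frobenius_majorant_nonneg) auto
    then show "norm (frobenius_majorant T D (Suc n) * \<bar>x\<bar> ^ Suc n)
         \<le> c * norm (frobenius_majorant T D n * \<bar>x\<bar> ^ n)"
      using assms frobenius_majorant_nonneg[OF assms(1,2)]
      by (simp add: frobenius_majorant_Suc abs_mult mult_ac)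
  qed
qed

lemma frobenius_recurrence:
  fixes \<alpha> \<sigma> c k0 k1 m0 m1 :: real
  defines "a \<equiv> frobenius_a \<alpha> \<sigma> c k0 k1 m0 m1" and "b \<equiv> frobenius_b \<alpha> \<sigma> c k0 k1 m0 m1"
    and "a' \<equiv> frobenius_a' \<alpha> \<sigma> c k0 k1 m0 m1" and "b' \<equiv> frobenius_b' \<alpha> \<sigma> c k0 k1 m0 m1"
  shows "a 0 = k0" "b 0 = 2 * \<alpha>" "a' 0 = 0" "b' 0 = 0" "a' (Suc n) = a n" "b' (Suc n) = b n"
    "a (Suc n) = (real (Suc n) * ((real n + 3 * \<alpha> + 2 * \<sigma>) * a n + (2 * c + k1 - k0) * b n - 2 * \<sigma> * a' n - 2 * c * b' n)
         + k0 * ((real n - \<alpha> - 2 * \<sigma>) * b n - (2 * c + m1 - m0) * a n + 2 * c * a' n + 2 * \<sigma> * b' n))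
         / (real (Suc n) * (real (Suc n) + 2 * \<alpha>))"
    "b (Suc n) = ((real (Suc n) + 2 * \<alpha>) * ((real n - \<alpha> - 2 * \<sigma>) * b n - (2 * c + m1 - m0) * a n + 2 * c * a' n + 2 * \<sigma> * b' n)
         - m0 * ((real n + 3 * \<alpha> + 2 * \<sigma>) * a n + (2 * c + k1 - k0) * b n - 2 * \<sigma> * a' n - 2 * c * b' n))
         / (real (Suc n) * (real (Suc n) + 2 * \<alpha>))"
  unfolding a_def b_def a'_def b'_def frobenius_a_def frobenius_b_def frobenius_a'_def frobenius_b'_def
  by (simp_all add: Let_def case_prod_unfold)

lemma frobenius_recurrence_lin:
  fixes \<alpha> \<sigma> c k0 k1 m0 m1 :: real
  defines "a \<equiv> frobenius_a \<alpha> \<sigma> c k0 k1 m0 m1" and "b \<equiv> frobenius_b \<alpha> \<sigma> c k0 k1 m0 m1"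
    and "a' \<equiv> frobenius_a' \<alpha> \<sigma> c k0 k1 m0 m1" and "b' \<equiv> frobenius_b' \<alpha> \<sigma> c k0 k1 m0 m1"
  assumes \<alpha>: "\<alpha> > 0" and km: "k0 * m0 = 0"
  shows "(real (Suc n) + 2 * \<alpha>) * a (Suc n) - k0 * b (Suc n)
      = (real n + 3 * \<alpha> + 2 * \<sigma>) * a n + (2 * c + k1 - k0) * b n - 2 * \<sigma> * a' n - 2 * c * b' n" (is ?A)
    and "real (Suc n) * b (Suc n) + m0 * a (Suc n)
      = (real n - \<alpha> - 2 * \<sigma>) * b n - (2 * c + m1 - m0) * a n + 2 * c * a' n + 2 * \<sigma> * b' n" (is ?B)
proof -
  define r where "r = (real n + 3 * \<alpha> + 2 * \<sigma>) * a n + (2 * c + k1 - k0) * b n - 2 * \<sigma> * a' n - 2 * c * b' n"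
  define s where "s = (real n - \<alpha> - 2 * \<sigma>) * b n - (2 * c + m1 - m0) * a n + 2 * c * a' n + 2 * \<sigma> * b' n"
  define N where "N = real (Suc n)"
  have N: "N > 0" "N + 2 * \<alpha> > 0" using \<alpha> by (auto simp: N_def)
  have eq: "a (Suc n) = (N * r + k0 * s) / (N * (N + 2 * \<alpha>))" "b (Suc n) = ((N + 2 * \<alpha>) * s - m0 * r) / (N * (N + 2 * \<alpha>))"
    unfolding r_def s_def N_def a_def b_def a'_def b'_def by (rule frobenius_recurrence)+
  have km': "k0 * (m0 * x) = 0" "m0 * (k0 * x) = 0" for x using km by auto
  define d where "d = N * (N + 2 * \<alpha>)"
  have d: "d \<noteq> 0" using N by (simp add: d_def)
  have ad: "a (Suc n) * d = N * r + k0 * s" and bd: "b (Suc n) * d = (N + 2 * \<alpha>) * s - m0 * r"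
    using d unfolding eq d_def[symmetric] by simp_all
  have "((N + 2 * \<alpha>) * a (Suc n) - k0 * b (Suc n)) * d = (N + 2 * \<alpha>) * (a (Suc n) * d) - k0 * (b (Suc n) * d)"
    by (simp add: algebra_simps)
  also have "\<dots> = r * d" unfolding ad bd by (simp add: algebra_simps km' d_def)
  finally have "(N + 2 * \<alpha>) * a (Suc n) - k0 * b (Suc n) = r" using d by simp
  then show ?A unfolding r_def N_def .
  have "(N * b (Suc n) + m0 * a (Suc n)) * d = N * (b (Suc n) * d) + m0 * (a (Suc n) * d)"
    by (simp add: algebra_simps)
  also have "\<dots> = s * d" unfolding ad bd by (simp add: algebra_simps km' d_def)
  finally have "N * b (Suc n) + m0 * a (Suc n) = s" using d by simp
  then show ?B unfolding s_def N_def .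
qed

text \<open>In the recursion the previous coefficients are multiplied by \<open>n + O(1)\<close> and the inverse matrix is \<open>O(1 / n)\<close>, so
  one step multiplies the bound by at most \<open>1 + 2 * D / n\<close>. The constants depend only on \<open>\<alpha>\<close> and
  on the bound \<open>B\<close> for the other parameters.\<close>

lemma frobenius_coeff_bound:
  fixes \<alpha> \<sigma> c k0 k1 m0 m1 :: real
  defines "a \<equiv> frobenius_a \<alpha> \<sigma> c k0 k1 m0 m1" and "b \<equiv> frobenius_b \<alpha> \<sigma> c k0 k1 m0 m1"
    and "a' \<equiv> frobenius_a' \<alpha> \<sigma> c k0 k1 m0 m1" and "b' \<equiv> frobenius_b' \<alpha> \<sigma> c k0 k1 m0 m1"
  assumes \<alpha>: "\<alpha> > 0" and B: "\<bar>\<sigma>\<bar> \<le> B" "\<bar>c\<bar> \<le> B" "\<bar>k0\<bar> \<le> B" "\<bar>k1\<bar> \<le> B" "\<bar>m0\<bar> \<le> B" "\<bar>m1\<bar> \<le> B"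
  defines "C \<equiv> 3 * \<alpha> + 10 * B"
  defines "D \<equiv> (1 + B) * 2 * C + B"
  shows "\<bar>a n\<bar> + \<bar>b n\<bar> \<le> frobenius_majorant (B + 2 * \<alpha>) (2 * D) n"
    and "\<bar>a' n\<bar> + \<bar>b' n\<bar> \<le> frobenius_majorant (B + 2 * \<alpha>) (2 * D) n"
proof -
  let ?M = "frobenius_majorant (B + 2 * \<alpha>) (2 * D)"
  have B0: "B \<ge> 0" using B(1) by linarith
  have C0: "C \<ge> 0" using B0 \<alpha> by (simp add: C_def)
  have D0: "D \<ge> 0" using B0 C0 by (simp add: D_def)
  have T0: "B + 2 * \<alpha> \<ge> 0" using B0 \<alpha> by simp
  have M0: "?M n \<ge> 0" for n using frobenius_majorant_nonneg T0 D0 by simp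
  have "\<bar>a n\<bar> + \<bar>b n\<bar> \<le> ?M n \<and> \<bar>a' n\<bar> + \<bar>b' n\<bar> \<le> ?M n"
  proof (induction n)
    case 0
    show ?case using B \<alpha> B0 frobenius_recurrence(1-4)[of \<alpha> \<sigma> c k0 k1 m0 m1]
      by (simp add: a_def b_def a'_def b'_def frobenius_majorant_def)
  next
    case (Suc n)
    define r where "r = (real n + 3 * \<alpha> + 2 * \<sigma>) * a n + (2 * c + k1 - k0) * b n - 2 * \<sigma> * a' n - 2 * c * b' n"
    define s where "s = (real n - \<alpha> - 2 * \<sigma>) * b n - (2 * c + m1 - m0) * a n + 2 * c * a' n + 2 * \<sigma> * b' n"
    define N where "N = real (Suc n)"
    have N: "N \<ge> 1" "N > 0" "N + 2 * \<alpha> \<ge> N" using \<alpha> by (auto simp: N_def)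
    have eq: "a (Suc n) = (N * r + k0 * s) / (N * (N + 2 * \<alpha>))" "b (Suc n) = ((N + 2 * \<alpha>) * s - m0 * r) / (N * (N + 2 * \<alpha>))"
      unfolding r_def s_def N_def a_def b_def a'_def b'_def by (rule frobenius_recurrence)+
    have prod: "\<bar>x * y\<bar> \<le> X * \<bar>y\<bar>" if "\<bar>x\<bar> \<le> X" for x y X :: real
      using that by (simp add: abs_mult mult_right_mono)
    have B': "- B \<le> \<sigma>" "\<sigma> \<le> B" "- B \<le> c" "c \<le> B" "- B \<le> k0" "k0 \<le> B" "- B \<le> k1" "k1 \<le> B"
      "- B \<le> m0" "m0 \<le> B" "- B \<le> m1" "m1 \<le> B" using B by (simp_all add: abs_le_iff)
    have tri1: "\<bar>w + x - y - v\<bar> \<le> W + X + Y + V"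
      and tri2: "\<bar>w - x + y + v\<bar> \<le> W + X + Y + V"
      if "\<bar>w\<bar> \<le> W" "\<bar>x\<bar> \<le> X" "\<bar>y\<bar> \<le> Y" "\<bar>v\<bar> \<le> V" for w x y v W X Y V :: real
      using that by linarith+
    have BC: "2 * B \<le> C" "4 * B \<le> C" "3 * \<alpha> + 2 * B \<le> C" using B0 \<alpha> by (auto simp: C_def)
    have "\<bar>(real n + 3 * \<alpha> + 2 * \<sigma>) * a n\<bar> \<le> (real n + C) * \<bar>a n\<bar>"
      "\<bar>(2 * c + k1 - k0) * b n\<bar> \<le> C * \<bar>b n\<bar>" "\<bar>2 * \<sigma> * a' n\<bar> \<le> C * \<bar>a' n\<bar>" "\<bar>2 * c * b' n\<bar> \<le> C * \<bar>b' n\<bar>"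
      by (rule prod, rule abs_leI; use B' BC \<alpha> in linarith)+
    then have "\<bar>r\<bar> \<le> (real n + C) * \<bar>a n\<bar> + C * \<bar>b n\<bar> + C * \<bar>a' n\<bar> + C * \<bar>b' n\<bar>"
      unfolding r_def by (rule tri1)
    then have r: "\<bar>r\<bar> \<le> real n * \<bar>a n\<bar> + C * (\<bar>a n\<bar> + \<bar>b n\<bar>) + C * (\<bar>a' n\<bar> + \<bar>b' n\<bar>)"
      by (simp add: algebra_simps)
    have "\<bar>(real n - \<alpha> - 2 * \<sigma>) * b n\<bar> \<le> (real n + C) * \<bar>b n\<bar>"
      "\<bar>(2 * c + m1 - m0) * a n\<bar> \<le> C * \<bar>a n\<bar>" "\<bar>2 * c * a' n\<bar> \<le> C * \<bar>a' n\<bar>" "\<bar>2 * \<sigma> * b' n\<bar> \<le> C * \<bar>b' n\<bar>"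
      by (rule prod, rule abs_leI; use B' BC \<alpha> in linarith)+
    then have "\<bar>s\<bar> \<le> (real n + C) * \<bar>b n\<bar> + C * \<bar>a n\<bar> + C * \<bar>a' n\<bar> + C * \<bar>b' n\<bar>"
      unfolding s_def by (rule tri2)
    then have s: "\<bar>s\<bar> \<le> real n * \<bar>b n\<bar> + C * (\<bar>a n\<bar> + \<bar>b n\<bar>) + C * (\<bar>a' n\<bar> + \<bar>b' n\<bar>)"
      by (simp add: algebra_simps)
    have "\<bar>r\<bar> + \<bar>s\<bar> \<le> real n * (\<bar>a n\<bar> + \<bar>b n\<bar>) + 2 * C * (\<bar>a n\<bar> + \<bar>b n\<bar>) + 2 * C * (\<bar>a' n\<bar> + \<bar>b' n\<bar>)"
      using r s by (simp add: algebra_simps)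
    also have "\<dots> \<le> real n * ?M n + 2 * C * ?M n + 2 * C * ?M n"
      using Suc C0 by (intro add_mono mult_left_mono) simp_all
    finally have rs: "\<bar>r\<bar> + \<bar>s\<bar> \<le> (real n + 4 * C) * ?M n" by (simp add: algebra_simps)
    have q: "\<bar>x\<bar> / (N * (N + 2 * \<alpha>)) \<le> \<bar>x\<bar> / (N * N)" for x
      using N by (intro divide_left_mono mult_left_mono) auto
    have k: "\<bar>k0 * s\<bar> \<le> B * \<bar>s\<bar>" "\<bar>m0 * r\<bar> \<le> B * \<bar>r\<bar>" by (rule prod, rule B)+
    have "\<bar>a (Suc n)\<bar> = \<bar>N * r + k0 * s\<bar> / (N * (N + 2 * \<alpha>))" using N eq by (simp add: abs_divide)
    also have "\<dots> \<le> \<bar>N * r + k0 * s\<bar> / (N * N)" by (rule q)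
    also have "\<dots> \<le> (N * \<bar>r\<bar> + B * \<bar>s\<bar>) / (N * N)"
    proof (rule divide_right_mono)
      have "\<bar>N * r + k0 * s\<bar> \<le> \<bar>N * r\<bar> + \<bar>k0 * s\<bar>" by (rule abs_triangle_ineq)
      also have "\<bar>N * r\<bar> = N * \<bar>r\<bar>" using N by (simp add: abs_mult)
      finally show "\<bar>N * r + k0 * s\<bar> \<le> N * \<bar>r\<bar> + B * \<bar>s\<bar>" using k by linarith
    qed simp
    finally have a: "\<bar>a (Suc n)\<bar> \<le> (N * \<bar>r\<bar> + B * \<bar>s\<bar>) / (N * N)" .
    have "b (Suc n) = s / N - m0 * r / (N * (N + 2 * \<alpha>))"
      using N unfolding eq by (simp add: diff_divide_distrib)
    then have "\<bar>b (Suc n)\<bar> \<le> \<bar>s / N\<bar> + \<bar>m0 * r / (N * (N + 2 * \<alpha>))\<bar>" by linarith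
    also have "\<bar>m0 * r / (N * (N + 2 * \<alpha>))\<bar> = \<bar>m0 * r\<bar> / (N * (N + 2 * \<alpha>))" using N by (simp add: abs_divide abs_mult)
    also have "\<dots> \<le> \<bar>m0 * r\<bar> / (N * N)" by (rule q)
    also have "\<dots> \<le> B * \<bar>r\<bar> / (N * N)" using k N by (intro divide_right_mono) auto
    also have "\<bar>s / N\<bar> = N * \<bar>s\<bar> / (N * N)" using N by (simp add: abs_divide)
    finally have b: "\<bar>b (Suc n)\<bar> \<le> N * \<bar>s\<bar> / (N * N) + B * \<bar>r\<bar> / (N * N)" by simp
    have "\<bar>a (Suc n)\<bar> + \<bar>b (Suc n)\<bar> \<le> (N + B) * (\<bar>r\<bar> + \<bar>s\<bar>) / (N * N)"
      using a b by (simp add: add_divide_distrib algebra_simps)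
    also have "\<dots> \<le> (N + B) * ((real n + 4 * C) * ?M n) / (N * N)"
      using N B0 rs by (intro divide_right_mono mult_left_mono) auto
    also have "\<dots> = ((N + B) * (real n + 4 * C) / (N * N)) * ?M n" by simp
    also have "\<dots> \<le> (1 + 2 * D / N) * ?M n"
    proof (rule mult_right_mono[OF _ M0])
      have "(N + B) * (real n + 4 * C) \<le> (N + B) * (N + 4 * C)"
        using B0 N by (intro mult_left_mono) (auto simp: N_def)
      also have "\<dots> = N * N + N * (4 * C + B) + 4 * B * C * 1" by (simp add: algebra_simps)
      also have "\<dots> \<le> N * N + N * (4 * C + B) + 4 * B * C * N"
        using N B0 C0 by (intro add_mono mult_left_mono order_refl) auto
      also have "\<dots> \<le> N * N + 2 * D * N" using N B0 by (simp add: D_def algebra_simps)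
      finally have "(N + B) * (real n + 4 * C) / (N * N) \<le> (N * N + 2 * D * N) / (N * N)"
        using N by (intro divide_right_mono) auto
      also have "\<dots> = 1 + 2 * D / N" using N by (simp add: add_divide_distrib)
      finally show "(N + B) * (real n + 4 * C) / (N * N) \<le> 1 + 2 * D / N" .
    qed
    also have "\<dots> = ?M (Suc n)" by (simp add: frobenius_majorant_Suc N_def)
    finally have 1: "\<bar>a (Suc n)\<bar> + \<bar>b (Suc n)\<bar> \<le> ?M (Suc n)" .
    have "a' (Suc n) = a n" "b' (Suc n) = b n"
      unfolding a_def b_def a'_def b'_def by (rule frobenius_recurrence)+
    moreover have "?M n \<le> ?M (Suc n)" using frobenius_majorant_Suc_ge T0 D0 by simp
    ultimately show ?case using 1 Suc by simp
  qed
  then show "\<bar>a n\<bar> + \<bar>b n\<bar> \<le> ?M n" "\<bar>a' n\<bar> + \<bar>b' n\<bar> \<le> ?M n" by auto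
qed

definition "frobenius_F \<alpha> \<sigma> c k0 k1 m0 m1 z = (\<Sum>n. frobenius_a \<alpha> \<sigma> c k0 k1 m0 m1 n * z ^ n)"
definition "frobenius_G \<alpha> \<sigma> c k0 k1 m0 m1 z = (\<Sum>n. frobenius_b \<alpha> \<sigma> c k0 k1 m0 m1 n * z ^ n)"

definition frobenius_bound :: "real \<Rightarrow> real \<Rightarrow> nat \<Rightarrow> real" where
  "frobenius_bound \<alpha> B = frobenius_majorant (B + 2 * \<alpha>) (2 * ((1 + B) * 2 * (3 * \<alpha> + 10 * B) + B))"

lemma frobenius_ab_le:
  assumes "\<alpha> > 0" "\<bar>\<sigma>\<bar> \<le> B" "\<bar>c\<bar> \<le> B" "\<bar>k0\<bar> \<le> B" "\<bar>k1\<bar> \<le> B" "\<bar>m0\<bar> \<le> B" "\<bar>m1\<bar> \<le> B"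
  shows "\<bar>frobenius_a \<alpha> \<sigma> c k0 k1 m0 m1 n\<bar> \<le> frobenius_bound \<alpha> B n"
    "\<bar>frobenius_b \<alpha> \<sigma> c k0 k1 m0 m1 n\<bar> \<le> frobenius_bound \<alpha> B n"
  using frobenius_coeff_bound(1)[OF assms, of n] unfolding frobenius_bound_def by linarith+

lemma summable_frobenius_bound:
  assumes "\<alpha> > 0" "B \<ge> 0" "\<bar>x\<bar> < 1"
  shows "summable (\<lambda>n. frobenius_bound \<alpha> B n * \<bar>x\<bar> ^ n)"
  unfolding frobenius_bound_def by (rule summable_frobenius_majorant) (use assms in auto)

lemma summable_frobenius:
  assumes \<alpha>: "\<alpha> > 0" and x: "\<bar>x\<bar> < (1::real)"
  shows "summable (\<lambda>n. frobenius_a \<alpha> \<sigma> c k0 k1 m0 m1 n * x ^ n)"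
    "summable (\<lambda>n. frobenius_b \<alpha> \<sigma> c k0 k1 m0 m1 n * x ^ n)"
proof -
  define B where "B = \<bar>\<sigma>\<bar> + \<bar>c\<bar> + \<bar>k0\<bar> + \<bar>k1\<bar> + \<bar>m0\<bar> + \<bar>m1\<bar>"
  have B: "\<bar>\<sigma>\<bar> \<le> B" "\<bar>c\<bar> \<le> B" "\<bar>k0\<bar> \<le> B" "\<bar>k1\<bar> \<le> B" "\<bar>m0\<bar> \<le> B" "\<bar>m1\<bar> \<le> B" "B \<ge> 0"
    by (simp_all add: B_def)
  note S = summable_frobenius_bound[OF \<alpha> B(7) x]
  show "summable (\<lambda>n. frobenius_a \<alpha> \<sigma> c k0 k1 m0 m1 n * x ^ n)"
    by (rule summable_comparison_test'[OF S, of 0])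
       (simp add: abs_mult power_abs mult_right_mono frobenius_ab_le(1)[OF \<alpha> B(1-6)])
  show "summable (\<lambda>n. frobenius_b \<alpha> \<sigma> c k0 k1 m0 m1 n * x ^ n)"
    by (rule summable_comparison_test'[OF S, of 0])
       (simp add: abs_mult power_abs mult_right_mono frobenius_ab_le(2)[OF \<alpha> B(1-6)])
qed

lemma frobenius_FG_bound:
  assumes \<alpha>: "\<alpha> > 0"
  obtains K where "K \<ge> 0" "\<And>\<sigma> c k0 k1 m0 m1 z. \<lbrakk>\<bar>\<sigma>\<bar> \<le> B; \<bar>c\<bar> \<le> B; \<bar>k0\<bar> \<le> B; \<bar>k1\<bar> \<le> B; \<bar>m0\<bar> \<le> B; \<bar>m1\<bar> \<le> B; \<bar>z\<bar> \<le> 1 / 2\<rbrakk>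
     \<Longrightarrow> \<bar>frobenius_F \<alpha> \<sigma> c k0 k1 m0 m1 z\<bar> \<le> K \<and> \<bar>frobenius_G \<alpha> \<sigma> c k0 k1 m0 m1 z\<bar> \<le> K"
proof -
  define K where "K = (\<Sum>n. frobenius_bound \<alpha> \<bar>B\<bar> n * \<bar>1 / 2\<bar> ^ n)"
  have S: "summable (\<lambda>n. frobenius_bound \<alpha> \<bar>B\<bar> n * \<bar>1 / 2\<bar> ^ n)"
    by (rule summable_frobenius_bound) (use \<alpha> in auto)
  have nn: "frobenius_bound \<alpha> \<bar>B\<bar> n \<ge> 0" for n
    unfolding frobenius_bound_def by (rule frobenius_majorant_nonneg) (use \<alpha> in auto)
  show ?thesis
  proof
    show "K \<ge> 0" unfolding K_def using nn by (intro suminf_nonneg[OF S]) auto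
  next
    fix \<sigma> c k0 k1 m0 m1 z :: real
    assume le: "\<bar>\<sigma>\<bar> \<le> B" "\<bar>c\<bar> \<le> B" "\<bar>k0\<bar> \<le> B" "\<bar>k1\<bar> \<le> B" "\<bar>m0\<bar> \<le> B" "\<bar>m1\<bar> \<le> B" "\<bar>z\<bar> \<le> 1 / 2"
    then have "\<bar>B\<bar> = B" by linarith
    note ab = frobenius_ab_le[OF \<alpha> le(1-6)]
    have zn: "\<bar>z\<bar> ^ n \<le> \<bar>1 / 2\<bar> ^ n" for n using le(7) by (intro power_mono) auto
    have le_K: "\<bar>\<Sum>n. d n * z ^ n\<bar> \<le> K" if d: "\<And>n. \<bar>d n\<bar> \<le> frobenius_bound \<alpha> B n" for d
      unfolding K_def
    proof (rule norm_suminf_le[of "\<lambda>n. d n * z ^ n", unfolded real_norm_def])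
      show "\<bar>d n * z ^ n\<bar> \<le> frobenius_bound \<alpha> \<bar>B\<bar> n * \<bar>1 / 2\<bar> ^ n" for n
        unfolding \<open>\<bar>B\<bar> = B\<close> abs_mult power_abs using d zn nn[unfolded \<open>\<bar>B\<bar> = B\<close>] by (intro mult_mono) auto
    qed (rule S)
    show "\<bar>frobenius_F \<alpha> \<sigma> c k0 k1 m0 m1 z\<bar> \<le> K \<and> \<bar>frobenius_G \<alpha> \<sigma> c k0 k1 m0 m1 z\<bar> \<le> K"
      unfolding frobenius_F_def frobenius_G_def by (intro conjI le_K ab)
  qed
qed

lemma frobenius_FG_0: "frobenius_F \<alpha> \<sigma> c k0 k1 m0 m1 0 = k0" "frobenius_G \<alpha> \<sigma> c k0 k1 m0 m1 0 = 2 * \<alpha>"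
  by (simp_all add: frobenius_F_def frobenius_G_def frobenius_recurrence)

text \<open>Each coefficient is a rational function of the parameters without poles, and the common majorant permits to
  take the limit under the sum.\<close>

lemma frobenius_FG_tendsto:
  assumes \<alpha>: "\<alpha> > 0" and lim: "(\<sigma> \<longlongrightarrow> \<sigma>') F" "(c \<longlongrightarrow> c') F" "(k0 \<longlongrightarrow> k0') F" "(k1 \<longlongrightarrow> k1') F"
      "(m0 \<longlongrightarrow> m0') F" "(m1 \<longlongrightarrow> m1') F" and z: "\<bar>z\<bar> < 1"
  shows "((\<lambda>s. frobenius_F \<alpha> (\<sigma> s) (c s) (k0 s) (k1 s) (m0 s) (m1 s) z) \<longlongrightarrow> frobenius_F \<alpha> \<sigma>' c' k0' k1' m0' m1' z) F"
    "((\<lambda>s. frobenius_G \<alpha> (\<sigma> s) (c s) (k0 s) (k1 s) (m0 s) (m1 s) z) \<longlongrightarrow> frobenius_G \<alpha> \<sigma>' c' k0' k1' m0' m1' z) F"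
proof -
  have coeffs: "((\<lambda>s. frobenius_a \<alpha> (\<sigma> s) (c s) (k0 s) (k1 s) (m0 s) (m1 s) n) \<longlongrightarrow> frobenius_a \<alpha> \<sigma>' c' k0' k1' m0' m1' n) F \<and>
      ((\<lambda>s. frobenius_b \<alpha> (\<sigma> s) (c s) (k0 s) (k1 s) (m0 s) (m1 s) n) \<longlongrightarrow> frobenius_b \<alpha> \<sigma>' c' k0' k1' m0' m1' n) F \<and>
      ((\<lambda>s. frobenius_a' \<alpha> (\<sigma> s) (c s) (k0 s) (k1 s) (m0 s) (m1 s) n) \<longlongrightarrow> frobenius_a' \<alpha> \<sigma>' c' k0' k1' m0' m1' n) F \<and>
      ((\<lambda>s. frobenius_b' \<alpha> (\<sigma> s) (c s) (k0 s) (k1 s) (m0 s) (m1 s) n) \<longlongrightarrow> frobenius_b' \<alpha> \<sigma>' c' k0' k1' m0' m1' n) F" for n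
  proof (induction n)
    case 0
    show ?case using lim by (simp add: frobenius_recurrence)
  next
    case (Suc n)
    have "real (Suc n) * (real (Suc n) + 2 * \<alpha>) \<noteq> 0" using \<alpha> by auto
    with Suc lim show ?case unfolding frobenius_recurrence by (intro conjI tendsto_intros) auto
  qed
  define B where "B = \<bar>\<sigma>'\<bar> + \<bar>c'\<bar> + \<bar>k0'\<bar> + \<bar>k1'\<bar> + \<bar>m0'\<bar> + \<bar>m1'\<bar> + 1"
  have ev: "eventually (\<lambda>s. \<bar>h s\<bar> \<le> B) F" if "(h \<longlongrightarrow> h') F" "\<bar>h'\<bar> + 1 \<le> B" for h h'
    using order_tendstoD(2)[OF tendsto_rabs[OF that(1)], of B] that(2)
    by (auto elim!: eventually_mono)
  have evB: "eventually (\<lambda>s. \<bar>\<sigma> s\<bar> \<le> B \<and> \<bar>c s\<bar> \<le> B \<and> \<bar>k0 s\<bar> \<le> B \<and> \<bar>k1 s\<bar> \<le> B \<and> \<bar>m0 s\<bar> \<le> B \<and> \<bar>m1 s\<bar> \<le> B) F"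
    using ev[OF lim(1)] ev[OF lim(2)] ev[OF lim(3)] ev[OF lim(4)] ev[OF lim(5)] ev[OF lim(6)]
    by (auto simp: B_def eventually_conj_iff)
  have S: "summable (\<lambda>n. frobenius_bound \<alpha> B n * \<bar>z\<bar> ^ n)"
    by (rule summable_frobenius_bound) (use \<alpha> z in \<open>auto simp: B_def\<close>)
  have tannery: "((\<lambda>s. \<Sum>n. d s n * z ^ n) \<longlongrightarrow> (\<Sum>n. d' n * z ^ n)) F"
    if lim: "\<And>n. ((\<lambda>s. d s n) \<longlongrightarrow> d' n) F" and le: "eventually (\<lambda>s. \<forall>n. \<bar>d s n\<bar> \<le> frobenius_bound \<alpha> B n) F" for d d'
  proof (cases "F = bot")
    case False
    have "eventually (\<lambda>(n, s). norm (d s n * z ^ n) \<le> frobenius_bound \<alpha> B n * \<bar>z\<bar> ^ n) (at_top \<times>\<^sub>F F)"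
      using eventually_prodI[OF eventually_True le]
      by eventually_elim (auto simp: abs_mult power_abs intro!: mult_right_mono)
    moreover have "((\<lambda>s. d s n * z ^ n) \<longlongrightarrow> d' n * z ^ n) F" for n
      by (intro tendsto_intros lim)
    ultimately show ?thesis
      using tannerys_theorem[of "\<lambda>n s. d s n * z ^ n", OF _ _ S False] by simp
  qed simp
  show "((\<lambda>s. frobenius_F \<alpha> (\<sigma> s) (c s) (k0 s) (k1 s) (m0 s) (m1 s) z) \<longlongrightarrow> frobenius_F \<alpha> \<sigma>' c' k0' k1' m0' m1' z) F"
    unfolding frobenius_F_def
    by (rule tannery) (use coeffs evB in \<open>auto elim!: eventually_mono intro: frobenius_ab_le \<alpha>\<close>)
  show "((\<lambda>s. frobenius_G \<alpha> (\<sigma> s) (c s) (k0 s) (k1 s) (m0 s) (m1 s) z) \<longlongrightarrow> frobenius_G \<alpha> \<sigma>' c' k0' k1' m0' m1' z) F"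
    unfolding frobenius_G_def
    by (rule tannery) (use coeffs evB in \<open>auto elim!: eventually_mono intro: frobenius_ab_le \<alpha>\<close>)
qed

lemma sums_shift:
  fixes u :: "nat \<Rightarrow> real"
  assumes "(\<lambda>n. u n * z ^ n) sums U" "v 0 = 0" "\<And>n. v (Suc n) = u n"
  shows "(\<lambda>n. v n * z ^ n) sums (z * U)"
proof -
  have "(\<lambda>n. z * (u n * z ^ n)) sums (z * U)" by (rule sums_mult[OF assms(1)])
  then have "(\<lambda>n. v (Suc n) * z ^ Suc n) sums (z * U)" by (simp add: assms(3) mult_ac)
  then show ?thesis using sums_Suc_iff[of "\<lambda>n. v n * z ^ n" "z * U"] assms(2) by simp
qed

lemma power_series_has_derivative:
  fixes u :: "nat \<Rightarrow> real"
  assumes S: "\<And>x. \<bar>x\<bar> < 1 \<Longrightarrow> summable (\<lambda>n. u n * x ^ n)" and z: "\<bar>z\<bar> < 1"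
  obtains D where "((\<lambda>x. \<Sum>n. u n * x ^ n) has_real_derivative D) (at z)"
    "(\<lambda>n. real n * u n * z ^ n) sums (z * D)"
proof
  show "((\<lambda>x. \<Sum>n. u n * x ^ n) has_real_derivative (\<Sum>n. diffs u n * z ^ n)) (at z)"
    by (rule termdiffs_strong'[of 1]) (use S z in auto)
  have "summable (\<lambda>n. diffs u n * z ^ n)"
    by (rule termdiff_converges[of _ 1]) (use S z in auto)
  then have "(\<lambda>n. diffs u n * z ^ n) sums (\<Sum>n. diffs u n * z ^ n)" by (rule summable_sums)
  then show "(\<lambda>n. real n * u n * z ^ n) sums (z * (\<Sum>n. diffs u n * z ^ n))"
    by (rule sums_shift) (simp_all add: diffs_def)
qed

text \<open>The linear form of the recursion, summed against \<open>z ^ n\<close>, is the differential equation multiplied by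
  \<open>z * (1 - z)\<close>.\<close>

theorem frobenius_solution:
  assumes \<alpha>: "\<alpha> > 0" and km: "k0 * m0 = 0"
  shows "canonical_solution \<alpha> \<sigma> c k0 k1 m0 m1
     (\<lambda>z. z powr \<alpha> * frobenius_F \<alpha> \<sigma> c k0 k1 m0 m1 z) (\<lambda>z. z powr \<alpha> * frobenius_G \<alpha> \<sigma> c k0 k1 m0 m1 z)"
  unfolding canonical_solution_def
proof (rule ballI)
  fix z :: real assume z: "z \<in> {0<..<1}"
  then have z1: "\<bar>z\<bar> < 1" and z0: "z \<noteq> 0" "1 - z \<noteq> 0" "z > 0" by auto
  define a where "a = frobenius_a \<alpha> \<sigma> c k0 k1 m0 m1"
  define b where "b = frobenius_b \<alpha> \<sigma> c k0 k1 m0 m1"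
  define a' where "a' = frobenius_a' \<alpha> \<sigma> c k0 k1 m0 m1"
  define b' where "b' = frobenius_b' \<alpha> \<sigma> c k0 k1 m0 m1"
  define A where "A = frobenius_F \<alpha> \<sigma> c k0 k1 m0 m1"
  define B where "B = frobenius_G \<alpha> \<sigma> c k0 k1 m0 m1"
  note recs = frobenius_recurrence[of \<alpha> \<sigma> c k0 k1 m0 m1, folded a_def b_def a'_def b'_def]
  note rec = frobenius_recurrence_lin[OF \<alpha> km, where \<sigma> = \<sigma> and c = c and ?k1.0 = k1 and ?m1.0 = m1, folded a_def b_def a'_def b'_def]
  obtain A' where A': "(A has_real_derivative A') (at z)" "(\<lambda>n. real n * a n * z ^ n) sums (z * A')"
    using power_series_has_derivative[OF summable_frobenius(1)[OF \<alpha>] z1]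
    unfolding A_def a_def frobenius_F_def by blast
  obtain B' where B': "(B has_real_derivative B') (at z)" "(\<lambda>n. real n * b n * z ^ n) sums (z * B')"
    using power_series_has_derivative[OF summable_frobenius(2)[OF \<alpha>] z1]
    unfolding B_def b_def frobenius_G_def by blast
  have sa: "(\<lambda>n. a n * z ^ n) sums A z" unfolding A_def a_def frobenius_F_def
    by (rule summable_sums summable_frobenius \<alpha> z1)+
  have sb: "(\<lambda>n. b n * z ^ n) sums B z" unfolding B_def b_def frobenius_G_def
    by (rule summable_sums summable_frobenius \<alpha> z1)+
  have sa': "(\<lambda>n. a' n * z ^ n) sums (z * A z)" and sb': "(\<lambda>n. b' n * z ^ n) sums (z * B z)"
    by (rule sums_shift[OF sa] sums_shift[OF sb]; simp add: recs)+
  define r where "r n = (real n + 3 * \<alpha> + 2 * \<sigma>) * a n + (2 * c + k1 - k0) * b n - 2 * \<sigma> * a' n - 2 * c * b' n" for n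
  define s where "s n = (real n - \<alpha> - 2 * \<sigma>) * b n - (2 * c + m1 - m0) * a n + 2 * c * a' n + 2 * \<sigma> * b' n" for n
  have "(\<lambda>n. (real n * a n * z ^ n + (3 * \<alpha> + 2 * \<sigma>) * (a n * z ^ n)) + (2 * c + k1 - k0) * (b n * z ^ n)
      - 2 * \<sigma> * (a' n * z ^ n) - 2 * c * (b' n * z ^ n)) sums
     ((z * A' + (3 * \<alpha> + 2 * \<sigma>) * A z) + (2 * c + k1 - k0) * B z - 2 * \<sigma> * (z * A z) - 2 * c * (z * B z))"
    by (intro sums_add sums_diff sums_mult sa sb sa' sb' A'(2))
  then have "(\<lambda>n. r n * z ^ n) sums
     ((z * A' + (3 * \<alpha> + 2 * \<sigma>) * A z) + (2 * c + k1 - k0) * B z - 2 * \<sigma> * (z * A z) - 2 * c * (z * B z))"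
    by (rule sums_cong[THEN iffD1, rotated]) (simp add: r_def algebra_simps)
  then have R: "(\<lambda>n. (real n * a n + 2 * \<alpha> * a n - k0 * b n) * z ^ n) sums
     (z * ((z * A' + (3 * \<alpha> + 2 * \<sigma>) * A z) + (2 * c + k1 - k0) * B z - 2 * \<sigma> * (z * A z) - 2 * c * (z * B z)))"
    by (rule sums_shift) (use rec(1) in \<open>simp_all add: recs(1,2) r_def algebra_simps\<close>)
  have "(\<lambda>n. (real n * a n * z ^ n + 2 * \<alpha> * (a n * z ^ n)) - k0 * (b n * z ^ n)) sums (z * A' + 2 * \<alpha> * A z - k0 * B z)"
    by (intro sums_add sums_diff sums_mult sa sb A'(2))
  then have "(\<lambda>n. (real n * a n + 2 * \<alpha> * a n - k0 * b n) * z ^ n) sums (z * A' + 2 * \<alpha> * A z - k0 * B z)"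
    by (simp add: algebra_simps)
  from sums_unique2[OF R this]
  have eqA: "z * A' + 2 * \<alpha> * A z - k0 * B z =
     z * ((z * A' + (3 * \<alpha> + 2 * \<sigma>) * A z) + (2 * c + k1 - k0) * B z - 2 * \<sigma> * (z * A z) - 2 * c * (z * B z))" by simp
  have "(\<lambda>n. (real n * b n * z ^ n - (\<alpha> + 2 * \<sigma>) * (b n * z ^ n)) - (2 * c + m1 - m0) * (a n * z ^ n)
      + 2 * c * (a' n * z ^ n) + 2 * \<sigma> * (b' n * z ^ n)) sums
     ((z * B' - (\<alpha> + 2 * \<sigma>) * B z) - (2 * c + m1 - m0) * A z + 2 * c * (z * A z) + 2 * \<sigma> * (z * B z))"
    by (intro sums_add sums_diff sums_mult sa sb sa' sb' B'(2))
  then have "(\<lambda>n. s n * z ^ n) sums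
     ((z * B' - (\<alpha> + 2 * \<sigma>) * B z) - (2 * c + m1 - m0) * A z + 2 * c * (z * A z) + 2 * \<sigma> * (z * B z))"
    by (rule sums_cong[THEN iffD1, rotated]) (simp add: s_def algebra_simps)
  then have R: "(\<lambda>n. (real n * b n + m0 * a n) * z ^ n) sums
     (z * ((z * B' - (\<alpha> + 2 * \<sigma>) * B z) - (2 * c + m1 - m0) * A z + 2 * c * (z * A z) + 2 * \<sigma> * (z * B z)))"
    by (rule sums_shift) (use rec(2) km in \<open>simp_all add: recs(1,2) s_def algebra_simps\<close>)
  have "(\<lambda>n. real n * b n * z ^ n + m0 * (a n * z ^ n)) sums (z * B' + m0 * A z)"
    by (intro sums_add sums_mult sa B'(2))
  then have "(\<lambda>n. (real n * b n + m0 * a n) * z ^ n) sums (z * B' + m0 * A z)"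
    by (simp add: algebra_simps)
  from sums_unique2[OF R this]
  have eqB: "z * B' + m0 * A z =
     z * ((z * B' - (\<alpha> + 2 * \<sigma>) * B z) - (2 * c + m1 - m0) * A z + 2 * c * (z * A z) + 2 * \<sigma> * (z * B z))" by simp
  have p: "((\<lambda>z. z powr \<alpha>) has_real_derivative \<alpha> / z * z powr \<alpha>) (at z)"
    using z0 by (auto intro!: derivative_eq_intros simp: powr_diff)
  have e1: "\<alpha> / z * A z + A' = diag_coeff \<alpha> \<sigma> z * A z + offdiag_coeff c k0 k1 z * B z"
  proof -
    have "(\<alpha> / z * A z + A') * (z * (1 - z)) = (diag_coeff \<alpha> \<sigma> z * A z + offdiag_coeff c k0 k1 z * B z) * (z * (1 - z))"
      using eqA z0 by (simp add: diag_coeff_def offdiag_coeff_def divide_simps) (simp add: algebra_simps)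
    then show ?thesis using z0 by simp
  qed
  have e2: "\<alpha> / z * B z + B' = - offdiag_coeff c m0 m1 z * A z - diag_coeff \<alpha> \<sigma> z * B z"
  proof -
    have "(\<alpha> / z * B z + B') * (z * (1 - z)) = (- offdiag_coeff c m0 m1 z * A z - diag_coeff \<alpha> \<sigma> z * B z) * (z * (1 - z))"
      using eqB z0 by (simp add: diag_coeff_def offdiag_coeff_def divide_simps) (simp add: algebra_simps)
    then show ?thesis using z0 by simp
  qed
  have d1: "((\<lambda>z. z powr \<alpha> * A z) has_real_derivative z powr \<alpha> * (\<alpha> / z * A z + A')) (at z)"
    using DERIV_mult[OF p A'(1)] by (simp add: algebra_simps)
  have d2: "((\<lambda>z. z powr \<alpha> * B z) has_real_derivative z powr \<alpha> * (\<alpha> / z * B z + B')) (at z)"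
    using DERIV_mult[OF p B'(1)] by (simp add: algebra_simps)
  show "((\<lambda>z. z powr \<alpha> * frobenius_F \<alpha> \<sigma> c k0 k1 m0 m1 z) has_real_derivative
        diag_coeff \<alpha> \<sigma> z * (z powr \<alpha> * frobenius_F \<alpha> \<sigma> c k0 k1 m0 m1 z) + offdiag_coeff c k0 k1 z * (z powr \<alpha> * frobenius_G \<alpha> \<sigma> c k0 k1 m0 m1 z)) (at z) \<and>
     ((\<lambda>z. z powr \<alpha> * frobenius_G \<alpha> \<sigma> c k0 k1 m0 m1 z) has_real_derivative
        - offdiag_coeff c m0 m1 z * (z powr \<alpha> * frobenius_F \<alpha> \<sigma> c k0 k1 m0 m1 z) - diag_coeff \<alpha> \<sigma> z * (z powr \<alpha> * frobenius_G \<alpha> \<sigma> c k0 k1 m0 m1 z)) (at z)"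
    using d1[unfolded e1] d2[unfolded e2] unfolding A_def B_def by (simp add: algebra_simps)
qed

section \<open>The limit point case\<close>

definition "recessive_f \<alpha> \<sigma> c k0 k1 m0 m1 z = z powr \<alpha> * frobenius_F \<alpha> \<sigma> c k0 k1 m0 m1 z"
definition "recessive_g \<alpha> \<sigma> c k0 k1 m0 m1 z = z powr \<alpha> * frobenius_G \<alpha> \<sigma> c k0 k1 m0 m1 z"

lemma recessive_solution:
  "\<alpha> > 0 \<Longrightarrow> k0 * m0 = 0 \<Longrightarrow>
   canonical_solution \<alpha> \<sigma> c k0 k1 m0 m1 (recessive_f \<alpha> \<sigma> c k0 k1 m0 m1) (recessive_g \<alpha> \<sigma> c k0 k1 m0 m1)"
  using frobenius_solution[of \<alpha> k0 m0 \<sigma> c k1 m1] unfolding recessive_f_def[abs_def] recessive_g_def[abs_def] by simp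

lemma recessive_bound:
  assumes \<alpha>: "\<alpha> > 0"
  obtains K where "K \<ge> 0" "\<And>\<sigma> c k0 k1 m0 m1 z. \<lbrakk>\<bar>\<sigma>\<bar> \<le> B; \<bar>c\<bar> \<le> B; \<bar>k0\<bar> \<le> B; \<bar>k1\<bar> \<le> B; \<bar>m0\<bar> \<le> B; \<bar>m1\<bar> \<le> B; 0 < z; z \<le> 1 / 2\<rbrakk>
     \<Longrightarrow> \<bar>recessive_f \<alpha> \<sigma> c k0 k1 m0 m1 z\<bar> \<le> K * z powr \<alpha> \<and> \<bar>recessive_g \<alpha> \<sigma> c k0 k1 m0 m1 z\<bar> \<le> K * z powr \<alpha>"
proof -
  obtain K where K: "K \<ge> 0" "\<And>\<sigma> c k0 k1 m0 m1 z. \<lbrakk>\<bar>\<sigma>\<bar> \<le> B; \<bar>c\<bar> \<le> B; \<bar>k0\<bar> \<le> B; \<bar>k1\<bar> \<le> B; \<bar>m0\<bar> \<le> B; \<bar>m1\<bar> \<le> B; \<bar>z\<bar> \<le> 1 / 2\<rbrakk>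
     \<Longrightarrow> \<bar>frobenius_F \<alpha> \<sigma> c k0 k1 m0 m1 z\<bar> \<le> K \<and> \<bar>frobenius_G \<alpha> \<sigma> c k0 k1 m0 m1 z\<bar> \<le> K"
    by (rule frobenius_FG_bound[OF \<alpha>, of B]) auto
  show ?thesis
  proof (rule that[OF K(1)])
    fix \<sigma> c k0 k1 m0 m1 z :: real
    assume "\<bar>\<sigma>\<bar> \<le> B" "\<bar>c\<bar> \<le> B" "\<bar>k0\<bar> \<le> B" "\<bar>k1\<bar> \<le> B" "\<bar>m0\<bar> \<le> B" "\<bar>m1\<bar> \<le> B" "0 < z" "z \<le> 1 / 2"
    then have "\<bar>frobenius_F \<alpha> \<sigma> c k0 k1 m0 m1 z\<bar> \<le> K \<and> \<bar>frobenius_G \<alpha> \<sigma> c k0 k1 m0 m1 z\<bar> \<le> K"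
      by (intro K(2)) auto
    then show "\<bar>recessive_f \<alpha> \<sigma> c k0 k1 m0 m1 z\<bar> \<le> K * z powr \<alpha> \<and> \<bar>recessive_g \<alpha> \<sigma> c k0 k1 m0 m1 z\<bar> \<le> K * z powr \<alpha>"
      unfolding recessive_f_def recessive_g_def
      by (simp add: abs_mult mult.commute[of K] mult_left_mono)
  qed
qed

lemma recessive_bound_fixed:
  assumes \<alpha>: "\<alpha> > 0"
  obtains K where "K > 0" "\<And>z. 0 < z \<Longrightarrow> z \<le> 1 / 2 \<Longrightarrow> \<bar>recessive_f \<alpha> \<sigma> c k0 k1 m0 m1 z\<bar> \<le> K * z powr \<alpha>"
    "\<And>z. 0 < z \<Longrightarrow> z \<le> 1 / 2 \<Longrightarrow> \<bar>recessive_g \<alpha> \<sigma> c k0 k1 m0 m1 z\<bar> \<le> K * z powr \<alpha>"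
proof -
  define B where "B = \<bar>\<sigma>\<bar> + \<bar>c\<bar> + \<bar>k0\<bar> + \<bar>k1\<bar> + \<bar>m0\<bar> + \<bar>m1\<bar>"
  have B: "\<bar>\<sigma>\<bar> \<le> B" "\<bar>c\<bar> \<le> B" "\<bar>k0\<bar> \<le> B" "\<bar>k1\<bar> \<le> B" "\<bar>m0\<bar> \<le> B" "\<bar>m1\<bar> \<le> B"
    by (simp_all add: B_def)
  obtain K where K: "K \<ge> 0" "\<And>\<sigma> c k0 k1 m0 m1 z. \<lbrakk>\<bar>\<sigma>\<bar> \<le> B; \<bar>c\<bar> \<le> B; \<bar>k0\<bar> \<le> B; \<bar>k1\<bar> \<le> B; \<bar>m0\<bar> \<le> B; \<bar>m1\<bar> \<le> B; 0 < z; z \<le> 1 / 2\<rbrakk>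
     \<Longrightarrow> \<bar>recessive_f \<alpha> \<sigma> c k0 k1 m0 m1 z\<bar> \<le> K * z powr \<alpha> \<and> \<bar>recessive_g \<alpha> \<sigma> c k0 k1 m0 m1 z\<bar> \<le> K * z powr \<alpha>"
    by (rule recessive_bound[OF \<alpha>, of B]) auto
  have le: "K * z powr \<alpha> \<le> (K + 1) * z powr \<alpha>" for z by (intro mult_right_mono) auto
  show ?thesis
    by (rule that[of "K + 1"]) (use K(1) K(2)[OF B] order_trans[OF _ le] in auto)
qed

text \<open>The constant term of the series for \<open>g\<close> is \<open>2 * \<alpha>\<close>.\<close>

lemma recessive_g_ge:
  assumes \<alpha>: "\<alpha> > 0"
  obtains \<delta> where "0 < \<delta>" "\<delta> \<le> 1 / 2" "\<And>z. 0 < z \<Longrightarrow> z \<le> \<delta> \<Longrightarrow> recessive_g \<alpha> \<sigma> c k0 k1 m0 m1 z \<ge> \<alpha> * z powr \<alpha>"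
proof -
  obtain D where "(frobenius_G \<alpha> \<sigma> c k0 k1 m0 m1 has_real_derivative D) (at 0)"
    using power_series_has_derivative[of "frobenius_b \<alpha> \<sigma> c k0 k1 m0 m1" 0] summable_frobenius(2)[OF \<alpha>]
    unfolding frobenius_G_def[abs_def] by (metis abs_zero zero_less_one)
  then have "isCont (frobenius_G \<alpha> \<sigma> c k0 k1 m0 m1) 0" by (rule DERIV_isCont)
  then have "frobenius_G \<alpha> \<sigma> c k0 k1 m0 m1 \<midarrow>0\<rightarrow> 2 * \<alpha>" by (simp add: isCont_def frobenius_FG_0)
  then have "eventually (\<lambda>z. frobenius_G \<alpha> \<sigma> c k0 k1 m0 m1 z > \<alpha>) (at 0)"
    by (rule order_tendstoD) (use \<alpha> in simp)
  then obtain d where d: "d > 0" "\<And>z. z \<noteq> 0 \<Longrightarrow> \<bar>z\<bar> < d \<Longrightarrow> frobenius_G \<alpha> \<sigma> c k0 k1 m0 m1 z > \<alpha>"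
    unfolding eventually_at by (auto simp: dist_real_def)
  show ?thesis
  proof (rule that[of "min (d / 2) (1 / 2)"])
    fix z :: real assume "0 < z" "z \<le> min (d / 2) (1 / 2)"
    then have "frobenius_G \<alpha> \<sigma> c k0 k1 m0 m1 z > \<alpha>" by (intro d) (use d(1) in auto)
    then show "recessive_g \<alpha> \<sigma> c k0 k1 m0 m1 z \<ge> \<alpha> * z powr \<alpha>"
      unfolding recessive_g_def by (simp add: mult.commute[of \<alpha>] mult_left_mono)
  qed (use d in auto)
qed

lemma canonical_solution_wronskian_const:
  assumes "canonical_solution \<alpha> \<sigma> c k0 k1 m0 m1 f g" "canonical_solution \<alpha> \<sigma> c k0 k1 m0 m1 f1 g1"
  obtains C where "\<And>z. z \<in> {0<..<1} \<Longrightarrow> f z * g1 z - g z * f1 z = C"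
proof -
  have "((\<lambda>z. f z * g1 z - g z * f1 z) has_real_derivative 0) (at z within {0<..<1})" if z: "z \<in> {0<..<1}" for z
  proof -
    have d: "(f has_real_derivative diag_coeff \<alpha> \<sigma> z * f z + offdiag_coeff c k0 k1 z * g z) (at z)"
      "(g has_real_derivative - offdiag_coeff c m0 m1 z * f z - diag_coeff \<alpha> \<sigma> z * g z) (at z)"
      "(f1 has_real_derivative diag_coeff \<alpha> \<sigma> z * f1 z + offdiag_coeff c k0 k1 z * g1 z) (at z)"
      "(g1 has_real_derivative - offdiag_coeff c m0 m1 z * f1 z - diag_coeff \<alpha> \<sigma> z * g1 z) (at z)"
      using assms z unfolding canonical_solution_def by auto
    show ?thesis
      by (rule has_field_derivative_at_within)
         (auto intro!: derivative_eq_intros d simp: algebra_simps)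
  qed
  then have "\<exists>C. \<forall>z\<in>{0<..<1}. f z * g1 z - g z * f1 z = C"
    by (intro has_field_derivative_zero_constant) auto
  then show ?thesis using that by blast
qed

text \<open>Gronwall's argument in both directions: \<open>E * exp (- K * x)\<close> decreases and \<open>E * exp (K * x)\<close> increases.\<close>

lemma gronwall_zero:
  fixes E E' :: "real \<Rightarrow> real"
  assumes d: "\<And>x. x \<in> {a..b} \<Longrightarrow> (E has_real_derivative E' x) (at x)"
    and bd: "\<And>x. x \<in> {a..b} \<Longrightarrow> \<bar>E' x\<bar> \<le> K * E x"
    and x0: "x0 \<in> {a..b}" "E x0 = 0" and z: "z \<in> {a..b}"
  shows "E z \<le> 0"
proof (cases "x0 \<le> z")
  case True
  have "E z * exp (- K * z) \<le> E x0 * exp (- K * x0)"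
  proof (rule DERIV_nonpos_imp_nonincreasing[OF True])
    fix x assume "x0 \<le> x" "x \<le> z"
    then have x: "x \<in> {a..b}" using x0 z by auto
    have "((\<lambda>x. E x * exp (- K * x)) has_real_derivative (E' x - K * E x) * exp (- K * x)) (at x)"
      by (auto intro!: derivative_eq_intros d[OF x] simp: algebra_simps)
    moreover have "(E' x - K * E x) * exp (- K * x) \<le> 0"
      using bd[OF x] by (intro mult_nonpos_nonneg) auto
    ultimately show "\<exists>y. ((\<lambda>x. E x * exp (- K * x)) has_real_derivative y) (at x) \<and> y \<le> 0" by blast
  qed
  then show ?thesis using x0 by (simp add: mult_le_0_iff)
next
  case False
  then have "z \<le> x0" by simp
  then have "E z * exp (K * z) \<le> E x0 * exp (K * x0)"
  proof (rule DERIV_nonneg_imp_nondecreasing)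
    fix x assume "z \<le> x" "x \<le> x0"
    then have x: "x \<in> {a..b}" using x0 z by auto
    have "((\<lambda>x. E x * exp (K * x)) has_real_derivative (E' x + K * E x) * exp (K * x)) (at x)"
      by (auto intro!: derivative_eq_intros d[OF x] simp: algebra_simps)
    moreover have "(E' x + K * E x) * exp (K * x) \<ge> 0"
      using bd[OF x] by (intro mult_nonneg_nonneg) auto
    ultimately show "\<exists>y. ((\<lambda>x. E x * exp (K * x)) has_real_derivative y) (at x) \<and> 0 \<le> y" by blast
  qed
  then show ?thesis using x0 by (simp add: mult_le_0_iff)
qed

lemma continuous_on_Icc_norm_bounded:
  fixes M :: "real \<Rightarrow> 'a::real_normed_vector"
  shows "continuous_on {a..b} M \<Longrightarrow> \<exists>K. \<forall>x\<in>{a..b}. norm (M x) \<le> K"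
  using compact_imp_bounded[OF compact_continuous_image[OF _ compact_Icc], of a b M]
  by (simp add: bounded_iff)

lemma canonical_solution_unique_zero:
  assumes sol: "canonical_solution \<alpha> \<sigma> c k0 k1 m0 m1 f g" and x0: "x0 \<in> {0<..<1}" "f x0 = 0" "g x0 = 0"
    and z: "z \<in> {0<..<1}"
  shows "f z = 0" "g z = 0"
proof -
  define a where "a = min x0 z" define b where "b = max x0 z"
  have ab: "{a..b} \<subseteq> {0<..<1}" "x0 \<in> {a..b}" "z \<in> {a..b}"
    using x0(1) z by (auto simp: a_def b_def)
  define M where "M x = 2 * \<bar>diag_coeff \<alpha> \<sigma> x\<bar> + \<bar>offdiag_coeff c k0 k1 x\<bar> + \<bar>offdiag_coeff c m0 m1 x\<bar>" for x
  have "continuous_on {a..b} M"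
    unfolding M_def diag_coeff_def offdiag_coeff_def by (intro continuous_intros) (use ab in fastforce)+
  then obtain K where K: "\<And>x. x \<in> {a..b} \<Longrightarrow> \<bar>M x\<bar> \<le> K"
    using continuous_on_Icc_norm_bounded by fastforce
  define E where "E x = (f x)\<^sup>2 + (g x)\<^sup>2" for x
  define E' where "E' x = 2 * diag_coeff \<alpha> \<sigma> x * ((f x)\<^sup>2 - (g x)\<^sup>2)
      + (offdiag_coeff c k0 k1 x - offdiag_coeff c m0 m1 x) * (2 * f x * g x)" for x
  have "E z \<le> 0"
  proof (rule gronwall_zero[OF _ _ ab(2) _ ab(3)])
    fix x assume x: "x \<in> {a..b}"
    then have "x \<in> {0<..<1}" using ab by blast
    then have d: "(f has_real_derivative diag_coeff \<alpha> \<sigma> x * f x + offdiag_coeff c k0 k1 x * g x) (at x)"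
      "(g has_real_derivative - offdiag_coeff c m0 m1 x * f x - diag_coeff \<alpha> \<sigma> x * g x) (at x)"
      using sol unfolding canonical_solution_def by auto
    show "(E has_real_derivative E' x) (at x)"
      unfolding E_def E'_def by (auto intro!: derivative_eq_intros d simp: algebra_simps power2_eq_square)
    have fg: "\<bar>2 * f x * g x\<bar> \<le> E x" "\<bar>(f x)\<^sup>2 - (g x)\<^sup>2\<bar> \<le> E x"
      using sum_squares_bound[of "\<bar>f x\<bar>" "\<bar>g x\<bar>"] zero_le_power2[of "f x"] zero_le_power2[of "g x"]
      unfolding E_def abs_mult by (simp, linarith)
    have "\<bar>E' x\<bar> \<le> \<bar>2 * diag_coeff \<alpha> \<sigma> x * ((f x)\<^sup>2 - (g x)\<^sup>2)\<bar>
       + \<bar>(offdiag_coeff c k0 k1 x - offdiag_coeff c m0 m1 x) * (2 * f x * g x)\<bar>"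
      unfolding E'_def by (rule abs_triangle_ineq)
    also have "\<bar>2 * diag_coeff \<alpha> \<sigma> x * ((f x)\<^sup>2 - (g x)\<^sup>2)\<bar> \<le> 2 * \<bar>diag_coeff \<alpha> \<sigma> x\<bar> * E x"
      using fg by (simp add: abs_mult mult_left_mono)
    also have "\<bar>(offdiag_coeff c k0 k1 x - offdiag_coeff c m0 m1 x) * (2 * f x * g x)\<bar>
       \<le> (\<bar>offdiag_coeff c k0 k1 x\<bar> + \<bar>offdiag_coeff c m0 m1 x\<bar>) * E x"
      unfolding abs_mult[of "_ - _"] using fg by (intro mult_mono) auto
    finally have "\<bar>E' x\<bar> \<le> M x * E x" by (simp add: M_def algebra_simps)
    also have "\<dots> \<le> K * E x" using K[OF x] by (intro mult_right_mono) (auto simp: E_def)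
    finally show "\<bar>E' x\<bar> \<le> K * E x" by simp
  qed (simp add: E_def x0)
  then show "f z = 0" "g z = 0" by (simp_all add: E_def sum_power2_le_zero_iff)
qed

lemma canonical_solution_diff_scale:
  assumes "canonical_solution \<alpha> \<sigma> c k0 k1 m0 m1 f g" "canonical_solution \<alpha> \<sigma> c k0 k1 m0 m1 f1 g1"
  shows "canonical_solution \<alpha> \<sigma> c k0 k1 m0 m1 (\<lambda>z. f z - b * f1 z) (\<lambda>z. g z - b * g1 z)"
  unfolding canonical_solution_def
proof (intro ballI conjI)
  fix z :: real assume z: "z \<in> {0<..<1}"
  have d: "(f has_real_derivative diag_coeff \<alpha> \<sigma> z * f z + offdiag_coeff c k0 k1 z * g z) (at z)"
      "(g has_real_derivative - offdiag_coeff c m0 m1 z * f z - diag_coeff \<alpha> \<sigma> z * g z) (at z)"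
      "(f1 has_real_derivative diag_coeff \<alpha> \<sigma> z * f1 z + offdiag_coeff c k0 k1 z * g1 z) (at z)"
      "(g1 has_real_derivative - offdiag_coeff c m0 m1 z * f1 z - diag_coeff \<alpha> \<sigma> z * g1 z) (at z)"
    using assms z unfolding canonical_solution_def by auto
  show "((\<lambda>z. f z - b * f1 z) has_real_derivative
       diag_coeff \<alpha> \<sigma> z * (f z - b * f1 z) + offdiag_coeff c k0 k1 z * (g z - b * g1 z)) (at z)"
    by (auto intro!: derivative_eq_intros d simp: algebra_simps)
  show "((\<lambda>z. g z - b * g1 z) has_real_derivative
       - offdiag_coeff c m0 m1 z * (f z - b * f1 z) - diag_coeff \<alpha> \<sigma> z * (g z - b * g1 z)) (at z)"
    by (auto intro!: derivative_eq_intros d simp: algebra_simps)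
qed

text \<open>Scale so that the second components agree at a point near zero, where the recessive one does not vanish; the
  Wronskian then takes care of the first components, and uniqueness extends the equality to the interval.\<close>

lemma multiple_of_recessive:
  assumes \<alpha>: "\<alpha> > 0" and km: "k0 * m0 = 0"
    and sol: "canonical_solution \<alpha> \<sigma> c k0 k1 m0 m1 f g"
    and W: "\<And>z. z \<in> {0<..<1} \<Longrightarrow> f z * recessive_g \<alpha> \<sigma> c k0 k1 m0 m1 z - g z * recessive_f \<alpha> \<sigma> c k0 k1 m0 m1 z = 0"
  obtains b where "\<And>z. z \<in> {0<..<1} \<Longrightarrow> f z = b * recessive_f \<alpha> \<sigma> c k0 k1 m0 m1 z"
    "\<And>z. z \<in> {0<..<1} \<Longrightarrow> g z = b * recessive_g \<alpha> \<sigma> c k0 k1 m0 m1 z"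
proof -
  let ?f = "recessive_f \<alpha> \<sigma> c k0 k1 m0 m1" and ?g = "recessive_g \<alpha> \<sigma> c k0 k1 m0 m1"
  obtain \<delta> where \<delta>: "0 < \<delta>" "\<delta> \<le> 1 / 2" "\<And>z. 0 < z \<Longrightarrow> z \<le> \<delta> \<Longrightarrow> ?g z \<ge> \<alpha> * z powr \<alpha>"
    using recessive_g_ge[OF \<alpha>, of \<sigma> c k0 k1 m0 m1] by blast
  have "\<alpha> * \<delta> powr \<alpha> > 0" using \<alpha> \<delta> by simp
  then have g: "?g \<delta> \<noteq> 0" using \<delta>(3)[of \<delta>] \<delta>(1) by linarith
  have \<delta>1: "\<delta> \<in> {0<..<1}" using \<delta> by auto
  define b where "b = g \<delta> / ?g \<delta>"
  have sol': "canonical_solution \<alpha> \<sigma> c k0 k1 m0 m1 (\<lambda>z. f z - b * ?f z) (\<lambda>z. g z - b * ?g z)"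
    by (rule canonical_solution_diff_scale[OF sol recessive_solution[OF \<alpha> km]])
  have z: "f \<delta> - b * ?f \<delta> = 0" "g \<delta> - b * ?g \<delta> = 0"
    using g W[OF \<delta>1] by (auto simp: b_def field_simps)
  show ?thesis
  proof (rule that[of b])
    fix x :: real assume x: "x \<in> {0<..<1}"
    show "f x = b * ?f x" using canonical_solution_unique_zero(1)[OF sol' \<delta>1 z x] by simp
    show "g x = b * ?g x" using canonical_solution_unique_zero(2)[OF sol' \<delta>1 z x] by simp
  qed
qed

text \<open>If the Wronskian \<open>C\<close> with the recessive solution were not zero, then \<open>C\<^sup>2\<close> would be at most a constant times
  \<open>z powr (2 * \<alpha>) * (f\<^sup>2 + g\<^sup>2)\<close>. As \<open>2 * \<alpha> \<ge> 1\<close>, this would bound \<open>1 / z\<close> by an integrable function.\<close>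

theorem limit_point_L2:
  assumes \<alpha>: "\<alpha> \<ge> 1 / 2" and km: "k0 * m0 = 0"
    and sol: "canonical_solution \<alpha> \<sigma> c k0 k1 m0 m1 f g"
    and L2: "(\<lambda>z. (f z)\<^sup>2 + (g z)\<^sup>2) integrable_on {0..1}"
  obtains b where "\<And>z. z \<in> {0<..<1} \<Longrightarrow> f z = b * recessive_f \<alpha> \<sigma> c k0 k1 m0 m1 z"
    "\<And>z. z \<in> {0<..<1} \<Longrightarrow> g z = b * recessive_g \<alpha> \<sigma> c k0 k1 m0 m1 z"
proof -
  have \<alpha>0: "\<alpha> > 0" using \<alpha> by simp
  let ?f = "recessive_f \<alpha> \<sigma> c k0 k1 m0 m1" and ?g = "recessive_g \<alpha> \<sigma> c k0 k1 m0 m1"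
  obtain C where C: "\<And>z. z \<in> {0<..<1} \<Longrightarrow> f z * ?g z - g z * ?f z = C"
    by (rule canonical_solution_wronskian_const[OF sol recessive_solution[OF \<alpha>0 km]]) auto
  obtain K where K: "K > 0" "\<And>z. 0 < z \<Longrightarrow> z \<le> 1 / 2 \<Longrightarrow> \<bar>?f z\<bar> \<le> K * z powr \<alpha>"
    "\<And>z. 0 < z \<Longrightarrow> z \<le> 1 / 2 \<Longrightarrow> \<bar>?g z\<bar> \<le> K * z powr \<alpha>"
    using recessive_bound_fixed[OF \<alpha>0, of \<sigma> c k0 k1 m0 m1] by blast
  have "C = 0"
  proof (rule ccontr)
    assume "C \<noteq> 0"
    define D where "D = C\<^sup>2 / (2 * K\<^sup>2)"
    have D: "D > 0" using \<open>C \<noteq> 0\<close> K(1) by (simp add: D_def)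
    have lower: "D * (1 / z) \<le> (f z)\<^sup>2 + (g z)\<^sup>2" if z: "0 < z" "z \<le> 1 / 2" for z
    proof -
      have "z powr \<alpha> * z powr \<alpha> = z powr (2 * \<alpha>)" by (simp flip: powr_add)
      also have "\<dots> \<le> z powr 1" by (rule powr_mono') (use \<alpha> z in auto)
      finally have zz: "(z powr \<alpha>)\<^sup>2 \<le> z" using z by (simp add: power2_eq_square)
      have "\<bar>C\<bar> \<le> \<bar>f z\<bar> * \<bar>?g z\<bar> + \<bar>g z\<bar> * \<bar>?f z\<bar>"
        using C[of z] z abs_triangle_ineq4[of "f z * ?g z" "g z * ?f z"] by (simp add: abs_mult)
      also have "\<dots> \<le> \<bar>f z\<bar> * (K * z powr \<alpha>) + \<bar>g z\<bar> * (K * z powr \<alpha>)"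
        using K z by (intro add_mono mult_left_mono) auto
      also have "\<dots> = (\<bar>f z\<bar> + \<bar>g z\<bar>) * (K * z powr \<alpha>)" by (simp add: algebra_simps)
      finally have "\<bar>C\<bar>\<^sup>2 \<le> ((\<bar>f z\<bar> + \<bar>g z\<bar>) * (K * z powr \<alpha>))\<^sup>2" by (intro power_mono) auto
      then have "C\<^sup>2 \<le> (\<bar>f z\<bar> + \<bar>g z\<bar>)\<^sup>2 * (K\<^sup>2 * (z powr \<alpha>)\<^sup>2)" by (simp add: power_mult_distrib)
      also have "\<dots> \<le> (2 * ((f z)\<^sup>2 + (g z)\<^sup>2)) * (K\<^sup>2 * z)"
      proof (intro mult_mono)
        show "(\<bar>f z\<bar> + \<bar>g z\<bar>)\<^sup>2 \<le> 2 * ((f z)\<^sup>2 + (g z)\<^sup>2)"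
          using sum_squares_bound[of "\<bar>f z\<bar>" "\<bar>g z\<bar>"] by (simp add: power2_sum)
      qed (use zz z in auto)
      finally have "C\<^sup>2 \<le> (2 * K\<^sup>2 * z) * ((f z)\<^sup>2 + (g z)\<^sup>2)" by (simp only: mult_ac)
      then have "C\<^sup>2 / (2 * K\<^sup>2 * z) \<le> (f z)\<^sup>2 + (g z)\<^sup>2"
        using z K(1) by (simp add: pos_divide_le_eq mult.commute)
      then show ?thesis by (simp add: D_def)
    qed
    define I where "I = integral {0..1} (\<lambda>z. (f z)\<^sup>2 + (g z)\<^sup>2)"
    have key: "D * X \<le> I" if "X > 0" for X
    proof -
      define e where "e = exp (- X) / 2"
      have e: "0 < e" "e < 1 / 2" using that by (auto simp: e_def)
      have "((\<lambda>z. D * (1 / z)) has_integral D * ln (1 / 2) - D * ln e) {e..1 / 2}"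
        by (rule fundamental_theorem_of_calculus)
           (use e in \<open>auto intro!: derivative_eq_intros simp: has_real_derivative_iff_has_vector_derivative[symmetric]\<close>)
      moreover have "D * ln (1 / 2) - D * ln e = D * X"
        by (simp add: e_def ln_div algebra_simps)
      ultimately have hi: "((\<lambda>z. D * (1 / z)) has_integral D * X) {e..1 / 2}" by simp
      have L2': "(\<lambda>z. (f z)\<^sup>2 + (g z)\<^sup>2) integrable_on {e..1 / 2}"
        by (rule integrable_on_subinterval[OF L2]) (use e in auto)
      have "D * X \<le> integral {e..1 / 2} (\<lambda>z. (f z)\<^sup>2 + (g z)\<^sup>2)"
        by (rule has_integral_le[OF hi integrable_integral[OF L2']]) (use lower e in auto)
      also have "\<dots> \<le> I" unfolding I_def
        by (rule integral_subset_le[OF _ L2' L2]) (use e in auto)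
      finally show ?thesis .
    qed
    have "D * ((\<bar>I\<bar> + 1) / D) \<le> I" by (rule key) (use D in auto)
    then show False using D by simp
  qed
  then have W: "f z * ?g z - g z * ?f z = 0" if "z \<in> {0<..<1}" for z using C[OF that] by simp
  show ?thesis
    using multiple_of_recessive[OF \<alpha>0 km sol W] that by blast
qed

text \<open>The same dichotomy for a growth condition on \<open>g\<close> alone. The quotient of \<open>g\<close> and the recessive \<open>g\<close> has
  derivative \<open>- 2 * c * C\<close> divided by the square of the latter, so for a Wronskian \<open>C \<noteq> 0\<close> it grows like the
  antiderivative of \<open>z powr (- 2 * \<alpha>)\<close>, whereas the hypothesis bounds it by a multiple of
  \<open>z powr (1 / 2 - \<alpha>)\<close>. Comparing both on an interval from \<open>z\<close> to \<open>L * z\<close> with large \<open>L\<close> and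
  \<open>L\<^sup>2 * z\<close> small treats the logarithmic case \<open>\<alpha> = 1 / 2\<close> together with the others.\<close>

theorem limit_point_sqrt_bound:
  assumes \<alpha>: "\<alpha> \<ge> 1 / 2" and c: "c > 0"
    and sol: "canonical_solution \<alpha> \<sigma> c k0 k1 0 0 f g"
    and bd: "\<And>z. z \<in> {0<..<1} \<Longrightarrow> \<bar>g z\<bar> \<le> M * sqrt z"
  obtains b where "\<And>z. z \<in> {0<..<1} \<Longrightarrow> f z = b * recessive_f \<alpha> \<sigma> c k0 k1 0 0 z"
    "\<And>z. z \<in> {0<..<1} \<Longrightarrow> g z = b * recessive_g \<alpha> \<sigma> c k0 k1 0 0 z"
proof -
  have \<alpha>0: "\<alpha> > 0" using \<alpha> by simp
  have km: "k0 * 0 = (0::real)" by simp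
  let ?f = "recessive_f \<alpha> \<sigma> c k0 k1 0 0" and ?g = "recessive_g \<alpha> \<sigma> c k0 k1 0 0"
  note rsol = recessive_solution[OF \<alpha>0 km, of \<sigma> c k1 0]
  obtain C where C: "\<And>z. z \<in> {0<..<1} \<Longrightarrow> f z * ?g z - g z * ?f z = C"
    by (rule canonical_solution_wronskian_const[OF sol rsol]) auto
  obtain K where K: "K > 0" "\<And>z. 0 < z \<Longrightarrow> z \<le> 1 / 2 \<Longrightarrow> \<bar>?f z\<bar> \<le> K * z powr \<alpha>"
    "\<And>z. 0 < z \<Longrightarrow> z \<le> 1 / 2 \<Longrightarrow> \<bar>?g z\<bar> \<le> K * z powr \<alpha>"
    using recessive_bound_fixed[OF \<alpha>0, of \<sigma> c k0 k1 0 0] by blast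
  obtain \<delta> where \<delta>: "0 < \<delta>" "\<delta> \<le> 1 / 2" "\<And>z. 0 < z \<Longrightarrow> z \<le> \<delta> \<Longrightarrow> ?g z \<ge> \<alpha> * z powr \<alpha>"
    using recessive_g_ge[OF \<alpha>0, of \<sigma> c k0 k1 0 0] by blast
  have "C = 0"
  proof (rule ccontr)
    assume C0: "C \<noteq> 0"
    \<comment> \<open>Up to sign, \<open>g / ?g\<close> grows at least like the antiderivative of \<open>z powr (- 2 * \<alpha>)\<close>.\<close>
    define h where "h z = - sgn C * (g z / ?g z)" for z
    define D where "D = 2 * c * \<bar>C\<bar> / K\<^sup>2"
    define K' where "K' = \<bar>M\<bar> / \<alpha>"
    have D: "D > 0" using c C0 K(1) by (simp add: D_def)
    have K': "K' \<ge> 0" using \<alpha>0 by (simp add: K'_def)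
    have gpos: "?g z > 0" if "0 < z" "z \<le> \<delta>" for z
    proof -
      have "\<alpha> * z powr \<alpha> > 0" using \<alpha>0 that by simp
      then show ?thesis using \<delta>(3)[OF that] by linarith
    qed
    have dh: "(h has_real_derivative 2 * c * \<bar>C\<bar> / (?g z)\<^sup>2) (at z)" if z: "0 < z" "z \<le> \<delta>" for z
    proof -
      have z1: "z \<in> {0<..<1}" using z \<delta> by auto
      have d: "(g has_real_derivative - (2 * c) * f z - diag_coeff \<alpha> \<sigma> z * g z) (at z)"
        "(?g has_real_derivative - (2 * c) * ?f z - diag_coeff \<alpha> \<sigma> z * ?g z) (at z)"
        using sol rsol z1 unfolding canonical_solution_def by (auto simp: offdiag_coeff_def)
      have g0: "?g z \<noteq> 0" using gpos[OF z] by simp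
      have "((\<lambda>z. g z / ?g z) has_real_derivative
          ((- (2 * c) * f z - diag_coeff \<alpha> \<sigma> z * g z) * ?g z - g z * (- (2 * c) * ?f z - diag_coeff \<alpha> \<sigma> z * ?g z)) / (?g z * ?g z)) (at z)"
        by (rule DERIV_divide[OF d g0])
      moreover have "(- (2 * c) * f z - diag_coeff \<alpha> \<sigma> z * g z) * ?g z - g z * (- (2 * c) * ?f z - diag_coeff \<alpha> \<sigma> z * ?g z)
          = - 2 * c * C" unfolding C[OF z1, symmetric] by (simp add: algebra_simps)
      ultimately have "((\<lambda>z. g z / ?g z) has_real_derivative - 2 * c * C / (?g z)\<^sup>2) (at z)"
        by (simp add: power2_eq_square)
      from DERIV_cmult[OF this, of "- sgn C"]
      show ?thesis unfolding h_def by (simp add: abs_sgn mult_ac)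
    qed
    have h_le: "\<bar>h z\<bar> \<le> K' * z powr (1 / 2 - \<alpha>)" if z: "0 < z" "z \<le> \<delta>" for z
    proof -
      have "\<bar>h z\<bar> = \<bar>g z\<bar> / ?g z" using C0 gpos[OF z] by (simp add: h_def abs_mult abs_sgn_eq)
      also have "\<dots> \<le> (\<bar>M\<bar> * sqrt z) / (\<alpha> * z powr \<alpha>)"
      proof (rule frac_le)
        have "\<bar>g z\<bar> \<le> M * sqrt z" using bd[of z] z \<delta> by auto
        also have "\<dots> \<le> \<bar>M\<bar> * sqrt z" using z by (intro mult_right_mono) auto
        finally show "\<bar>g z\<bar> \<le> \<bar>M\<bar> * sqrt z" .
      qed (use \<delta>(3)[OF z] \<alpha>0 z in auto)
      also have "\<dots> = K' * z powr (1 / 2 - \<alpha>)"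
        using z by (simp add: K'_def powr_diff powr_half_sqrt)
      finally show ?thesis .
    qed
    define L where "L = exp ((2 * K' + 1) / D)"
    have L: "L > 1" "ln L * D = 2 * K' + 1" using D K' by (auto simp: L_def)
    define z where "z = \<delta> / L\<^sup>2"
    have L2: "L\<^sup>2 > 0" "L \<le> L\<^sup>2" using L(1) by (auto simp: power2_eq_square)
    have z0: "0 < z" using \<delta>(1) L2 by (simp add: z_def)
    have "L * z \<le> L\<^sup>2 * z" using L2 z0 by (intro mult_right_mono) auto
    also have "\<dots> = \<delta>" using L2 by (simp add: z_def)
    finally have Lz: "L * z \<le> \<delta>" .
    have zL: "z \<le> L * z" using L(1) z0 by simp
    have Lzp: "(L * z) powr (1 - 2 * \<alpha>) \<ge> z powr (1 / 2 - \<alpha>)"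
    proof -
      have "(L * z) powr (1 - 2 * \<alpha>) = (L\<^sup>2 * z) powr (1 / 2 - \<alpha>) * z powr (1 / 2 - \<alpha>)"
      proof -
        have "(L * z) powr (1 - 2 * \<alpha>) = ((L * z) powr 2) powr (1 / 2 - \<alpha>)"
          by (simp add: powr_powr algebra_simps)
        also have "(L * z) powr 2 = (L\<^sup>2 * z) * z" using L z0 by (simp add: powr_numeral power2_eq_square)
        finally show ?thesis using L z0 by (simp add: powr_mult)
      qed
      moreover have "(L\<^sup>2 * z) powr (1 / 2 - \<alpha>) \<ge> (L\<^sup>2 * z) powr 0"
        by (rule powr_mono') (use \<alpha> \<delta> L2 in \<open>auto simp: z_def\<close>)
      moreover have "(L\<^sup>2 * z) powr 0 = 1" using L2 z0 by simp
      ultimately show ?thesis by (simp add: mult_left_le_one_le mult_le_cancel_right1)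
    qed
    have "h z - D * z powr (1 / 2 - \<alpha>) * ln z \<le> h (L * z) - D * z powr (1 / 2 - \<alpha>) * ln (L * z)"
    proof (rule DERIV_nonneg_imp_nondecreasing[OF zL])
      fix s assume s: "z \<le> s" "s \<le> L * z"
      have s0: "0 < s" "s \<le> \<delta>" using s z0 Lz by auto
      have "((\<lambda>s. h s - D * z powr (1 / 2 - \<alpha>) * ln s) has_real_derivative
          2 * c * \<bar>C\<bar> / (?g s)\<^sup>2 - D * z powr (1 / 2 - \<alpha>) * (1 / s)) (at s)"
        using s0 by (auto intro!: derivative_eq_intros dh)
      moreover have "D * z powr (1 / 2 - \<alpha>) * (1 / s) \<le> 2 * c * \<bar>C\<bar> / (?g s)\<^sup>2"
      proof -
        have gs: "?g s \<le> K * s powr \<alpha>" using K(3)[of s] s0 \<delta> by auto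
        have "(?g s)\<^sup>2 \<le> (K * s powr \<alpha>)\<^sup>2" using gs gpos[OF s0] by (intro power_mono) auto
        also have "\<dots> = K\<^sup>2 * s powr (2 * \<alpha>)"
          by (simp add: power_mult_distrib power2_eq_square flip: powr_add)
        finally have "2 * c * \<bar>C\<bar> / (K\<^sup>2 * s powr (2 * \<alpha>)) \<le> 2 * c * \<bar>C\<bar> / (?g s)\<^sup>2"
          using gpos[OF s0] c K(1) s0 by (intro divide_left_mono mult_pos_pos) auto
        moreover have "D * z powr (1 / 2 - \<alpha>) * (1 / s) \<le> D * s powr (1 - 2 * \<alpha>) * (1 / s)"
        proof (intro mult_right_mono mult_left_mono)
          have "(L * z) powr (1 - 2 * \<alpha>) \<le> s powr (1 - 2 * \<alpha>)"
            using s s0 \<alpha> by (intro powr_mono2') auto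
          then show "z powr (1 / 2 - \<alpha>) \<le> s powr (1 - 2 * \<alpha>)" using Lzp by linarith
        qed (use D s0 in auto)
        moreover have "D * s powr (1 - 2 * \<alpha>) * (1 / s) = 2 * c * \<bar>C\<bar> / (K\<^sup>2 * s powr (2 * \<alpha>))"
          using s0 by (simp add: D_def powr_diff)
        ultimately show ?thesis by linarith
      qed
      ultimately show "\<exists>y. ((\<lambda>s. h s - D * z powr (1 / 2 - \<alpha>) * ln s) has_real_derivative y) (at s) \<and> 0 \<le> y"
        by (intro exI conjI) auto
    qed
    moreover have "ln (L * z) = ln L + ln z" using L z0 by (simp add: ln_mult)
    ultimately have "(ln L * D) * z powr (1 / 2 - \<alpha>) \<le> h (L * z) - h z" by (simp add: algebra_simps)
    also have "\<dots> \<le> \<bar>h (L * z)\<bar> + \<bar>h z\<bar>" by linarith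
    also have "\<bar>h (L * z)\<bar> \<le> K' * (L * z) powr (1 / 2 - \<alpha>)" by (rule h_le) (use z0 L Lz in auto)
    also have "\<bar>h z\<bar> \<le> K' * z powr (1 / 2 - \<alpha>)" by (rule h_le) (use z0 order_trans[OF zL Lz] in auto)
    also have "K' * (L * z) powr (1 / 2 - \<alpha>) \<le> K' * z powr (1 / 2 - \<alpha>)"
      using zL z0 \<alpha> K' by (intro mult_left_mono powr_mono2') auto
    finally have "(2 * K' + 1) * z powr (1 / 2 - \<alpha>) \<le> 2 * K' * z powr (1 / 2 - \<alpha>)"
      using L(2) by simp
    then show False using z0 by (simp add: algebra_simps)
  qed
  then have W: "f z * ?g z - g z * ?f z = 0" if "z \<in> {0<..<1}" for z using C[OF that] by simp
  show ?thesis
    using multiple_of_recessive[OF \<alpha>0 km sol W] that by blast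
qed

section \<open>The Feynman-Hellmann formula\<close>

definition square_integrable_solution ::
  "real \<Rightarrow> real \<Rightarrow> real \<Rightarrow> real \<Rightarrow> real \<Rightarrow> (real \<Rightarrow> real) \<Rightarrow> (real \<Rightarrow> real) \<Rightarrow> bool" where
  "square_integrable_solution \<alpha> \<sigma> c k m f g \<longleftrightarrow>
     canonical_solution \<alpha> \<sigma> c k 0 0 m f g \<and> (\<lambda>z. (f z)\<^sup>2 + (g z)\<^sup>2) integrable_on {0..1} \<and>
     (\<exists>z\<in>{0<..<1}. f z \<noteq> 0 \<or> g z \<noteq> 0)"

lemma integrable_on_reflect_unit:
  fixes h :: "real \<Rightarrow> real"
  assumes "h integrable_on {0..1}"
  shows "(\<lambda>z. h (1 - z)) integrable_on {0..1}"
proof -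
  obtain i where "(h has_integral i) (cbox 0 1)" using assms by auto
  from has_integral_affinity[OF this, of "-1" 1]
  have "(\<lambda>x. h (1 - x)) integrable_on (\<lambda>x::real. 1 - x) ` {0..1}"
    by (auto simp: integrable_on_def)
  moreover have "(\<lambda>x::real. 1 - x) ` {0..1} = {0..1}"
    by (auto simp: image_iff intro!: bexI[of _ "1 - _"])
  ultimately show ?thesis by simp
qed

lemma recessive_nonvanishing:
  assumes \<alpha>: "\<alpha> > 0" and km: "k0 * m0 = 0" and z: "z \<in> {0<..<1}"
  shows "(recessive_f \<alpha> \<sigma> c k0 k1 m0 m1 z)\<^sup>2 + (recessive_g \<alpha> \<sigma> c k0 k1 m0 m1 z)\<^sup>2 > 0"
proof (rule ccontr)
  let ?f = "recessive_f \<alpha> \<sigma> c k0 k1 m0 m1" and ?g = "recessive_g \<alpha> \<sigma> c k0 k1 m0 m1"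
  assume "\<not> ?thesis"
  then have 0: "?f z = 0" "?g z = 0" by (simp_all add: not_less sum_power2_le_zero_iff)
  obtain \<delta> where \<delta>: "0 < \<delta>" "\<delta> \<le> 1 / 2" "\<And>z. 0 < z \<Longrightarrow> z \<le> \<delta> \<Longrightarrow> ?g z \<ge> \<alpha> * z powr \<alpha>"
    using recessive_g_ge[OF \<alpha>, of \<sigma> c k0 k1 m0 m1] by blast
  have "?g \<delta> = 0"
    by (rule canonical_solution_unique_zero(2)[OF recessive_solution[OF \<alpha> km] z 0]) (use \<delta> in auto)
  moreover have "\<alpha> * \<delta> powr \<alpha> > 0" using \<alpha> \<delta> by simp
  ultimately show False using \<delta>(3)[of \<delta>] \<delta>(1) by simp
qed

text \<open>Both end points are in the limit point case, so a square integrable solution is recessive at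
  both of them; hence the two recessive solutions are proportional.\<close>

lemma square_integrable_connects:
  assumes \<alpha>: "\<alpha> \<ge> 1 / 2" and sol: "square_integrable_solution \<alpha> \<sigma> c k m f g"
  obtains b \<beta> where "b \<noteq> 0"
    "\<And>z. z \<in> {0<..<1} \<Longrightarrow> f z = b * recessive_f \<alpha> \<sigma> c k 0 0 m z \<and> g z = b * recessive_g \<alpha> \<sigma> c k 0 0 m z"
    "\<And>z. z \<in> {0<..<1} \<Longrightarrow> recessive_f \<alpha> \<sigma> c k 0 0 m z = \<beta> * recessive_f \<alpha> (- \<sigma>) c 0 k m 0 (1 - z) \<and>
       recessive_g \<alpha> \<sigma> c k 0 0 m z = - (\<beta> * recessive_g \<alpha> (- \<sigma>) c 0 k m 0 (1 - z))"
proof -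
  have s: "canonical_solution \<alpha> \<sigma> c k 0 0 m f g" "(\<lambda>z. (f z)\<^sup>2 + (g z)\<^sup>2) integrable_on {0..1}"
    and nz: "\<exists>z\<in>{0<..<1}. f z \<noteq> 0 \<or> g z \<noteq> 0"
    using sol unfolding square_integrable_solution_def by auto
  obtain b where b: "\<And>z. z \<in> {0<..<1} \<Longrightarrow> f z = b * recessive_f \<alpha> \<sigma> c k 0 0 m z"
    "\<And>z. z \<in> {0<..<1} \<Longrightarrow> g z = b * recessive_g \<alpha> \<sigma> c k 0 0 m z"
    using limit_point_L2[OF \<alpha> mult_zero_right s] by blast
  have r: "(\<lambda>z. (f (1 - z))\<^sup>2 + (- g (1 - z))\<^sup>2) integrable_on {0..1}"
    using integrable_on_reflect_unit[OF s(2)] by simp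
  obtain b' where b': "\<And>z. z \<in> {0<..<1} \<Longrightarrow> f (1 - z) = b' * recessive_f \<alpha> (- \<sigma>) c 0 k m 0 z"
    "\<And>z. z \<in> {0<..<1} \<Longrightarrow> - g (1 - z) = b' * recessive_g \<alpha> (- \<sigma>) c 0 k m 0 z"
    using limit_point_L2[OF \<alpha> mult_zero_left canonical_solution_reflect[OF s(1)] r] by blast
  have b0: "b \<noteq> 0"
  proof
    assume "b = 0"
    then show False using nz b by auto
  qed
  show ?thesis
  proof (rule that[OF b0, of "b' / b"])
    fix z :: real assume z: "z \<in> {0<..<1}"
    show "f z = b * recessive_f \<alpha> \<sigma> c k 0 0 m z \<and> g z = b * recessive_g \<alpha> \<sigma> c k 0 0 m z"
      using b[OF z] by simp
    have "1 - z \<in> {0<..<1}" using z by auto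
    then have "f z = b' * recessive_f \<alpha> (- \<sigma>) c 0 k m 0 (1 - z)" "- g z = b' * recessive_g \<alpha> (- \<sigma>) c 0 k m 0 (1 - z)"
      using b'[of "1 - z"] by simp_all
    then show "recessive_f \<alpha> \<sigma> c k 0 0 m z = b' / b * recessive_f \<alpha> (- \<sigma>) c 0 k m 0 (1 - z) \<and>
       recessive_g \<alpha> \<sigma> c k 0 0 m z = - (b' / b * recessive_g \<alpha> (- \<sigma>) c 0 k m 0 (1 - z))"
      using b[OF z] b0 by (auto simp: field_simps)
  qed
qed

lemma has_integral_derivative_vanishing_at_ends:
  fixes h h' :: "real \<Rightarrow> real"
  assumes d: "\<And>z. z \<in> {0<..<1} \<Longrightarrow> (h has_real_derivative h' z) (at z)"
    and bd: "\<And>z. z \<in> {0<..<1} \<Longrightarrow> \<bar>h z\<bar> \<le> K * min z (1 - z)"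
  shows "(h' has_integral 0) {0<..<1}"
proof -
  define H where "H z = (if z \<in> {0<..<1} then h z else 0)" for z
  have dH: "(H has_vector_derivative h' z) (at z)" if z: "z \<in> {0<..<1}" for z
  proof -
    have "(H has_real_derivative h' z) (at z)"
      by (rule has_field_derivative_transform_within_open[OF d[OF z], of "{0<..<1}"])
         (use z in \<open>auto simp: H_def\<close>)
    then show ?thesis by (simp add: has_real_derivative_iff_has_vector_derivative)
  qed
  have HK: "\<bar>H z\<bar> \<le> \<bar>K\<bar> * min z (1 - z)" if "z \<in> {0..1}" for z
  proof (cases "z \<in> {0<..<1}")
    case True
    then have "\<bar>h z\<bar> \<le> \<bar>K\<bar> * min z (1 - z)"
      by (intro order_trans[OF bd[OF True]] mult_right_mono) auto
    then show ?thesis using True by (simp add: H_def)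
  qed (use that in \<open>auto simp: H_def\<close>)
  have "continuous_on {0..1} H"
    unfolding continuous_on_eq_continuous_within
  proof
    fix z :: real assume z: "z \<in> {0..1}"
    show "continuous (at z within {0..1}) H"
    proof (cases "z \<in> {0<..<1}")
      case True
      then show ?thesis using dH[OF True] has_vector_derivative_continuous continuous_at_imp_continuous_at_within by blast
    next
      case False
      then have z': "z = 0 \<or> z = 1" using z by auto
      have "((\<lambda>x. \<bar>K\<bar> * min x (1 - x)) \<longlongrightarrow> \<bar>K\<bar> * min z (1 - z)) (at z within {0..1})"
        by (intro tendsto_intros)
      moreover have "min z (1 - z) = 0" using z' by auto
      ultimately have "((\<lambda>x. \<bar>K\<bar> * min x (1 - x)) \<longlongrightarrow> 0) (at z within {0..1})" by simp
      then have "(H \<longlongrightarrow> 0) (at z within {0..1})"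
        by (rule Lim_null_comparison[rotated]) (use HK in \<open>auto simp: eventually_at_filter\<close>)
      moreover have "H z = 0" using z' by (auto simp: H_def)
      ultimately show ?thesis by (simp add: continuous_within)
    qed
  qed
  then have "(h' has_integral H 1 - H 0) {0..1}"
    by (intro fundamental_theorem_of_calculus_interior) (use dH in auto)
  then show ?thesis by (simp add: H_def has_integral_Icc_iff_Ioo)
qed

lemma recessive_tendsto:
  assumes "\<alpha> > 0" "(\<sigma> \<longlongrightarrow> \<sigma>') F" "(c \<longlongrightarrow> c') F" "(k0 \<longlongrightarrow> k0') F" "(k1 \<longlongrightarrow> k1') F"
      "(m0 \<longlongrightarrow> m0') F" "(m1 \<longlongrightarrow> m1') F" "z \<in> {0<..<1}"
  shows "((\<lambda>s. recessive_f \<alpha> (\<sigma> s) (c s) (k0 s) (k1 s) (m0 s) (m1 s) z) \<longlongrightarrow> recessive_f \<alpha> \<sigma>' c' k0' k1' m0' m1' z) F"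
    "((\<lambda>s. recessive_g \<alpha> (\<sigma> s) (c s) (k0 s) (k1 s) (m0 s) (m1 s) z) \<longlongrightarrow> recessive_g \<alpha> \<sigma>' c' k0' k1' m0' m1' z) F"
  unfolding recessive_f_def recessive_g_def
  by (intro tendsto_intros frobenius_FG_tendsto[OF assms(1-7)]; use assms(8) in simp)+

lemma powr_le_sqrt:
  assumes "\<alpha> \<ge> 1 / 2" "0 < z" "z \<le> (1::real)"
  shows "z powr \<alpha> \<le> sqrt z"
  using powr_mono'[of "1 / 2" \<alpha> z] assms by (simp add: powr_half_sqrt)

text \<open>Near \<open>0\<close> the bound is that of the common majorant of the Frobenius series. Near \<open>1\<close> the recessive
  solution for the \<open>n\<close>-th parameters is \<open>\<beta> n\<close> times the reflection of another one; the absolute value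
  of \<open>\<beta> n\<close> can be read off at \<open>1 / 2\<close>, where both solutions converge and do not vanish.\<close>

lemma recessive_uniform_envelope:
  fixes \<sigma> c k m :: "nat \<Rightarrow> real"
  assumes \<alpha>: "\<alpha> \<ge> 1 / 2" and lim: "\<sigma> \<longlonglongrightarrow> \<sigma>'" "c \<longlonglongrightarrow> c'" "k \<longlonglongrightarrow> k'" "m \<longlonglongrightarrow> m'"
    and sol: "\<And>n. \<exists>f g. square_integrable_solution \<alpha> (\<sigma> n) (c n) (k n) (m n) f g"
  obtains K where "K \<ge> 0" "\<And>n z. z \<in> {0<..<1} \<Longrightarrow>
    \<bar>recessive_f \<alpha> (\<sigma> n) (c n) (k n) 0 0 (m n) z\<bar> \<le> K * sqrt (min z (1 - z)) \<and>
    \<bar>recessive_g \<alpha> (\<sigma> n) (c n) (k n) 0 0 (m n) z\<bar> \<le> K * sqrt (min z (1 - z))"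
proof -
  have \<alpha>0: "\<alpha> > 0" using \<alpha> by simp
  define f where "f n = recessive_f \<alpha> (\<sigma> n) (c n) (k n) 0 0 (m n)" for n
  define g where "g n = recessive_g \<alpha> (\<sigma> n) (c n) (k n) 0 0 (m n)" for n
  define p where "p n = recessive_f \<alpha> (- \<sigma> n) (c n) 0 (k n) (m n) 0" for n
  define q where "q n = recessive_g \<alpha> (- \<sigma> n) (c n) 0 (k n) (m n) 0" for n
  have "\<exists>\<beta>. \<forall>z\<in>{0<..<1}. f n z = \<beta> * p n (1 - z) \<and> g n z = - (\<beta> * q n (1 - z))" for n
  proof -
    obtain f0 g0 where s0: "square_integrable_solution \<alpha> (\<sigma> n) (c n) (k n) (m n) f0 g0" using sol by blast
    show ?thesis
      by (rule square_integrable_connects[OF \<alpha> s0]) (unfold f_def g_def p_def q_def, blast)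
  qed
  then obtain \<beta> where \<beta>: "\<And>n z. z \<in> {0<..<1} \<Longrightarrow> f n z = \<beta> n * p n (1 - z) \<and> g n z = - (\<beta> n * q n (1 - z))"
    by metis
  have "\<exists>B. \<forall>n. \<bar>\<sigma> n\<bar> \<le> B \<and> \<bar>c n\<bar> \<le> B \<and> \<bar>k n\<bar> \<le> B \<and> \<bar>m n\<bar> \<le> B"
  proof -
    have "\<exists>B. \<forall>n. \<bar>x n\<bar> \<le> B" if "x \<longlonglongrightarrow> x'" for x :: "nat \<Rightarrow> real" and x'
      using convergent_imp_Bseq[OF convergentI[OF that]] unfolding Bseq_def by auto
    then obtain B1 B2 B3 B4 where B: "\<And>n. \<bar>\<sigma> n\<bar> \<le> B1" "\<And>n. \<bar>c n\<bar> \<le> B2" "\<And>n. \<bar>k n\<bar> \<le> B3" "\<And>n. \<bar>m n\<bar> \<le> B4"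
      using lim by metis
    have "\<bar>\<sigma> n\<bar> \<le> max (max B1 B2) (max B3 B4)" "\<bar>c n\<bar> \<le> max (max B1 B2) (max B3 B4)"
      "\<bar>k n\<bar> \<le> max (max B1 B2) (max B3 B4)" "\<bar>m n\<bar> \<le> max (max B1 B2) (max B3 B4)" for n
      using B[of n] by linarith+
    then show ?thesis by blast
  qed
  then obtain B where B: "\<And>n. \<bar>\<sigma> n\<bar> \<le> B" "\<And>n. \<bar>c n\<bar> \<le> B" "\<And>n. \<bar>k n\<bar> \<le> B" "\<And>n. \<bar>m n\<bar> \<le> B" by blast
  have B0: "\<bar>0\<bar> \<le> B" using B(1)[of 0] by linarith
  obtain K where K: "K \<ge> 0" "\<And>\<sigma> c k0 k1 m0 m1 z. \<lbrakk>\<bar>\<sigma>\<bar> \<le> B; \<bar>c\<bar> \<le> B; \<bar>k0\<bar> \<le> B; \<bar>k1\<bar> \<le> B; \<bar>m0\<bar> \<le> B; \<bar>m1\<bar> \<le> B; 0 < z; z \<le> 1 / 2\<rbrakk>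
     \<Longrightarrow> \<bar>recessive_f \<alpha> \<sigma> c k0 k1 m0 m1 z\<bar> \<le> K * z powr \<alpha> \<and> \<bar>recessive_g \<alpha> \<sigma> c k0 k1 m0 m1 z\<bar> \<le> K * z powr \<alpha>"
    by (rule recessive_bound[OF \<alpha>0, of B]) auto
  have Ks: "K * z powr \<alpha> \<le> K * sqrt z" if "0 < z" "z \<le> 1 / 2" for z
    using powr_le_sqrt[OF \<alpha>, of z] that K(1) by (intro mult_left_mono) auto
  have fg: "\<bar>f n z\<bar> \<le> K * sqrt z" "\<bar>g n z\<bar> \<le> K * sqrt z" if "0 < z" "z \<le> 1 / 2" for n z
    using K(2)[OF B(1)[of n] B(2)[of n] B(3)[of n] B0 B0 B(4)[of n] that] Ks[OF that]
    unfolding f_def g_def by linarith+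
  have pq: "\<bar>p n z\<bar> \<le> K * sqrt z" "\<bar>q n z\<bar> \<le> K * sqrt z" if "0 < z" "z \<le> 1 / 2" for n z
    using K(2)[of "- \<sigma> n" "c n" 0 "k n" "m n" 0, OF _ B(2)[of n] B0 B(3)[of n] B(4)[of n] B0 that] B(1)[of n] Ks[OF that]
    unfolding p_def q_def by fastforce+
  \<comment> \<open>The squares of the connection coefficients converge.\<close>
  have half: "(1 / 2 :: real) \<in> {0<..<1}" by simp
  have N0: "(p n (1 / 2))\<^sup>2 + (q n (1 / 2))\<^sup>2 > 0" for n
    unfolding p_def q_def by (rule recessive_nonvanishing[OF \<alpha>0 _ half]) simp
  have \<beta>2: "(\<beta> n)\<^sup>2 = ((f n (1 / 2))\<^sup>2 + (g n (1 / 2))\<^sup>2) / ((p n (1 / 2))\<^sup>2 + (q n (1 / 2))\<^sup>2)" for n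
  proof -
    have "(f n (1 / 2))\<^sup>2 + (g n (1 / 2))\<^sup>2 = (\<beta> n)\<^sup>2 * ((p n (1 / 2))\<^sup>2 + (q n (1 / 2))\<^sup>2)"
      using \<beta>[OF half, of n] by (simp add: power_mult_distrib distrib_left)
    moreover have "(p n (1 / 2))\<^sup>2 + (q n (1 / 2))\<^sup>2 \<noteq> 0" using N0[of n] by linarith
    ultimately show ?thesis by (metis nonzero_mult_div_cancel_right)
  qed
  have ne: "(recessive_f \<alpha> (- \<sigma>') c' 0 k' m' 0 (1 / 2))\<^sup>2 + (recessive_g \<alpha> (- \<sigma>') c' 0 k' m' 0 (1 / 2))\<^sup>2 \<noteq> 0"
    using recessive_nonvanishing[OF \<alpha>0 mult_zero_left half] by (metis less_irrefl)
  have lim\<beta>: "(\<lambda>n. (\<beta> n)\<^sup>2) \<longlonglongrightarrow>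
     ((recessive_f \<alpha> \<sigma>' c' k' 0 0 m' (1 / 2))\<^sup>2 + (recessive_g \<alpha> \<sigma>' c' k' 0 0 m' (1 / 2))\<^sup>2) /
     ((recessive_f \<alpha> (- \<sigma>') c' 0 k' m' 0 (1 / 2))\<^sup>2 + (recessive_g \<alpha> (- \<sigma>') c' 0 k' m' 0 (1 / 2))\<^sup>2)"
    unfolding \<beta>2 f_def g_def p_def q_def
    by (intro tendsto_intros recessive_tendsto[OF \<alpha>0] lim half ne)
  then obtain M where M: "\<And>n. (\<beta> n)\<^sup>2 \<le> M"
    using convergent_imp_Bseq[OF convergentI[OF lim\<beta>]] unfolding Bseq_def by auto
  have \<beta>M: "\<bar>\<beta> n\<bar> \<le> sqrt M" for n using M[of n] by (metis real_sqrt_abs real_sqrt_le_iff)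
  have M0: "sqrt M \<ge> 0" using \<beta>M[of 0] abs_ge_zero[of "\<beta> 0"] by linarith
  show ?thesis
  proof (rule that[of "K * (1 + sqrt M)"])
    show "K * (1 + sqrt M) \<ge> 0" using K(1) M0 by simp
  next
    fix n and z :: real assume z: "z \<in> {0<..<1}"
    show "\<bar>recessive_f \<alpha> (\<sigma> n) (c n) (k n) 0 0 (m n) z\<bar> \<le> K * (1 + sqrt M) * sqrt (min z (1 - z)) \<and>
      \<bar>recessive_g \<alpha> (\<sigma> n) (c n) (k n) 0 0 (m n) z\<bar> \<le> K * (1 + sqrt M) * sqrt (min z (1 - z))"
      unfolding f_def[symmetric] g_def[symmetric]
    proof (cases "z \<le> 1 / 2")
      case True
      then have mn: "min z (1 - z) = z" by simp
      have "K * sqrt z * 1 \<le> K * sqrt z * (1 + sqrt M)" using K(1) z M0 by (intro mult_left_mono) auto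
      then show "\<bar>f n z\<bar> \<le> K * (1 + sqrt M) * sqrt (min z (1 - z)) \<and> \<bar>g n z\<bar> \<le> K * (1 + sqrt M) * sqrt (min z (1 - z))"
        unfolding mn using fg[of z n] z True by (simp add: mult_ac)
    next
      case False
      then have mn: "min z (1 - z) = 1 - z" by simp
      have z': "0 < 1 - z" "1 - z \<le> 1 / 2" using z False by auto
      have "\<bar>\<beta> n\<bar> * \<bar>x\<bar> \<le> K * (1 + sqrt M) * sqrt (1 - z)" if "\<bar>x\<bar> \<le> K * sqrt (1 - z)" for x
      proof -
        have "\<bar>\<beta> n\<bar> * \<bar>x\<bar> \<le> (1 + sqrt M) * (K * sqrt (1 - z))"
          using that \<beta>M[of n] by (intro mult_mono) auto
        then show ?thesis by (simp add: mult_ac)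
      qed
      then show "\<bar>f n z\<bar> \<le> K * (1 + sqrt M) * sqrt (min z (1 - z)) \<and> \<bar>g n z\<bar> \<le> K * (1 + sqrt M) * sqrt (min z (1 - z))"
        unfolding mn using \<beta>[OF z, of n] pq[OF z', of n] by (simp add: abs_mult)
    qed
  qed
qed

text \<open>The Feynman-Hellmann formula. The Wronskian of the eigenfunctions for two parameter values
  vanishes at both end points, so the integral of its derivative is zero; dividing by the parameter
  difference and passing to the limit gives the formula.\<close>

theorem feynman_hellmann:
  fixes \<sigma> c k m :: "real \<Rightarrow> real"
  assumes \<alpha>: "\<alpha> \<ge> 1 / 2"
    and d: "(\<sigma> has_real_derivative d\<sigma>) (at s0)" "(c has_real_derivative dc) (at s0)"
      "(k has_real_derivative dk) (at s0)" "(m has_real_derivative dm) (at s0)"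
    and r: "r > 0"
    and sol: "\<And>s. \<bar>s - s0\<bar> < r \<Longrightarrow> \<exists>f g. square_integrable_solution \<alpha> (\<sigma> s) (c s) (k s) (m s) f g"
  defines "f \<equiv> recessive_f \<alpha> (\<sigma> s0) (c s0) (k s0) 0 0 (m s0)"
    and "g \<equiv> recessive_g \<alpha> (\<sigma> s0) (c s0) (k s0) 0 0 (m s0)"
  shows "((\<lambda>z. (2 * dc + dm / (1 - z)) * (f z)\<^sup>2 + 4 * d\<sigma> * (f z * g z) + (2 * dc + dk / z) * (g z)\<^sup>2)
    has_integral 0) {0<..<1}"
proof -
  have \<alpha>0: "\<alpha> > 0" using \<alpha> by simp
  define X where "X n = s0 + r / (real n + 2)" for n :: nat
  have X0: "X n - s0 \<noteq> 0" "\<bar>X n - s0\<bar> < r" for n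
  proof -
    have "r / (real n + 2) \<le> r / 2" using r by (intro divide_left_mono) auto
    moreover have "r / (real n + 2) > 0" using r by simp
    ultimately show "X n - s0 \<noteq> 0" "\<bar>X n - s0\<bar> < r" using r unfolding X_def by linarith+
  qed
  have Xlim: "X \<longlonglongrightarrow> s0"
  proof -
    have "(\<lambda>n. r / (real n + 2)) \<longlonglongrightarrow> 0"
      by (intro real_tendsto_divide_at_top[OF tendsto_const] filterlim_tendsto_add_at_top[OF tendsto_const]
            filterlim_at_top_mono[OF filterlim_real_sequentially]) auto
    from tendsto_add[OF tendsto_const[of s0] this] show ?thesis by (simp add: X_def[abs_def])
  qed
  then have Xat: "filterlim X (at s0) sequentially"
    by (rule filterlim_atI) (use X0(1) in auto)
  have quot: "(\<lambda>n. (h (X n) - h s0) / (X n - s0)) \<longlonglongrightarrow> dh" and lim: "(\<lambda>n. h (X n)) \<longlonglongrightarrow> h s0"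
    if "(h has_real_derivative dh) (at s0)" for h dh
  proof -
    have "((\<lambda>y. (h y - h s0) / (y - s0)) \<longlongrightarrow> dh) (at s0)"
      using that by (simp add: has_field_derivative_iff)
    from filterlim_compose[OF this Xat] show "(\<lambda>n. (h (X n) - h s0) / (X n - s0)) \<longlonglongrightarrow> dh" .
    have "(h \<longlongrightarrow> h s0) (at s0)" using DERIV_isCont[OF that] by (simp add: isCont_def)
    from filterlim_compose[OF this Xat] show "(\<lambda>n. h (X n)) \<longlonglongrightarrow> h s0" .
  qed
  define q where "q h n = (h (X n) - h s0) / (X n - s0)" for h n
  note qlim = quot[OF d(1), folded q_def] quot[OF d(2), folded q_def] quot[OF d(3), folded q_def] quot[OF d(4), folded q_def]
  define F where "F n = recessive_f \<alpha> (\<sigma> (X n)) (c (X n)) (k (X n)) 0 0 (m (X n))" for n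
  define G where "G n = recessive_g \<alpha> (\<sigma> (X n)) (c (X n)) (k (X n)) 0 0 (m (X n))" for n
  have Fsol: "canonical_solution \<alpha> (\<sigma> (X n)) (c (X n)) (k (X n)) 0 0 (m (X n)) (F n) (G n)" for n
    unfolding F_def G_def by (rule recessive_solution[OF \<alpha>0]) simp
  have fsol: "canonical_solution \<alpha> (\<sigma> s0) (c s0) (k s0) 0 0 (m s0) f g"
    unfolding f_def g_def by (rule recessive_solution[OF \<alpha>0]) simp
  obtain K1 where K1: "K1 \<ge> 0" "\<And>n z. z \<in> {0<..<1} \<Longrightarrow>
    \<bar>F n z\<bar> \<le> K1 * sqrt (min z (1 - z)) \<and> \<bar>G n z\<bar> \<le> K1 * sqrt (min z (1 - z))"
    unfolding F_def G_def
    by (rule recessive_uniform_envelope[OF \<alpha> lim[OF d(1)] lim[OF d(2)] lim[OF d(3)] lim[OF d(4)] sol[OF X0(2)]]) auto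
  have sol0: "\<exists>f g. square_integrable_solution \<alpha> (\<sigma> s0) (c s0) (k s0) (m s0) f g" by (rule sol) (use r in simp)
  obtain K2 where K2: "K2 \<ge> 0" "\<And>z. z \<in> {0<..<1} \<Longrightarrow>
    \<bar>f z\<bar> \<le> K2 * sqrt (min z (1 - z)) \<and> \<bar>g z\<bar> \<le> K2 * sqrt (min z (1 - z))"
    unfolding f_def g_def
    by (rule recessive_uniform_envelope[OF \<alpha> tendsto_const[of "\<sigma> s0"] tendsto_const[of "c s0"]
          tendsto_const[of "k s0"] tendsto_const[of "m s0"] sol0]) auto
  define K where "K = K1 * K2"
  have K0: "K \<ge> 0" using K1 K2 by (simp add: K_def)
  have prod: "\<bar>x * y\<bar> \<le> K * min z (1 - z)"
    if "\<bar>x\<bar> \<le> K1 * sqrt (min z (1 - z))" "\<bar>y\<bar> \<le> K2 * sqrt (min z (1 - z))" "z \<in> {0<..<1}" for x y z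
  proof -
    have "\<bar>x * y\<bar> \<le> (K1 * sqrt (min z (1 - z))) * (K2 * sqrt (min z (1 - z)))"
      unfolding abs_mult using that K1(1) by (intro mult_mono) auto
    also have "\<dots> = K * (sqrt (min z (1 - z)) * sqrt (min z (1 - z)))" by (simp add: K_def)
    also have "\<dots> = K * min z (1 - z)" using that(3) by simp
    finally show ?thesis .
  qed
  have prods: "\<bar>F n z * f z\<bar> \<le> K * min z (1 - z)" "\<bar>F n z * g z\<bar> \<le> K * min z (1 - z)"
    "\<bar>G n z * f z\<bar> \<le> K * min z (1 - z)" "\<bar>G n z * g z\<bar> \<le> K * min z (1 - z)" if "z \<in> {0<..<1}" for n z
    using K1(2)[OF that, of n] K2(2)[OF that] by (auto intro!: prod that)
  define \<phi> where "\<phi> n z = (2 * q c n + q m n / (1 - z)) * (F n z * f z) + 2 * q \<sigma> n * (F n z * g z + G n z * f z)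
     + (2 * q c n + q k n / z) * (G n z * g z)" for n z
  have int\<phi>: "(\<phi> n has_integral 0) {0<..<1}" for n
  proof (rule has_integral_derivative_vanishing_at_ends)
    fix z :: real assume z: "z \<in> {0<..<1}"
    have dF: "(F n has_real_derivative diag_coeff \<alpha> (\<sigma> (X n)) z * F n z + offdiag_coeff (c (X n)) (k (X n)) 0 z * G n z) (at z)"
      "(G n has_real_derivative - offdiag_coeff (c (X n)) 0 (m (X n)) z * F n z - diag_coeff \<alpha> (\<sigma> (X n)) z * G n z) (at z)"
      using Fsol[of n] z unfolding canonical_solution_def by auto
    have df: "(f has_real_derivative diag_coeff \<alpha> (\<sigma> s0) z * f z + offdiag_coeff (c s0) (k s0) 0 z * g z) (at z)"
      "(g has_real_derivative - offdiag_coeff (c s0) 0 (m s0) z * f z - diag_coeff \<alpha> (\<sigma> s0) z * g z) (at z)"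
      using fsol z unfolding canonical_solution_def by auto
    have "((\<lambda>z. F n z * g z - G n z * f z) has_real_derivative
       (offdiag_coeff (c (X n)) 0 (m (X n)) z - offdiag_coeff (c s0) 0 (m s0) z) * (F n z * f z)
       + (diag_coeff \<alpha> (\<sigma> (X n)) z - diag_coeff \<alpha> (\<sigma> s0) z) * (F n z * g z + G n z * f z)
       + (offdiag_coeff (c (X n)) (k (X n)) 0 z - offdiag_coeff (c s0) (k s0) 0 z) * (G n z * g z)) (at z)"
      by (auto intro!: derivative_eq_intros dF df simp: algebra_simps)
    from DERIV_cdivide[OF this, of "X n - s0"]
    show "((\<lambda>z. (F n z * g z - G n z * f z) / (X n - s0)) has_real_derivative \<phi> n z) (at z)"
      by (rule DERIV_cong)
         (simp add: \<phi>_def q_def diag_coeff_def offdiag_coeff_def add_divide_distrib diff_divide_distrib algebra_simps)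
    have "\<bar>F n z * g z - G n z * f z\<bar> \<le> 2 * K * min z (1 - z)"
      using prods(2,3)[OF z, of n] by linarith
    then show "\<bar>(F n z * g z - G n z * f z) / (X n - s0)\<bar> \<le> (2 * K / \<bar>X n - s0\<bar>) * min z (1 - z)"
      by (simp add: abs_divide divide_right_mono)
  qed
  have "\<exists>A. \<forall>n. \<bar>q \<sigma> n\<bar> \<le> A \<and> \<bar>q c n\<bar> \<le> A \<and> \<bar>q k n\<bar> \<le> A \<and> \<bar>q m n\<bar> \<le> A"
  proof -
    have bd: "\<exists>B. \<forall>n. \<bar>x n\<bar> \<le> B" if "x \<longlonglongrightarrow> x'" for x :: "nat \<Rightarrow> real" and x'
      using convergent_imp_Bseq[OF convergentI[OF that]] unfolding Bseq_def by auto
    obtain B1 B2 B3 B4 where B: "\<And>n. \<bar>q \<sigma> n\<bar> \<le> B1" "\<And>n. \<bar>q c n\<bar> \<le> B2" "\<And>n. \<bar>q k n\<bar> \<le> B3" "\<And>n. \<bar>q m n\<bar> \<le> B4"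
      using bd[OF qlim(1)] bd[OF qlim(2)] bd[OF qlim(3)] bd[OF qlim(4)] by blast
    have "\<bar>q \<sigma> n\<bar> \<le> max (max B1 B2) (max B3 B4)" "\<bar>q c n\<bar> \<le> max (max B1 B2) (max B3 B4)"
      "\<bar>q k n\<bar> \<le> max (max B1 B2) (max B3 B4)" "\<bar>q m n\<bar> \<le> max (max B1 B2) (max B3 B4)" for n
      using B[of n] by linarith+
    then show ?thesis by blast
  qed
  then obtain A where A: "\<And>n. \<bar>q \<sigma> n\<bar> \<le> A" "\<And>n. \<bar>q c n\<bar> \<le> A" "\<And>n. \<bar>q k n\<bar> \<le> A" "\<And>n. \<bar>q m n\<bar> \<le> A" by blast
  have A0: "A \<ge> 0" using A(1)[of 0] by linarith
  show ?thesis
  proof (rule has_integral_dominated_convergence[of \<phi> "\<lambda>_. 0" _ "\<lambda>_. 10 * (A * K)"])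
    show "(\<phi> n has_integral 0) {0<..<1}" for n by (rule int\<phi>)
    show "(\<lambda>_. 10 * (A * K)) integrable_on {0<..<1::real}"
      using integrable_const_ivl[of "10 * (A * K)" 0 "1::real"] by (simp only: integrable_on_Icc_iff_Ioo)
    show "\<forall>z\<in>{0<..<1}. norm (\<phi> n z) \<le> 10 * (A * K)" for n
    proof (intro ballI)
      fix z :: real assume z: "z \<in> {0<..<1}"
      have mn: "min z (1 - z) \<le> 1" "min z (1 - z) \<le> z" "min z (1 - z) \<le> 1 - z" using z by auto
      have le1: "\<bar>x * y\<bar> \<le> A * K" if "\<bar>x\<bar> \<le> A" "\<bar>y\<bar> \<le> K * min z (1 - z)" for x y
      proof -
        have "K * min z (1 - z) \<le> K * 1" using K0 mn by (intro mult_left_mono) auto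
        then have "\<bar>y\<bar> \<le> K" using that(2) by simp
        then show ?thesis unfolding abs_mult using that(1) A0 by (intro mult_mono) auto
      qed
      have le2: "\<bar>x / w * y\<bar> \<le> A * K" if "\<bar>x\<bar> \<le> A" "\<bar>y\<bar> \<le> K * min z (1 - z)" "min z (1 - z) \<le> w" "w > 0" for x y w
      proof -
        have "K * min z (1 - z) \<le> K * w" using K0 that by (intro mult_left_mono) auto
        then have "\<bar>y\<bar> / w \<le> K" using that by (simp add: pos_divide_le_eq)
        then have "\<bar>x\<bar> * (\<bar>y\<bar> / w) \<le> A * K" using that(1,4) A0 by (intro mult_mono) auto
        then show ?thesis using that(4) by (simp add: abs_mult)
      qed
      note P = prods[OF z, of n]
      have "\<bar>q c n * (F n z * f z)\<bar> \<le> A * K" "\<bar>q c n * (G n z * g z)\<bar> \<le> A * K"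
        "\<bar>q \<sigma> n * (F n z * g z)\<bar> \<le> A * K" "\<bar>q \<sigma> n * (G n z * f z)\<bar> \<le> A * K"
        by (intro le1 A P)+
      moreover have "\<bar>q m n / (1 - z) * (F n z * f z)\<bar> \<le> A * K" "\<bar>q k n / z * (G n z * g z)\<bar> \<le> A * K"
        by (intro le2 A P mn; use z in simp)+
      moreover have "\<phi> n z = 2 * (q c n * (F n z * f z)) + q m n / (1 - z) * (F n z * f z)
         + 2 * (q \<sigma> n * (F n z * g z)) + 2 * (q \<sigma> n * (G n z * f z))
         + 2 * (q c n * (G n z * g z)) + q k n / z * (G n z * g z)"
        unfolding \<phi>_def by (simp add: algebra_simps)
      ultimately show "norm (\<phi> n z) \<le> 10 * (A * K)" unfolding real_norm_def by linarith
    qed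
    show "\<forall>z\<in>{0<..<1}. (\<lambda>n. \<phi> n z) \<longlonglongrightarrow>
       (2 * dc + dm / (1 - z)) * (f z)\<^sup>2 + 4 * d\<sigma> * (f z * g z) + (2 * dc + dk / z) * (g z)\<^sup>2"
    proof
      fix z :: real assume z: "z \<in> {0<..<1}"
      have FG: "(\<lambda>n. F n z) \<longlonglongrightarrow> f z" "(\<lambda>n. G n z) \<longlonglongrightarrow> g z"
        unfolding F_def G_def f_def g_def
        by (intro recessive_tendsto[OF \<alpha>0 _ _ _ _ _ _ z] lim[OF d(1)] lim[OF d(2)] lim[OF d(3)] lim[OF d(4)] tendsto_const)+
      have "(\<lambda>n. \<phi> n z) \<longlonglongrightarrow> (2 * dc + dm / (1 - z)) * (f z * f z) + 2 * d\<sigma> * (f z * g z + g z * f z)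
         + (2 * dc + dk / z) * (g z * g z)"
        unfolding \<phi>_def using z by (intro tendsto_intros qlim FG) auto
      then show "(\<lambda>n. \<phi> n z) \<longlonglongrightarrow>
       (2 * dc + dm / (1 - z)) * (f z)\<^sup>2 + 4 * d\<sigma> * (f z * g z) + (2 * dc + dk / z) * (g z)\<^sup>2"
        by (simp add: power2_eq_square algebra_simps)
    qed
  qed simp
qed

section \<open>Isomonodromic deformation and the partial differential equation\<close>

text \<open>Here \<open>R\<close> is the right-hand side of the differential equation for \<open>\<omega>\<close>, and \<open>\<rho>\<close> stands for
  \<open>1 / (cosh u)\<^sup>2\<close>. The quadratic form is \<open>y\<^sup>T J B y\<close>, where the infinitesimal gauge transformation
  \<open>B = ((2 \<sigma> z + b, 2 c z - 2 c), (- 2 c z, - 2 \<sigma> z - b))\<close> solves \<open>DM = B' + [B, M]\<close> for the matrix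
  \<open>M\<close> of the system \<open>y' = M y\<close> and its derivative \<open>DM\<close> in the direction of the deformation.\<close>

lemma isomonodromic_derivative:
  fixes \<alpha> c \<tau> \<omega> :: real
  defines "\<sigma> \<equiv> c * \<tau>" and "\<rho> \<equiv> 1 - \<tau>\<^sup>2"
  defines "b \<equiv> - 2 * \<alpha> * \<rho> - \<sigma>"
  defines "R \<equiv> 8 * \<alpha>\<^sup>2 * \<tau> * \<rho> + 2 * c * \<sigma> + c"
  assumes sol: "canonical_solution \<alpha> \<sigma> c (\<omega> - 2 * \<alpha> * \<tau> - c) 0 0 (\<omega> + 2 * \<alpha> * \<tau> - c) f g"
    and z: "z \<in> {0<..<1}"
  shows "((\<lambda>z. 2 * c * z * (f z)\<^sup>2 + 2 * (2 * \<sigma> * z + b) * (f z * g z) + 2 * c * (z - 1) * (g z)\<^sup>2)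
    has_real_derivative
      (2 * c + 4 * \<omega> * \<sigma> + (R - c + 2 * \<omega> * (2 * \<alpha> * \<rho> - \<sigma>)) / (1 - z)) * (f z)\<^sup>2
      + (4 * \<sigma> + 8 * \<omega> * c) * (f z * g z)
      + (2 * c + 4 * \<omega> * \<sigma> + (R - c + 2 * \<omega> * (- 2 * \<alpha> * \<rho> - \<sigma>)) / z) * (g z)\<^sup>2) (at z)"
proof -
  define v w where "v = 1 / z" and "w = 1 / (1 - z)"
  have vw: "z * v = 1" "z * w = w - 1" using z by (auto simp: v_def w_def field_simps)
  define q where "q = - \<alpha> * v + \<alpha> * w + 2 * \<sigma>"
  define S where "S = 2 * c + (\<omega> - 2 * \<alpha> * \<tau> - c) * v"
  define P where "P = 2 * c + (\<omega> + 2 * \<alpha> * \<tau> - c) * w"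
  have d: "(f has_real_derivative q * f z + S * g z) (at z)" "(g has_real_derivative - P * f z - q * g z) (at z)"
    using sol z unfolding canonical_solution_def
    by (auto simp: q_def S_def P_def v_def w_def diag_coeff_def offdiag_coeff_def)
  have 1: "2 * c + 4 * c * z * q - 2 * (2 * \<sigma> * z + b) * P = 2 * c + 4 * \<omega> * \<sigma> + (R - c + 2 * \<omega> * (2 * \<alpha> * \<rho> - \<sigma>)) * w"
    using vw unfolding q_def P_def R_def b_def \<sigma>_def \<rho>_def by algebra
  have 2: "4 * c * z * S + 4 * \<sigma> - 4 * c * (z - 1) * P = 4 * \<sigma> + 8 * \<omega> * c"
    using vw unfolding S_def P_def \<sigma>_def by algebra
  have 3: "2 * (2 * \<sigma> * z + b) * S + 2 * c - 4 * c * (z - 1) * q = 2 * c + 4 * \<omega> * \<sigma> + (R - c + 2 * \<omega> * (- 2 * \<alpha> * \<rho> - \<sigma>)) * v"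
    using vw unfolding q_def S_def R_def b_def \<sigma>_def \<rho>_def by algebra
  have "((\<lambda>z. 2 * c * z * (f z)\<^sup>2 + 2 * (2 * \<sigma> * z + b) * (f z * g z) + 2 * c * (z - 1) * (g z)\<^sup>2)
    has_real_derivative
      (2 * c + 4 * c * z * q - 2 * (2 * \<sigma> * z + b) * P) * (f z)\<^sup>2
      + (4 * c * z * S + 4 * \<sigma> - 4 * c * (z - 1) * P) * (f z * g z)
      + (2 * (2 * \<sigma> * z + b) * S + 2 * c - 4 * c * (z - 1) * q) * (g z)\<^sup>2) (at z)"
    by (auto intro!: derivative_eq_intros d simp: power2_eq_square) (simp add: algebra_simps)
  then show ?thesis unfolding 1 2 3 by (simp add: v_def w_def)
qed

text \<open>Near zero the weight integrand is bounded below by a positive constant on an interval.\<close>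

lemma recessive_weighted_norm_not_null:
  assumes \<alpha>: "\<alpha> > 0"
    and int: "((\<lambda>z. d * ((recessive_f \<alpha> \<sigma> c k0 k1 m0 m1 z)\<^sup>2 / (1 - z) + (recessive_g \<alpha> \<sigma> c k0 k1 m0 m1 z)\<^sup>2 / z))
       has_integral 0) {0<..<1}"
  shows "d = 0"
proof (rule ccontr)
  assume d0: "d \<noteq> 0"
  let ?f = "recessive_f \<alpha> \<sigma> c k0 k1 m0 m1" and ?g = "recessive_g \<alpha> \<sigma> c k0 k1 m0 m1"
  define N where "N z = (?f z)\<^sup>2 / (1 - z) + (?g z)\<^sup>2 / z" for z
  have "((\<lambda>z. 1 / d * (d * N z)) has_integral 1 / d * 0) {0<..<1}"
    by (rule has_integral_mult_right) (use int in \<open>simp add: N_def\<close>)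
  then have N: "(N has_integral 0) {0..1}" using d0 by (simp add: has_integral_Icc_iff_Ioo)
  obtain \<delta> where \<delta>: "0 < \<delta>" "\<delta> \<le> 1 / 2" "\<And>z. 0 < z \<Longrightarrow> z \<le> \<delta> \<Longrightarrow> ?g z \<ge> \<alpha> * z powr \<alpha>"
    using recessive_g_ge[OF \<alpha>, of \<sigma> c k0 k1 m0 m1] by blast
  define e where "e = (\<alpha> * (\<delta> / 2) powr \<alpha>)\<^sup>2"
  have e: "e > 0" using \<alpha> \<delta> by (simp add: e_def)
  have low: "e \<le> N z" if z: "z \<in> {\<delta> / 2..\<delta>}" for z
  proof -
    have z0: "0 < z" "z < 1" using z \<delta> by auto
    have "\<alpha> * (\<delta> / 2) powr \<alpha> \<le> \<alpha> * z powr \<alpha>"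
      using z \<delta> \<alpha> by (intro mult_left_mono powr_mono2) auto
    also have "\<dots> \<le> ?g z" using \<delta>(3)[of z] z z0 by auto
    finally have "e \<le> (?g z)\<^sup>2" unfolding e_def using \<alpha> by (intro power_mono) auto
    also have "\<dots> \<le> (?g z)\<^sup>2 / z" using z0 by (simp add: le_divide_eq mult_left_le)
    also have "\<dots> \<le> N z" using z0 by (simp add: N_def)
    finally show ?thesis .
  qed
  have Nsub: "N integrable_on {\<delta> / 2..\<delta>}"
    by (rule integrable_on_subinterval[OF has_integral_integrable[OF N]]) (use \<delta> in auto)
  have "((\<lambda>_. e) has_integral (\<delta> - \<delta> / 2) *\<^sub>R e) {\<delta> / 2..\<delta>}"
    by (rule has_integral_const_real[THEN has_integral_eq_rhs]) (use \<delta> in simp)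
  then have "(\<delta> - \<delta> / 2) *\<^sub>R e \<le> integral {\<delta> / 2..\<delta>} N"
    by (rule has_integral_le[OF _ integrable_integral[OF Nsub]]) (rule low)
  also have "\<dots> \<le> integral {0..1} N"
    by (rule integral_subset_le[OF _ Nsub has_integral_integrable[OF N]]) (use \<delta> in \<open>auto simp: N_def\<close>)
  also have "\<dots> = 0" using N by (rule integral_unique)
  finally show False using \<delta> e by (simp add: mult_le_0_iff)
qed

text \<open>The Feynman-Hellmann integrals for \<open>t\<close> and \<open>u\<close> are added with the weights \<open>1\<close> and \<open>2 * \<omega>\<close>. In the difference
  to the integrated isomonodromic identity everything cancels except for a multiple of the weighted norm of
  the eigenfunction.\<close>

theorem eigenvalue_pde:
  fixes \<Omega> :: "real \<Rightarrow> real \<Rightarrow> real"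
  assumes \<alpha>: "\<alpha> \<ge> 1 / 2" and r: "r > 0"
    and dt: "((\<lambda>s. \<Omega> s u) has_real_derivative \<omega>t) (at t)"
    and du: "((\<lambda>v. \<Omega> t v) has_real_derivative \<omega>u) (at u)"
    and solt: "\<And>s. \<bar>s - t\<bar> < r \<Longrightarrow> \<exists>f g. square_integrable_solution \<alpha> (exp s * sinh u) (exp s * cosh u)
        (\<Omega> s u - 2 * \<alpha> * tanh u - exp s * cosh u) (\<Omega> s u + 2 * \<alpha> * tanh u - exp s * cosh u) f g"
    and solu: "\<And>v. \<bar>v - u\<bar> < r \<Longrightarrow> \<exists>f g. square_integrable_solution \<alpha> (exp t * sinh v) (exp t * cosh v)
        (\<Omega> t v - 2 * \<alpha> * tanh v - exp t * cosh v) (\<Omega> t v + 2 * \<alpha> * tanh v - exp t * cosh v) f g"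
  shows "\<omega>t + 2 * \<Omega> t u * \<omega>u = 8 * \<alpha>\<^sup>2 * (tanh u / (cosh u)\<^sup>2) + exp (2 * t) * sinh (2 * u) + exp t * cosh u"
proof -
  have \<alpha>0: "\<alpha> > 0" using \<alpha> by simp
  define c where "c = exp t * cosh u"
  define \<tau> where "\<tau> = tanh u"
  define \<rho> where "\<rho> = 1 - \<tau>\<^sup>2"
  define \<omega> where "\<omega> = \<Omega> t u"
  have \<sigma>: "exp t * sinh u = c * \<tau>" by (simp add: c_def \<tau>_def tanh_def)
  have cosh2: "1 / (cosh u)\<^sup>2 = \<rho>"
  proof -
    have "\<rho> = ((cosh u)\<^sup>2 - (sinh u)\<^sup>2) / (cosh u)\<^sup>2"
      by (simp add: \<rho>_def \<tau>_def tanh_def power_divide diff_divide_distrib)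
    then show ?thesis by (simp add: cosh_square_eq)
  qed
  define f where "f = recessive_f \<alpha> (c * \<tau>) c (\<omega> - 2 * \<alpha> * \<tau> - c) 0 0 (\<omega> + 2 * \<alpha> * \<tau> - c)"
  define g where "g = recessive_g \<alpha> (c * \<tau>) c (\<omega> - 2 * \<alpha> * \<tau> - c) 0 0 (\<omega> + 2 * \<alpha> * \<tau> - c)"
  have It: "((\<lambda>z. (2 * c + (\<omega>t - c) / (1 - z)) * (f z)\<^sup>2 + 4 * (c * \<tau>) * (f z * g z) + (2 * c + (\<omega>t - c) / z) * (g z)\<^sup>2)
      has_integral 0) {0<..<1}"
  proof -
    have "((\<lambda>s. exp s * sinh u) has_real_derivative exp t * sinh u) (at t)"
      "((\<lambda>s. exp s * cosh u) has_real_derivative exp t * cosh u) (at t)"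
      "((\<lambda>s. \<Omega> s u - 2 * \<alpha> * tanh u - exp s * cosh u) has_real_derivative \<omega>t - exp t * cosh u) (at t)"
      "((\<lambda>s. \<Omega> s u + 2 * \<alpha> * tanh u - exp s * cosh u) has_real_derivative \<omega>t - exp t * cosh u) (at t)"
      by (auto intro!: derivative_eq_intros dt)
    from feynman_hellmann[OF \<alpha> this r solt]
    show ?thesis
      unfolding f_def g_def \<sigma> c_def[symmetric] \<tau>_def[symmetric] \<omega>_def[symmetric] by simp
  qed
  have Iu: "((\<lambda>z. (2 * (c * \<tau>) + (\<omega>u + 2 * \<alpha> * \<rho> - c * \<tau>) / (1 - z)) * (f z)\<^sup>2 + 4 * c * (f z * g z)
      + (2 * (c * \<tau>) + (\<omega>u - 2 * \<alpha> * \<rho> - c * \<tau>) / z) * (g z)\<^sup>2) has_integral 0) {0<..<1}"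
  proof -
    have dtanh: "((\<lambda>v. 2 * \<alpha> * tanh v) has_real_derivative 2 * \<alpha> * \<rho>) (at u)"
      by (auto intro!: derivative_eq_intros simp: \<rho>_def \<tau>_def)
    have dcosh: "((\<lambda>v. exp t * cosh v) has_real_derivative exp t * sinh u) (at u)"
      and dsinh: "((\<lambda>v. exp t * sinh v) has_real_derivative exp t * cosh u) (at u)"
      by (auto intro!: derivative_eq_intros)
    note dk = DERIV_diff[OF DERIV_diff[OF du dtanh] dcosh] and dm = DERIV_diff[OF DERIV_add[OF du dtanh] dcosh]
    from feynman_hellmann[OF \<alpha> dsinh dcosh dk dm r solu]
    show ?thesis
      unfolding f_def g_def \<sigma> c_def[symmetric] \<tau>_def[symmetric] \<omega>_def[symmetric] by simp
  qed
  define b where "b = - 2 * \<alpha> * \<rho> - c * \<tau>"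
  define R where "R = 8 * \<alpha>\<^sup>2 * \<tau> * \<rho> + 2 * c * (c * \<tau>) + c"
  have sol: "canonical_solution \<alpha> (c * \<tau>) c (\<omega> - 2 * \<alpha> * \<tau> - c) 0 0 (\<omega> + 2 * \<alpha> * \<tau> - c) f g"
    unfolding f_def g_def by (rule recessive_solution[OF \<alpha>0]) simp
  have sol0: "\<exists>f g. square_integrable_solution \<alpha> (c * \<tau>) c (\<omega> - 2 * \<alpha> * \<tau> - c) (\<omega> + 2 * \<alpha> * \<tau> - c) f g"
    using solt[of t] r unfolding \<sigma> c_def[symmetric] \<tau>_def[symmetric] \<omega>_def[symmetric] by simp
  obtain K where K: "K \<ge> 0" "\<And>z. z \<in> {0<..<1} \<Longrightarrow>
    \<bar>f z\<bar> \<le> K * sqrt (min z (1 - z)) \<and> \<bar>g z\<bar> \<le> K * sqrt (min z (1 - z))"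
    unfolding f_def g_def
    by (rule recessive_uniform_envelope[OF \<alpha> tendsto_const[of "c * \<tau>"] tendsto_const[of c]
          tendsto_const[of "\<omega> - 2 * \<alpha> * \<tau> - c"] tendsto_const[of "\<omega> + 2 * \<alpha> * \<tau> - c"] sol0]) auto
  have "((\<lambda>z. (2 * c + 4 * \<omega> * (c * \<tau>) + (R - c + 2 * \<omega> * (2 * \<alpha> * \<rho> - c * \<tau>)) / (1 - z)) * (f z)\<^sup>2
      + (4 * (c * \<tau>) + 8 * \<omega> * c) * (f z * g z)
      + (2 * c + 4 * \<omega> * (c * \<tau>) + (R - c + 2 * \<omega> * (- 2 * \<alpha> * \<rho> - c * \<tau>)) / z) * (g z)\<^sup>2) has_integral 0) {0<..<1}"
  proof (rule has_integral_derivative_vanishing_at_ends)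
    fix z :: real assume z: "z \<in> {0<..<1}"
    show "((\<lambda>z. 2 * c * z * (f z)\<^sup>2 + 2 * (2 * (c * \<tau>) * z + b) * (f z * g z) + 2 * c * (z - 1) * (g z)\<^sup>2)
    has_real_derivative
      (2 * c + 4 * \<omega> * (c * \<tau>) + (R - c + 2 * \<omega> * (2 * \<alpha> * \<rho> - c * \<tau>)) / (1 - z)) * (f z)\<^sup>2
      + (4 * (c * \<tau>) + 8 * \<omega> * c) * (f z * g z)
      + (2 * c + 4 * \<omega> * (c * \<tau>) + (R - c + 2 * \<omega> * (- 2 * \<alpha> * \<rho> - c * \<tau>)) / z) * (g z)\<^sup>2) (at z)"
      unfolding R_def b_def \<rho>_def by (rule isomonodromic_derivative[OF sol z])
    define M where "M = K\<^sup>2 * min z (1 - z)"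
    have prod: "\<bar>x * y\<bar> \<le> M" if "\<bar>x\<bar> \<le> K * sqrt (min z (1 - z))" "\<bar>y\<bar> \<le> K * sqrt (min z (1 - z))" for x y
    proof -
      have "\<bar>x * y\<bar> \<le> (K * sqrt (min z (1 - z))) * (K * sqrt (min z (1 - z)))"
        unfolding abs_mult using that K(1) by (intro mult_mono) auto
      also have "\<dots> = K\<^sup>2 * (sqrt (min z (1 - z)) * sqrt (min z (1 - z)))" by (simp add: power2_eq_square)
      also have "\<dots> = M" using z by (simp add: M_def)
      finally show ?thesis .
    qed
    have fg: "\<bar>(f z)\<^sup>2\<bar> \<le> M" "\<bar>f z * g z\<bar> \<le> M" "\<bar>(g z)\<^sup>2\<bar> \<le> M"
    proof -
      have kf: "\<bar>f z\<bar> \<le> K * sqrt (min z (1 - z))" and kg: "\<bar>g z\<bar> \<le> K * sqrt (min z (1 - z))"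
        using K(2)[OF z] by blast+
      show "\<bar>(f z)\<^sup>2\<bar> \<le> M" "\<bar>f z * g z\<bar> \<le> M" "\<bar>(g z)\<^sup>2\<bar> \<le> M"
        unfolding power2_eq_square by (rule prod[OF kf kf] prod[OF kf kg] prod[OF kg kg])+
    qed
    have bd: "\<bar>x * y\<bar> \<le> X * M" if "\<bar>x\<bar> \<le> X" "\<bar>y\<bar> \<le> M" for x y X
      unfolding abs_mult using that by (intro mult_mono) auto
    have c1: "\<bar>2 * c * z\<bar> \<le> 2 * \<bar>c\<bar>" and c3: "\<bar>2 * c * (z - 1)\<bar> \<le> 2 * \<bar>c\<bar>"
      using z by (simp_all add: abs_mult mult_left_le)
    have c2: "\<bar>2 * (2 * (c * \<tau>) * z + b)\<bar> \<le> 2 * (2 * \<bar>c * \<tau>\<bar> + \<bar>b\<bar>)"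
    proof -
      have "\<bar>2 * (c * \<tau>) * z\<bar> \<le> 2 * \<bar>c * \<tau>\<bar>" using z by (simp add: abs_mult mult_left_le)
      moreover have "\<bar>2 * (w + b)\<bar> \<le> 2 * (V + \<bar>b\<bar>)" if "\<bar>w\<bar> \<le> V" for w V :: real
        using that abs_triangle_ineq[of w b] by (simp add: abs_mult)
      ultimately show ?thesis by presburger
    qed
    have "\<bar>2 * c * z * (f z)\<^sup>2\<bar> \<le> 2 * \<bar>c\<bar> * M"
      "\<bar>2 * (2 * (c * \<tau>) * z + b) * (f z * g z)\<bar> \<le> 2 * (2 * \<bar>c * \<tau>\<bar> + \<bar>b\<bar>) * M"
      "\<bar>2 * c * (z - 1) * (g z)\<^sup>2\<bar> \<le> 2 * \<bar>c\<bar> * M"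
      by (rule bd[OF c1 fg(1)] bd[OF c2 fg(2)] bd[OF c3 fg(3)])+
    then have "\<bar>2 * c * z * (f z)\<^sup>2 + 2 * (2 * (c * \<tau>) * z + b) * (f z * g z) + 2 * c * (z - 1) * (g z)\<^sup>2\<bar>
       \<le> 2 * \<bar>c\<bar> * M + 2 * (2 * \<bar>c * \<tau>\<bar> + \<bar>b\<bar>) * M + 2 * \<bar>c\<bar> * M" by linarith
    also have "\<dots> = ((4 * \<bar>c\<bar> + 2 * (2 * \<bar>c * \<tau>\<bar> + \<bar>b\<bar>)) * K\<^sup>2) * min z (1 - z)"
      by (simp add: M_def algebra_simps)
    finally show "\<bar>2 * c * z * (f z)\<^sup>2 + 2 * (2 * (c * \<tau>) * z + b) * (f z * g z) + 2 * c * (z - 1) * (g z)\<^sup>2\<bar>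
       \<le> ((4 * \<bar>c\<bar> + 2 * (2 * \<bar>c * \<tau>\<bar> + \<bar>b\<bar>)) * K\<^sup>2) * min z (1 - z)" .
  qed
  from has_integral_diff[OF has_integral_add[OF It has_integral_mult_right[OF Iu, of "2 * \<omega>"]] this]
  have "((\<lambda>z. (\<omega>t + 2 * \<omega> * \<omega>u - R) * ((f z)\<^sup>2 / (1 - z) + (g z)\<^sup>2 / z)) has_integral 0) {0<..<1}"
    by (simp, elim has_integral_eq[rotated])
       (simp add: add_divide_distrib diff_divide_distrib algebra_simps)
  then have "\<omega>t + 2 * \<omega> * \<omega>u - R = 0"
    unfolding f_def g_def by (rule recessive_weighted_norm_not_null[OF \<alpha>0])
  moreover have "R = 8 * \<alpha>\<^sup>2 * (tanh u / (cosh u)\<^sup>2) + exp (2 * t) * sinh (2 * u) + exp t * cosh u"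
  proof -
    have "exp (2 * t) = exp t * exp t" by (simp flip: exp_add)
    then have "exp (2 * t) * sinh (2 * u) = 2 * c * (c * \<tau>)"
      unfolding \<sigma>[symmetric] by (simp add: sinh_double c_def)
    moreover have "tanh u / (cosh u)\<^sup>2 = \<tau> * \<rho>" using cosh2 by (simp add: \<tau>_def divide_inverse)
    ultimately show ?thesis by (simp add: R_def c_def)
  qed
  ultimately show ?thesis by (simp add: \<omega>_def)
qed

section \<open>The eigenvalues of the Hamiltonian operator\<close>

lemma mat2_mult_vec:
  fixes A :: "complex^2^2"
  shows "(A *v x) $ 1 = A $ 1 $ 1 * x $ 1 + A $ 1 $ 2 * x $ 2" "(A *v x) $ 2 = A $ 2 $ 1 * x $ 1 + A $ 2 $ 2 * x $ 2"
  by (simp_all add: matrix_vector_mult_def sum_2)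

lemma W_mat_mult: "(W_mat z *v x) $ 1 = complex_of_real (1 / (1 - z)) * x $ 1" "(W_mat z *v x) $ 2 = complex_of_real (1 / z) * x $ 2"
  by (simp_all add: mat2_mult_vec W_mat_def)

lemma J_mat_mult: "(J_mat *v x) $ 1 = - x $ 2" "(J_mat *v x) $ 2 = x $ 1"
  by (simp_all add: mat2_mult_vec J_mat_def)

lemma matrix_inv_W_mat:
  assumes z: "z \<in> {0<..<1}"
  shows "W_mat z *v (matrix_inv (W_mat z) *v x) = x" "matrix_inv (W_mat z) *v (W_mat z *v x) = x"
proof -
  define V :: "complex^2^2" where "V = vector [vector [complex_of_real (1 - z), 0], vector [0, complex_of_real z]]"
  have z0: "complex_of_real z \<noteq> 0" "complex_of_real (1 - z) \<noteq> 0" using z by auto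
  have "W_mat z ** V = mat 1" "V ** W_mat z = mat 1"
    using z0 by (auto simp: vec_eq_iff forall_2 matrix_matrix_mult_def sum_2 mat_def W_mat_def V_def)
  then have "\<exists>V. W_mat z ** V = mat 1 \<and> V ** W_mat z = mat 1" by blast
  then have inv: "W_mat z ** matrix_inv (W_mat z) = mat 1 \<and> matrix_inv (W_mat z) ** W_mat z = mat 1"
    unfolding matrix_inv_def by (rule someI_ex)
  then show "W_mat z *v (matrix_inv (W_mat z) *v x) = x" "matrix_inv (W_mat z) *v (W_mat z *v x) = x"
    by (simp_all add: matrix_vector_mul_assoc)
qed

definition canonical_rhs :: "real \<Rightarrow> real \<Rightarrow> real \<Rightarrow> real \<Rightarrow> real \<Rightarrow> (real \<Rightarrow> complex^2) \<Rightarrow> real \<Rightarrow> complex^2" where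
  "canonical_rhs \<alpha> \<sigma> c k m y z = vector
     [complex_of_real (diag_coeff \<alpha> \<sigma> z) * y z $ 1 + complex_of_real (offdiag_coeff c k 0 z) * y z $ 2,
      - complex_of_real (offdiag_coeff c 0 m z) * y z $ 1 - complex_of_real (diag_coeff \<alpha> \<sigma> z) * y z $ 2]"

text \<open>Multiplication by the invertible weight removes the inverse from the operator.\<close>

lemma ham_expr_eq_iff:
  assumes z: "z \<in> {0<..<1}"
  shows "ham_expr \<mu> t u y z = complex_of_real \<omega> *s y z \<longleftrightarrow>
    vector_derivative y (at z) = canonical_rhs ((\<mu> + 1) / 2) (exp t * sinh u) (exp t * cosh u)
      (\<omega> - (\<mu> + 1) * tanh u - exp t * cosh u) (\<omega> + (\<mu> + 1) * tanh u - exp t * cosh u) y z"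
proof -
  let ?d = "vector_derivative y (at z)"
  have "ham_expr \<mu> t u y z = complex_of_real \<omega> *s y z \<longleftrightarrow>
      J_mat *v ?d - Phi_mat \<mu> z t u *v y z = W_mat z *v (complex_of_real \<omega> *s y z)"
    unfolding ham_expr_def using matrix_inv_W_mat[OF z] by metis
  also have "\<dots> \<longleftrightarrow> ?d = canonical_rhs ((\<mu> + 1) / 2) (exp t * sinh u) (exp t * cosh u)
      (\<omega> - (\<mu> + 1) * tanh u - exp t * cosh u) (\<omega> + (\<mu> + 1) * tanh u - exp t * cosh u) y z"
    unfolding vec_eq_iff forall_2 vector_minus_component J_mat_mult W_mat_mult canonical_rhs_def
    by (auto simp: mat2_mult_vec Phi_mat_def Let_def diag_coeff_def offdiag_coeff_def algebra_simps
          add_divide_distrib diff_divide_distrib eq_diff_eq)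
  finally show ?thesis .
qed

lemma weighted_norm_eq:
  "(\<Sum>i\<in>UNIV. cnj (x $ i) * (W_mat z *v x) $ i) = complex_of_real ((cmod (x $ 1))\<^sup>2 / (1 - z) + (cmod (x $ 2))\<^sup>2 / z)"
proof -
  have *: "cnj a * (complex_of_real r * a) = complex_of_real (r * (cmod a)\<^sup>2)" for a r
    using complex_norm_square[of a] by (simp add: mult_ac)
  show ?thesis unfolding sum_2 W_mat_mult * by simp
qed

text \<open>Multiplied by \<open>(z * (1 - z))\<^sup>2\<close> the determinant is a polynomial with the value \<open>- \<alpha>\<^sup>2\<close> at \<open>0\<close>.\<close>

lemma finite_zeros_canonical_det:
  assumes "\<alpha> \<noteq> 0"
  shows "finite {z \<in> {0<..<1}. offdiag_coeff c k 0 z * offdiag_coeff c 0 m z - (diag_coeff \<alpha> \<sigma> z)\<^sup>2 = 0}"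
proof -
  define Q where "Q = [:k, 2 * c:] * [:2 * c + m, - 2 * c:] * [:0, 1, - 1:] - [:- \<alpha>, 2 * \<alpha> + 2 * \<sigma>, - 2 * \<sigma>:]\<^sup>2"
  have "poly Q 0 = - (\<alpha>\<^sup>2)" by (simp add: Q_def)
  then have "Q \<noteq> 0" using assms by auto
  then have fin: "finite {z. poly Q z = 0}" by (rule poly_roots_finite)
  have "poly Q z = 0" if z: "z \<in> {0<..<1}"
    and eq: "offdiag_coeff c k 0 z * offdiag_coeff c 0 m z - (diag_coeff \<alpha> \<sigma> z)\<^sup>2 = 0" for z
  proof -
    have z0: "z \<noteq> 0" "1 - z \<noteq> 0" using z by auto
    have S: "poly [:k, 2 * c:] z = offdiag_coeff c k 0 z * z"
      and P: "poly [:2 * c + m, - 2 * c:] z = offdiag_coeff c 0 m z * (1 - z)"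
      using z0 by (simp_all add: offdiag_coeff_def field_simps)
    have q: "poly [:- \<alpha>, 2 * \<alpha> + 2 * \<sigma>, - 2 * \<sigma>:] z = diag_coeff \<alpha> \<sigma> z * (z * (1 - z))"
    proof -
      have "diag_coeff \<alpha> \<sigma> z * (z * (1 - z)) = - \<alpha> * (1 - z) + \<alpha> * z + 2 * \<sigma> * (z * (1 - z))"
        using z0 by (simp add: diag_coeff_def divide_simps)
      then show ?thesis by (simp only:) (simp add: algebra_simps)
    qed
    have "poly Q z = (offdiag_coeff c k 0 z * offdiag_coeff c 0 m z - (diag_coeff \<alpha> \<sigma> z)\<^sup>2) * (z * (1 - z))\<^sup>2"
      unfolding Q_def poly_diff poly_mult poly_power S P q by (simp add: power2_eq_square algebra_simps)
    then show ?thesis using eq by simp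
  qed
  then have sub: "{z \<in> {0<..<1}. offdiag_coeff c k 0 z * offdiag_coeff c 0 m z - (diag_coeff \<alpha> \<sigma> z)\<^sup>2 = 0}
      \<subseteq> {z. poly Q z = 0}" by blast
  show ?thesis by (rule finite_subset[OF sub fin])
qed

lemma has_vector_derivative_scaleR_const:
  "(r has_real_derivative r') (at z) \<Longrightarrow> ((\<lambda>z. r z *\<^sub>R v) has_vector_derivative r' *\<^sub>R v) (at z)"
  using has_vector_derivative_scaleR[of r r' z UNIV "\<lambda>_. v" 0] by simp

lemma classical_solution_of_ham:
  assumes \<alpha>: "\<alpha> > 0" and ac: "locally_abs_continuous_on {0<..<1} y"
    and ae: "AE z in lebesgue_on {0<..<1}. vector_derivative y (at z) = canonical_rhs \<alpha> \<sigma> c k m y z"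
    and z: "z \<in> {0<..<1}"
  shows "(y has_vector_derivative canonical_rhs \<alpha> \<sigma> c k m y z) (at z)"
proof -
  define q where "q = diag_coeff \<alpha> \<sigma>"
  define S where "S = offdiag_coeff c k 0"
  define P where "P = offdiag_coeff c 0 m"
  define q' where "q' z = \<alpha> / z\<^sup>2 + \<alpha> / (1 - z)\<^sup>2" for z
  define S' where "S' z = - k / z\<^sup>2" for z
  define P' where "P' z = m / (1 - z)\<^sup>2" for z
  have dq: "(q has_real_derivative q' z) (at z)" and dS: "(S has_real_derivative S' z) (at z)"
    and dP: "(P has_real_derivative P' z) (at z)" if "z \<in> {0<..<1}" for z
    unfolding q_def S_def P_def q'_def S'_def P'_def diag_coeff_def[abs_def] offdiag_coeff_def[abs_def]
    using that by (auto intro!: derivative_eq_intros simp: power2_eq_square)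
  have cq': "continuous_on {0<..<1} q'" "continuous_on {0<..<1} S'" "continuous_on {0<..<1} P'"
    unfolding q'_def S'_def P'_def by (intro continuous_intros; force)+
  have cq: "continuous_on {0<..<1} q" "continuous_on {0<..<1} S" "continuous_on {0<..<1} P"
    unfolding q_def S_def P_def diag_coeff_def[abs_def] offdiag_coeff_def[abs_def]
    by (intro continuous_intros; force)+
  define \<Delta> where "\<Delta> z = S z * P z - (q z)\<^sup>2" for z
  define \<Delta>' where "\<Delta>' z = S' z * P z + S z * P' z - 2 * q z * q' z" for z
  have d\<Delta>: "(\<Delta> has_real_derivative \<Delta>' z) (at z)" if "z \<in> {0<..<1}" for z
    unfolding \<Delta>_def \<Delta>'_def by (auto intro!: derivative_eq_intros dq dS dP that)
  define X where "X = {z \<in> {0<..<1}. \<Delta> z = 0}"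
  have X: "finite X" unfolding X_def \<Delta>_def S_def P_def q_def
    by (rule finite_zeros_canonical_det) (use \<alpha> in simp)
  \<comment> \<open>By Cramer's rule the default value of an undefined derivative determines \<open>y\<close>.\<close>
  define D :: "complex^2" where "D = (SOME d. False)"
  define e1 :: "complex^2" where "e1 = vector [- D $ 1, D $ 2]"
  define e2 :: "complex^2" where "e2 = vector [- D $ 2, 0]"
  define e3 :: "complex^2" where "e3 = vector [0, D $ 1]"
  define cr where "cr z = (q z / \<Delta> z) *\<^sub>R e1 + (S z / \<Delta> z) *\<^sub>R e2 + (P z / \<Delta> z) *\<^sub>R e3" for z
  define cr' where "cr' z = ((q' z * \<Delta> z - q z * \<Delta>' z) / (\<Delta> z)\<^sup>2) *\<^sub>R e1
      + ((S' z * \<Delta> z - S z * \<Delta>' z) / (\<Delta> z)\<^sup>2) *\<^sub>R e2 + ((P' z * \<Delta> z - P z * \<Delta>' z) / (\<Delta> z)\<^sup>2) *\<^sub>R e3" for z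
  have cont: "continuous_on {0<..<1} y"
  proof (rule continuous_at_imp_continuous_on, rule ballI)
    fix x :: real assume x: "x \<in> {0<..<1}"
    have "x / 2 \<le> (x + 1) / 2 \<and> {x / 2..(x + 1) / 2} \<subseteq> {0<..<1}" using x by auto
    then have "abs_continuous_on {x / 2..(x + 1) / 2} y"
      using ac unfolding locally_abs_continuous_on_def by blast
    then have "continuous_on {x / 2..(x + 1) / 2} y" by (rule abs_continuous_imp_continuous_on)
    then show "continuous (at x) y"
      by (rule continuous_on_interior) (use x in auto)
  qed
  show ?thesis
  proof (rule classical_solution_of_ae_solution[OF ac _ ae X _ _ _ z])
    show "continuous_on {0<..<1} (canonical_rhs \<alpha> \<sigma> c k m y)"
    proof -
      have "continuous_on {0<..<1} (\<lambda>z. complex_of_real (q z) * y z $ 1 + complex_of_real (S z) * y z $ 2)"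
        "continuous_on {0<..<1} (\<lambda>z. - complex_of_real (P z) * y z $ 1 - complex_of_real (q z) * y z $ 2)"
        by (intro continuous_intros cq cont)+
      then have "continuous_on {0<..<1} (\<lambda>z. (canonical_rhs \<alpha> \<sigma> c k m y z) $ i)" for i
        using exhaust_2[of i] unfolding canonical_rhs_def q_def[symmetric] S_def[symmetric] P_def[symmetric]
        by (elim disjE) simp_all
      then have "continuous_on {0<..<1} (\<lambda>z. \<chi> i. (canonical_rhs \<alpha> \<sigma> c k m y z) $ i)"
        by (rule continuous_on_vec_lambda)
      then show ?thesis by simp
    qed
    show "(cr has_vector_derivative cr' z) (at z)" if "z \<in> {0<..<1} - X" for z
    proof -
      have z: "z \<in> {0<..<1}" "\<Delta> z \<noteq> 0" using that by (auto simp: X_def)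
      have quot: "((\<lambda>z. (h z / \<Delta> z) *\<^sub>R v) has_vector_derivative ((h' * \<Delta> z - h z * \<Delta>' z) / (\<Delta> z)\<^sup>2) *\<^sub>R v) (at z)"
        if "(h has_real_derivative h') (at z)" for h h' and v :: "complex^2"
        using has_vector_derivative_scaleR_const[OF DERIV_divide[OF that d\<Delta>[OF z(1)] z(2)]]
        by (simp add: power2_eq_square)
      show ?thesis unfolding cr_def cr'_def
        by (intro has_vector_derivative_add quot dq dS dP z)
    qed
    have sub: "{0<..<1} - X \<subseteq> {0<..<1}" by blast
    note sub_cont = continuous_on_subset[OF _ sub]
    have c\<Delta>: "continuous_on {0<..<1} \<Delta>" "continuous_on {0<..<1} \<Delta>'"
      unfolding \<Delta>_def \<Delta>'_def by (intro continuous_intros cq cq')+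
    have ne: "\<forall>z\<in>{0<..<1} - X. (\<Delta> z)\<^sup>2 \<noteq> 0" by (auto simp: X_def)
    show "continuous_on ({0<..<1} - X) cr'"
      unfolding cr'_def
      by (intro continuous_intros sub_cont[OF cq(1)] sub_cont[OF cq(2)] sub_cont[OF cq(3)] sub_cont[OF cq'(1)]
          sub_cont[OF cq'(2)] sub_cont[OF cq'(3)] sub_cont[OF c\<Delta>(1)] sub_cont[OF c\<Delta>(2)] ne)
    show "y z = cr z" if z: "z \<in> {0<..<1} - X" and eq: "canonical_rhs \<alpha> \<sigma> c k m y z = (SOME d. False)" for z
    proof -
      have \<Delta>0: "\<Delta> z \<noteq> 0" using z by (auto simp: X_def)
      have D12: "D $ 1 = complex_of_real (q z) * y z $ 1 + complex_of_real (S z) * y z $ 2"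
        "D $ 2 = - complex_of_real (P z) * y z $ 1 - complex_of_real (q z) * y z $ 2"
        using eq unfolding D_def[symmetric] canonical_rhs_def q_def[symmetric] S_def[symmetric] P_def[symmetric]
        by (metis vector_2(1), metis vector_2(2))
      have "\<Delta> z *\<^sub>R y z = \<Delta> z *\<^sub>R cr z"
      proof -
        have "\<Delta> z *\<^sub>R cr z = q z *\<^sub>R e1 + S z *\<^sub>R e2 + P z *\<^sub>R e3"
          using \<Delta>0 by (simp add: cr_def scaleR_add_right)
        also have "\<dots> = \<Delta> z *\<^sub>R y z"
          by (simp add: vec_eq_iff forall_2 e1_def e2_def e3_def D12 \<Delta>_def scaleR_conv_of_real[where 'a = complex] power2_eq_square algebra_simps)
        finally show ?thesis by (rule sym)
      qed
      then show ?thesis using \<Delta>0 by simp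
    qed
  qed
qed


text \<open>Once the eigenfunction is classical, its real and imaginary parts solve the same real system; one of them is
  not zero.\<close>

theorem square_integrable_of_ham_eigenvalue:
  assumes \<mu>: "\<mu> \<ge> 0" and ev: "ham_eigenvalue \<mu> t u (complex_of_real \<omega>)"
  shows "\<exists>f g. square_integrable_solution ((\<mu> + 1) / 2) (exp t * sinh u) (exp t * cosh u)
      (\<omega> - (\<mu> + 1) * tanh u - exp t * cosh u) (\<omega> + (\<mu> + 1) * tanh u - exp t * cosh u) f g"
proof -
  define \<alpha> where "\<alpha> = (\<mu> + 1) / 2"
  define \<sigma> where "\<sigma> = exp t * sinh u"
  define c where "c = exp t * cosh u"
  define k where "k = \<omega> - (\<mu> + 1) * tanh u - c"
  define m where "m = \<omega> + (\<mu> + 1) * tanh u - c"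
  note defs = \<alpha>_def[symmetric] \<sigma>_def[symmetric] c_def[symmetric] k_def[symmetric] m_def[symmetric]
  have \<alpha>: "\<alpha> > 0" using \<mu> by (simp add: \<alpha>_def)
  obtain y where y: "y \<in> L2_W" "locally_abs_continuous_on {0<..<1} y"
    and nz: "\<not> (AE z in lebesgue_on {0<..<1}. y z = 0)"
    and eq: "AE z in lebesgue_on {0<..<1}. ham_expr \<mu> t u y z = complex_of_real \<omega> *s y z"
    using ev unfolding ham_eigenvalue_def ham_domain_def by blast
  have "AE z in lebesgue_on {0<..<1}. vector_derivative y (at z) = canonical_rhs \<alpha> \<sigma> c k m y z"
    using eq AE_space
  proof eventually_elim
    case (elim z)
    then have "z \<in> {0<..<1}" by simp
    from ham_expr_eq_iff[OF this, of \<mu> t u y \<omega>] elim(1) show ?case unfolding defs by simp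
  qed
  then have d: "(y has_vector_derivative canonical_rhs \<alpha> \<sigma> c k m y z) (at z)" if "z \<in> {0<..<1}" for z
    by (rule classical_solution_of_ham[OF \<alpha> y(2) _ that])
  have dlin: "((\<lambda>z. L (y z $ i)) has_real_derivative L (canonical_rhs \<alpha> \<sigma> c k m y z $ i)) (at z)"
    if L: "bounded_linear L" "z \<in> {0<..<1}" for L :: "complex \<Rightarrow> real" and i z
    using bounded_linear.has_vector_derivative[OF bounded_linear_compose[OF L(1) bounded_linear_vec_nth] d[OF L(2)]]
    by (simp add: has_real_derivative_iff_has_vector_derivative)
  have solRe: "canonical_solution \<alpha> \<sigma> c k 0 0 m (\<lambda>z. Re (y z $ 1)) (\<lambda>z. Re (y z $ 2))"
    unfolding canonical_solution_def
    using dlin[OF bounded_linear_Re, of _ 1] dlin[OF bounded_linear_Re, of _ 2] by (simp add: canonical_rhs_def)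
  have solIm: "canonical_solution \<alpha> \<sigma> c k 0 0 m (\<lambda>z. Im (y z $ 1)) (\<lambda>z. Im (y z $ 2))"
    unfolding canonical_solution_def
    using dlin[OF bounded_linear_Im, of _ 1] dlin[OF bounded_linear_Im, of _ 2] by (simp add: canonical_rhs_def)
  define N where "N z = (cmod (y z $ 1))\<^sup>2 / (1 - z) + (cmod (y z $ 2))\<^sup>2 / z" for z
  have "integrable (lebesgue_on {0<..<1}) (\<lambda>z. complex_of_real (N z))"
    using y(1) unfolding L2_W_def N_def by (simp only: mem_Collect_eq weighted_norm_eq)
  then have N: "N integrable_on {0<..<1}"
    unfolding complex_of_real_integrable_eq by (rule integrable_on_lebesgue_on) simp
  have int: "(\<lambda>z. (L (y z $ 1))\<^sup>2 + (L (y z $ 2))\<^sup>2) integrable_on {0..1}"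
    if L: "bounded_linear L" "\<And>a. \<bar>L a\<bar> \<le> cmod a" for L :: "complex \<Rightarrow> real"
    unfolding integrable_on_Icc_iff_Ioo
  proof (rule measurable_bounded_by_integrable_imp_integrable[OF _ N])
    have "continuous_on {0<..<1} (\<lambda>z. L (y z $ i))" for i
      by (rule continuous_at_imp_continuous_on) (use dlin[OF L(1)] DERIV_isCont in blast)
    then show "(\<lambda>z. (L (y z $ 1))\<^sup>2 + (L (y z $ 2))\<^sup>2) \<in> borel_measurable (lebesgue_on {0<..<1})"
      by (intro continuous_imp_measurable_on_sets_lebesgue continuous_intros) auto
  next
    fix z :: real assume z: "z \<in> {0<..<1}"
    have sq: "(L a)\<^sup>2 \<le> (cmod a)\<^sup>2" for a using L(2)[of a] by (simp add: abs_le_square_iff[symmetric])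
    have "(L (y z $ 1))\<^sup>2 \<le> (cmod (y z $ 1))\<^sup>2 / (1 - z)"
      by (rule order_trans[OF sq]) (use z in \<open>simp add: le_divide_eq mult_left_le\<close>)
    moreover have "(L (y z $ 2))\<^sup>2 \<le> (cmod (y z $ 2))\<^sup>2 / z"
      by (rule order_trans[OF sq]) (use z in \<open>simp add: le_divide_eq mult_left_le\<close>)
    ultimately show "norm ((L (y z $ 1))\<^sup>2 + (L (y z $ 2))\<^sup>2) \<le> N z" by (simp add: N_def)
  qed simp
  have "\<exists>z\<in>{0<..<1}. y z \<noteq> 0"
  proof (rule ccontr)
    assume "\<not> ?thesis"
    then have "AE z in lebesgue_on {0<..<1}. y z = 0" by (intro AE_I2) auto
    then show False using nz by blast
  qed
  then obtain z where z: "z \<in> {0<..<1}" "y z $ 1 \<noteq> 0 \<or> y z $ 2 \<noteq> 0" by (auto simp: vec_eq_iff forall_2)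
  show ?thesis unfolding defs
  proof (cases "Re (y z $ 1) \<noteq> 0 \<or> Re (y z $ 2) \<noteq> 0")
    case True
    then show "\<exists>f g. square_integrable_solution \<alpha> \<sigma> c k m f g"
      using solRe int[OF bounded_linear_Re abs_Re_le_cmod] z(1) unfolding square_integrable_solution_def by blast
  next
    case False
    then have "Im (y z $ 1) \<noteq> 0 \<or> Im (y z $ 2) \<noteq> 0" using z(2) by (auto simp: complex_eq_iff)
    then show "\<exists>f g. square_integrable_solution \<alpha> \<sigma> c k m f g"
      using solIm int[OF bounded_linear_Im abs_Im_le_cmod] z(1) unfolding square_integrable_solution_def by blast
  qed
qed

lemma L2_W_of_envelope:
  assumes cont: "continuous_on {0<..<1} f" "continuous_on {0<..<1} g"
    and K: "\<And>z. z \<in> {0<..<1} \<Longrightarrow> \<bar>f z\<bar> \<le> K * sqrt (min z (1 - z)) \<and> \<bar>g z\<bar> \<le> K * sqrt (min z (1 - z))"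
    and h: "\<And>z. z \<in> {0<..<1} \<Longrightarrow> h z = vector [complex_of_real (f z), complex_of_real (g z)]"
  shows "h \<in> L2_W"
proof -
  define y :: "real \<Rightarrow> complex^2" where "y z = (\<chi> i. if i = 1 then complex_of_real (f z) else complex_of_real (g z))" for z
  have hy: "h z = y z" if "z \<in> {0<..<1}" for z using h[OF that] by (simp add: y_def vec_eq_iff forall_2)
  have "continuous_on {0<..<1} (\<lambda>z. if i = 1 then complex_of_real (f z) else complex_of_real (g z))" for i :: 2
    by (cases "i = 1") (auto intro!: continuous_intros cont)
  then have "continuous_on {0<..<1} y" unfolding y_def by (rule continuous_on_vec_lambda)
  then have "y \<in> borel_measurable (lebesgue_on {0<..<1})"
    by (rule continuous_imp_measurable_on_sets_lebesgue) simp
  then have m: "h \<in> borel_measurable (lebesgue_on {0<..<1})"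
    by (rule measurable_cong[THEN iffD1, rotated]) (simp add: hy)
  define N where "N z = (f z)\<^sup>2 / (1 - z) + (g z)\<^sup>2 / z" for z
  interpret finite_measure "lebesgue_on {0<..<1::real}" by (rule finite_measure_lebesgue_on) simp
  have "integrable (lebesgue_on {0<..<1}) N"
  proof (rule integrable_const_bound[of _ "2 * K\<^sup>2"])
    have "norm (N z) \<le> 2 * K\<^sup>2" if z: "z \<in> {0<..<1}" for z
    proof -
      have sq: "x\<^sup>2 / v \<le> K\<^sup>2" if "\<bar>x\<bar> \<le> K * sqrt (min z (1 - z))" "min z (1 - z) \<le> v" "v > 0" for x v
      proof -
        have "\<bar>x\<bar>\<^sup>2 \<le> (K * sqrt (min z (1 - z)))\<^sup>2" using that(1) by (intro power_mono) auto
        also have "\<dots> = K\<^sup>2 * min z (1 - z)" using z by (simp add: power_mult_distrib)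
        also have "\<dots> \<le> K\<^sup>2 * v" using that by (intro mult_left_mono) auto
        finally show ?thesis using that(3) by (simp add: divide_le_eq)
      qed
      have "(f z)\<^sup>2 / (1 - z) \<le> K\<^sup>2" "(g z)\<^sup>2 / z \<le> K\<^sup>2"
        using K[OF z] z by (auto intro!: sq)
      moreover have "N z \<ge> 0" using z by (simp add: N_def)
      ultimately show ?thesis by (simp add: N_def)
    qed
    then show "AE z in lebesgue_on {0<..<1}. norm (N z) \<le> 2 * K\<^sup>2" by (intro AE_I2) simp
    show "N \<in> borel_measurable (lebesgue_on {0<..<1})"
      unfolding N_def
      by (rule continuous_imp_measurable_on_sets_lebesgue) (auto intro!: continuous_intros cont)
  qed
  then have "integrable (lebesgue_on {0<..<1}) (\<lambda>z. complex_of_real (N z))"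
    unfolding complex_of_real_integrable_eq .
  then have "integrable (lebesgue_on {0<..<1}) (\<lambda>z. \<Sum>i\<in>UNIV. cnj (h z $ i) * (W_mat z *v h z) $ i)"
    unfolding weighted_norm_eq
    by (rule Bochner_Integration.integrable_cong[THEN iffD1, rotated -1]) (auto simp: N_def h)
  with m show ?thesis unfolding L2_W_def by blast
qed

theorem ham_eigenvalue_of_envelope:
  assumes sol: "canonical_solution ((\<mu> + 1) / 2) (exp t * sinh u) (exp t * cosh u)
      (\<omega> - (\<mu> + 1) * tanh u - exp t * cosh u) 0 0 (\<omega> + (\<mu> + 1) * tanh u - exp t * cosh u) f g"
    and K: "\<And>z. z \<in> {0<..<1} \<Longrightarrow> \<bar>f z\<bar> \<le> K * sqrt (min z (1 - z)) \<and> \<bar>g z\<bar> \<le> K * sqrt (min z (1 - z))"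
    and z0: "z0 \<in> {0<..<1}" "f z0 \<noteq> 0 \<or> g z0 \<noteq> 0"
  shows "ham_eigenvalue \<mu> t u (complex_of_real \<omega>)"
proof -
  define \<alpha> where "\<alpha> = (\<mu> + 1) / 2"
  define \<sigma> where "\<sigma> = exp t * sinh u"
  define c where "c = exp t * cosh u"
  define k where "k = \<omega> - (\<mu> + 1) * tanh u - c"
  define m where "m = \<omega> + (\<mu> + 1) * tanh u - c"
  note defs = \<alpha>_def[symmetric] \<sigma>_def[symmetric] c_def[symmetric] k_def[symmetric] m_def[symmetric]
  note sol = sol[unfolded defs]
  define y :: "real \<Rightarrow> complex^2" where "y z = complex_of_real (f z) *s axis 1 1 + complex_of_real (g z) *s axis 2 1" for z
  have y: "y z $ 1 = complex_of_real (f z)" "y z $ 2 = complex_of_real (g z)" for z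
    by (simp_all add: y_def axis_def)
  have df: "(f has_real_derivative diag_coeff \<alpha> \<sigma> z * f z + offdiag_coeff c k 0 z * g z) (at z)"
    and dg: "(g has_real_derivative - offdiag_coeff c 0 m z * f z - diag_coeff \<alpha> \<sigma> z * g z) (at z)"
    if "z \<in> {0<..<1}" for z using sol that unfolding canonical_solution_def by auto
  have cont: "continuous_on {0<..<1} f" "continuous_on {0<..<1} g"
    by (rule continuous_at_imp_continuous_on; use df dg DERIV_isCont in blast)+
  define F where "F z = diag_coeff \<alpha> \<sigma> z * f z + offdiag_coeff c k 0 z * g z" for z
  define G where "G z = - offdiag_coeff c 0 m z * f z - diag_coeff \<alpha> \<sigma> z * g z" for z
  define y' :: "real \<Rightarrow> complex^2" where "y' z = F z *\<^sub>R axis 1 1 + G z *\<^sub>R axis 2 1" for z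
  have y'_rhs: "y' z = canonical_rhs \<alpha> \<sigma> c k m y z" for z
    by (simp add: y'_def vec_eq_iff forall_2 axis_def canonical_rhs_def y F_def G_def scaleR_conv_of_real[where 'a = complex])
  have y_alt: "y = (\<lambda>z. f z *\<^sub>R axis 1 1 + g z *\<^sub>R axis 2 1)"
    by (rule ext) (simp add: vec_eq_iff forall_2 axis_def y scaleR_conv_of_real[where 'a = complex])
  have dy: "(y has_vector_derivative y' z) (at z)" if "z \<in> {0<..<1}" for z
    unfolding y_alt y'_def F_def G_def
    by (intro has_vector_derivative_add has_vector_derivative_scaleR_const df dg that)
  have cFG: "continuous_on {0<..<1} F" "continuous_on {0<..<1} G"
    unfolding F_def G_def diag_coeff_def offdiag_coeff_def by (auto intro!: continuous_intros cont)
  have cy': "continuous_on {0<..<1} y'" unfolding y'_def by (intro continuous_intros cFG)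
  have ac: "locally_abs_continuous_on {0<..<1} y"
    unfolding locally_abs_continuous_on_def
  proof (intro allI impI)
    fix a b :: real assume ab: "a \<le> b \<and> {a..b} \<subseteq> {0<..<1}"
    then have sub: "{a..b} \<subseteq> {0<..<1}" by blast
    obtain L where L: "\<forall>x\<in>{a..b}. norm (y' x) \<le> L"
      using continuous_on_Icc_norm_bounded[OF continuous_on_subset[OF cy' sub]] by blast
    show "abs_continuous_on {a..b} y"
    proof (rule lipschitz_imp_abs_continuous_on[where L = L])
      fix p q assume pq: "p \<in> {a..b}" "q \<in> {a..b}"
      show "dist (y p) (y q) \<le> L * \<bar>p - q\<bar>"
        unfolding dist_norm
      proof (rule lipschitz_of_bounded_vector_derivative[OF _ _ pq])
        fix x assume "x \<in> {a..b}"
        then show "(y has_vector_derivative y' x) (at x within {a..b})"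
          using has_vector_derivative_at_within[OF dy] sub by blast
      qed (use L in blast)
    qed
  qed
  have eq: "ham_expr \<mu> t u y z = complex_of_real \<omega> *s y z" if z: "z \<in> {0<..<1}" for z
    using ham_expr_eq_iff[OF z, of \<mu> t u y \<omega>] vector_derivative_at[OF dy[OF z]] unfolding defs by (simp add: y'_rhs)
  have "y \<in> L2_W"
    by (rule L2_W_of_envelope[OF cont K]) (auto simp: vec_eq_iff forall_2 y)
  moreover have "ham_expr \<mu> t u y \<in> L2_W"
  proof (rule L2_W_of_envelope[of "\<lambda>z. \<omega> * f z" "\<lambda>z. \<omega> * g z" "\<bar>\<omega>\<bar> * K"])
    show "continuous_on {0<..<1} (\<lambda>z. \<omega> * f z)" "continuous_on {0<..<1} (\<lambda>z. \<omega> * g z)"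
      by (intro continuous_intros cont)+
    show "\<bar>\<omega> * f z\<bar> \<le> \<bar>\<omega>\<bar> * K * sqrt (min z (1 - z)) \<and> \<bar>\<omega> * g z\<bar> \<le> \<bar>\<omega>\<bar> * K * sqrt (min z (1 - z))"
      if "z \<in> {0<..<1}" for z
      using K[OF that] by (simp add: abs_mult mult.assoc mult_left_mono)
    show "ham_expr \<mu> t u y z = vector [complex_of_real (\<omega> * f z), complex_of_real (\<omega> * g z)]"
      if "z \<in> {0<..<1}" for z
      using eq[OF that] by (simp add: vec_eq_iff forall_2 y)
  qed
  ultimately have dom: "y \<in> ham_domain \<mu> t u" using ac unfolding ham_domain_def by blast
  have "\<not> (AE z in lebesgue_on {0<..<1}. y z = 0)"
  proof
    assume ae0: "AE z in lebesgue_on {0<..<1}. y z = 0"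
    \<comment> \<open>A continuous function that vanishes almost everywhere vanishes.\<close>
    define D where "D z = (f z)\<^sup>2 + (g z)\<^sup>2" for z
    have "continuous_on {0<..<1} D" unfolding D_def by (intro continuous_intros cont)
    then have opn: "open ({0<..<1} \<inter> D -` {0<..})" by (intro continuous_open_preimage) auto
    moreover have "z0 \<in> {0<..<1} \<inter> D -` {0<..}"
      using z0 by (auto simp: D_def sum_power2_gt_zero_iff)
    ultimately have nn: "\<not> negligible ({0<..<1} \<inter> D -` {0<..})" using open_not_negligible by blast
    have "AE z in lebesgue. z \<notin> {0<..<1} \<inter> D -` {0<..}"
    proof -
      have "AE z in lebesgue. z \<in> {0<..<1} \<longrightarrow> y z = 0" using ae0 by (simp add: AE_restrict_space_iff)
      then show ?thesis
      proof eventually_elim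
        case (elim z)
        show ?case
        proof
          assume "z \<in> {0<..<1} \<inter> D -` {0<..}"
          then have "y z = 0" "D z > 0" using elim by auto
          then show False using y[of z] by (simp add: D_def)
        qed
      qed
    qed
    moreover have "{0<..<1} \<inter> D -` {0<..} \<in> sets lebesgue"
      using opn by simp
    ultimately have "negligible ({0<..<1} \<inter> D -` {0<..})"
      unfolding negligible_iff_null_sets by (subst AE_iff_null_sets)
    then show False using nn by blast
  qed
  moreover have "AE z in lebesgue_on {0<..<1}. ham_expr \<mu> t u y z = complex_of_real \<omega> *s y z"
    by (intro AE_I2) (simp add: eq)
  ultimately show ?thesis using dom unfolding ham_eigenvalue_def by blast
qed

section \<open>Reduction to the spheroidal wave equation\<close>

text \<open>The coefficient of \<open>g\<close> in the equation for \<open>g''\<close> that results from eliminating \<open>f\<close> when \<open>g' = - 2 * c * f - q * g\<close>: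
  it is \<open>q\<^sup>2 - q' - 2 * c * S\<close> for the diagonal coefficient \<open>q\<close> and the off-diagonal coefficient \<open>S\<close> of \<open>g\<close>.\<close>

definition potential :: "real \<Rightarrow> real \<Rightarrow> real \<Rightarrow> real \<Rightarrow> real" where
  "potential \<alpha> c \<tau> z = (diag_coeff \<alpha> (c * \<tau>) z)\<^sup>2 - (\<alpha> / z\<^sup>2 + \<alpha> / (1 - z)\<^sup>2)
      - 2 * c * offdiag_coeff c (- 4 * \<alpha> * \<tau>) 0 z"

lemma diag_coeff_has_derivative:
  "z \<in> {0<..<1} \<Longrightarrow> (diag_coeff \<alpha> \<sigma> has_real_derivative \<alpha> / z\<^sup>2 + \<alpha> / (1 - z)\<^sup>2) (at z)"
  unfolding diag_coeff_def[abs_def] by (auto intro!: derivative_eq_intros simp: power2_eq_square)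

lemma potential_closed_form:
  assumes z: "z \<in> {0<..<1}"
  shows "potential \<alpha> c \<tau> z * (z * (1 - z))\<^sup>2 = (\<alpha>\<^sup>2 - \<alpha>) * (1 - 2 * (z * (1 - z)))
     - 4 * (c\<^sup>2 - (c * \<tau>)\<^sup>2) * (z * (1 - z))\<^sup>2 + (4 * \<alpha> * (c * \<tau>) - 2 * \<alpha>\<^sup>2) * (z * (1 - z))"
proof -
  define v w where "v = 1 / z" and "w = 1 / (1 - z)"
  have vw: "z * v = 1" "(1 - z) * w = 1" using z by (auto simp: v_def w_def)
  have "potential \<alpha> c \<tau> z = (- \<alpha> * v + \<alpha> * w + 2 * (c * \<tau>))\<^sup>2 - (\<alpha> * v\<^sup>2 + \<alpha> * w\<^sup>2) - 2 * c * (2 * c - 4 * \<alpha> * \<tau> * v)"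
    by (simp add: potential_def diag_coeff_def offdiag_coeff_def v_def w_def power_divide)
  then show ?thesis using vw by algebra
qed

text \<open>With \<open>s = sqrt (z * (1 - z))\<close> the substitution \<open>g z = s * w (2 * z - 1)\<close> turns the equation
  \<open>g'' = potential * g\<close> into the spheroidal equation for \<open>w\<close>; this is the identity behind it.\<close>

lemma potential_spheroidal:
  assumes z: "z \<in> {0<..<1}"
  defines "s \<equiv> sqrt (z * (1 - z))"
  shows "s * potential ((\<mu> + 1) / 2) c \<tau> z + 1 / s + (1 - 2 * z)\<^sup>2 / (4 * s ^ 3)
    = - ((\<mu> + 1) * (\<mu> - 2 * (c * \<tau>)) + (c\<^sup>2 - (c * \<tau>)\<^sup>2) * (4 * s\<^sup>2) - \<mu>\<^sup>2 / (4 * s\<^sup>2)) / s"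
proof -
  define p where "p = z * (1 - z)"
  have p: "p > 0" using z by (simp add: p_def)
  have s: "s > 0" "s\<^sup>2 = p" using p by (simp_all add: s_def p_def)
  have s3: "s ^ 3 = s * p" using s(2) by (simp add: power3_eq_cube power2_eq_square)
  have z2: "(1 - 2 * z)\<^sup>2 = 1 - 4 * p" by (simp add: p_def power2_eq_square algebra_simps)
  define \<Phi> where "\<Phi> = potential ((\<mu> + 1) / 2) c \<tau> z"
  have \<Phi>: "\<Phi> * p\<^sup>2 = (((\<mu> + 1) / 2)\<^sup>2 - (\<mu> + 1) / 2) * (1 - 2 * p)
     - 4 * (c\<^sup>2 - (c * \<tau>)\<^sup>2) * p\<^sup>2 + (4 * ((\<mu> + 1) / 2) * (c * \<tau>) - 2 * ((\<mu> + 1) / 2)\<^sup>2) * p"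
    unfolding \<Phi>_def p_def by (rule potential_closed_form[OF z])
  define d where "d = s * (4 * p)"
  have d: "d \<noteq> 0" using s p by (simp add: d_def)
  have "(s * \<Phi> + 1 / s + (1 - 2 * z)\<^sup>2 / (4 * s ^ 3)) * d = 4 * (\<Phi> * p\<^sup>2) + 4 * p + (1 - 4 * p)"
  proof -
    have ss: "s * s = p" using s(2) by (simp add: power2_eq_square)
    have "s * \<Phi> * d = 4 * (\<Phi> * ((s * s) * p))" unfolding d_def by (simp add: algebra_simps)
    then have "s * \<Phi> * d = 4 * (\<Phi> * p\<^sup>2)" unfolding ss by (simp add: power2_eq_square)
    moreover have "1 / s * d = 4 * p" "(1 - 4 * p) / (4 * (s * p)) * d = 1 - 4 * p"
      using s(1) p by (simp_all add: d_def)
    ultimately show ?thesis unfolding z2 s3 distrib_right by simp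
  qed
  also have "\<dots> = - (((\<mu> + 1) * (\<mu> - 2 * (c * \<tau>)) + (c\<^sup>2 - (c * \<tau>)\<^sup>2) * (4 * p)) * (4 * p) - \<mu>\<^sup>2)"
    unfolding \<Phi> by (simp add: power2_eq_square field_simps)
  also have "\<dots> = - ((\<mu> + 1) * (\<mu> - 2 * (c * \<tau>)) + (c\<^sup>2 - (c * \<tau>)\<^sup>2) * (4 * s\<^sup>2) - \<mu>\<^sup>2 / (4 * s\<^sup>2)) / s * d"
  proof -
    have sd: "x / s * d = x * (4 * p)" for x using s(1) by (simp add: d_def)
    show ?thesis unfolding sd s(2) using p by (simp add: algebra_simps)
  qed
  finally show ?thesis unfolding \<Phi>_def mult_right_cancel[OF d] .
qed

lemma sqrt_unit_has_derivative:
  assumes z: "z \<in> {0<..<1}"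
  shows "((\<lambda>z. sqrt (z * (1 - z))) has_real_derivative (1 - 2 * z) / (2 * sqrt (z * (1 - z)))) (at z)"
proof -
  have pos: "0 < z * (1 - z)" using z by simp
  have d: "((\<lambda>z. z * (1 - z)) has_real_derivative 1 - 2 * z) (at z)"
    by (auto intro!: derivative_eq_intros simp: algebra_simps)
  have eq: "inverse R / 2 * x = x / (2 * R)" for R x :: real
    by (cases "R = 0") (simp_all add: field_simps)
  show ?thesis
    using DERIV_chain2[where f = sqrt and g = "\<lambda>z. z * (1 - z)", OF DERIV_real_sqrt[OF pos] d] unfolding eq .
qed

text \<open>With \<open>x = 2 * z - 1\<close> one has \<open>1 - x\<^sup>2 = 4 * s\<^sup>2\<close>, so that the flux \<open>(1 - x\<^sup>2) w'\<close> of the spheroidal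
  equation is the function \<open>N\<close> below, in which \<open>g1\<close> is the derivative of \<open>g\<close>.\<close>

theorem spheroidal_eigenvalue_of_envelope:
  assumes sol: "canonical_solution ((\<mu> + 1) / 2) (c * \<tau>) c (- 4 * ((\<mu> + 1) / 2) * \<tau>) 0 0 0 f g" and c: "c \<noteq> 0"
    and K: "\<And>z. z \<in> {0<..<1} \<Longrightarrow> \<bar>g z\<bar> \<le> K * sqrt (z * (1 - z))"
    and nz: "z0 \<in> {0<..<1}" "f z0 \<noteq> 0 \<or> g z0 \<noteq> 0"
  shows "spheroidal_eigenvalue \<mu> (c\<^sup>2 - (c * \<tau>)\<^sup>2) (complex_of_real ((\<mu> + 1) * (\<mu> - 2 * (c * \<tau>))))"
proof -
  define \<alpha> where "\<alpha> = (\<mu> + 1) / 2"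
  define q where "q = diag_coeff \<alpha> (c * \<tau>)"
  define q' where "q' z = \<alpha> / z\<^sup>2 + \<alpha> / (1 - z)\<^sup>2" for z
  define S where "S = offdiag_coeff c (- 4 * \<alpha> * \<tau>) 0"
  define \<Phi> where "\<Phi> = potential \<alpha> c \<tau>"
  have \<Phi>_eq: "\<Phi> z = (q z)\<^sup>2 - q' z - 2 * c * S z" for z
    by (simp add: \<Phi>_def potential_def q_def q'_def S_def)
  have dq: "(q has_real_derivative q' z) (at z)" if "z \<in> {0<..<1}" for z
    unfolding q_def q'_def by (rule diag_coeff_has_derivative[OF that])
  have df: "(f has_real_derivative q z * f z + S z * g z) (at z)"
    and dg0: "(g has_real_derivative - (2 * c) * f z - q z * g z) (at z)" if "z \<in> {0<..<1}" for z
    using sol that unfolding canonical_solution_def \<alpha>_def[symmetric] q_def[symmetric] S_def[symmetric]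
    by (auto simp: offdiag_coeff_def)
  define g1 where "g1 z = - (2 * c) * f z - q z * g z" for z
  have dg: "(g has_real_derivative g1 z) (at z)" if "z \<in> {0<..<1}" for z
    using dg0[OF that] by (simp add: g1_def)
  have dg1: "(g1 has_real_derivative \<Phi> z * g z) (at z)" if "z \<in> {0<..<1}" for z
    unfolding g1_def
    by (auto intro!: derivative_eq_intros df[OF that] dg0[OF that] dq[OF that] simp: \<Phi>_eq power2_eq_square algebra_simps)
  define s where "s z = sqrt (z * (1 - z))" for z :: real
  have s: "s z > 0" "(s z)\<^sup>2 = z * (1 - z)" if "z \<in> {0<..<1}" for z using that by (auto simp: s_def)
  have ds: "(s has_real_derivative (1 - 2 * z) / (2 * s z)) (at z)" if "z \<in> {0<..<1}" for z
    unfolding s_def by (rule sqrt_unit_has_derivative[OF that])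
  define h where "h z = g z / s z" for z
  define h1 where "h1 z = (g1 z / s z - g z * (1 - 2 * z) / (2 * s z ^ 3)) / 2" for z
  define N where "N z = 2 * s z * g1 z - g z * (1 - 2 * z) / s z" for z
  define N1 where "N1 z = 2 * (s z * \<Phi> z * g z) + 2 * (g z / s z) + g z * (1 - 2 * z)\<^sup>2 / (2 * s z ^ 3)" for z
  have dh: "(h has_real_derivative 2 * h1 z) (at z)" if z: "z \<in> {0<..<1}" for z
    unfolding h_def h1_def
    using s(1)[OF z] by (auto intro!: derivative_eq_intros dg[OF z] ds[OF z] simp: field_simps power2_eq_square power3_eq_cube)
  have dN: "(N has_real_derivative N1 z) (at z)" if z: "z \<in> {0<..<1}" for z
    unfolding N_def N1_def
    using s(1)[OF z] by (auto intro!: derivative_eq_intros dg[OF z] dg1[OF z] ds[OF z] simp: field_simps power2_eq_square power3_eq_cube)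
  have Nh1: "N z = 4 * (z * (1 - z)) * h1 z" if z: "z \<in> {0<..<1}" for z
    unfolding s(2)[OF z, symmetric] using s(1)[OF z] by (simp add: N_def h1_def field_simps power2_eq_square power3_eq_cube)
  define Z where "Z x = (x + 1) / 2" for x :: real
  have Z: "Z x \<in> {0<..<1}" if "x \<in> {-1<..<1}" for x using that by (auto simp: Z_def)
  have dZ: "(Z has_real_derivative 1 / 2) (at x)" for x unfolding Z_def by (auto intro!: derivative_eq_intros)
  have xZ: "1 - x\<^sup>2 = 4 * (Z x * (1 - Z x))" for x by (simp add: Z_def power2_eq_square field_simps)
  have cvd: "((\<lambda>x. complex_of_real (r x)) has_vector_derivative complex_of_real r') (at x)"
    if "(r has_real_derivative r') (at x)" for r r' x
    using bounded_linear.has_vector_derivative[OF bounded_linear_of_real] that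
    by (simp add: has_real_derivative_iff_has_vector_derivative)
  define lam where "lam = (\<mu> + 1) * (\<mu> - 2 * (c * \<tau>))"
  define \<gamma>2 where "\<gamma>2 = c\<^sup>2 - (c * \<tau>)\<^sup>2"
  have "spheroidal_solution \<mu> \<gamma>2 (complex_of_real lam) (\<lambda>x. complex_of_real (h (Z x)))"
    unfolding spheroidal_solution_def
  proof (intro exI[of _ "\<lambda>x. complex_of_real (h1 (Z x))"] ballI conjI)
    fix x :: real assume x: "x \<in> {-1<..<1}"
    note z = Z[OF x]
    show "((\<lambda>x. complex_of_real (h (Z x))) has_vector_derivative complex_of_real (h1 (Z x))) (at x)"
      using cvd[OF DERIV_chain2[OF dh[OF z] dZ]] by simp
    have "((\<lambda>x. complex_of_real (N (Z x))) has_vector_derivative complex_of_real (N1 (Z x) / 2)) (at x)"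
      using cvd[OF DERIV_chain2[OF dN[OF z] dZ]] by simp
    then have d: "((\<lambda>x. complex_of_real (1 - x\<^sup>2) * complex_of_real (h1 (Z x))) has_vector_derivative complex_of_real (N1 (Z x) / 2)) (at x)"
      by (rule has_vector_derivative_transform_within_open[of _ _ _ "{-1<..<1}"])
         (use x in \<open>auto simp: Nh1[OF Z] xZ\<close>)
    have "N1 (Z x) / 2 = (s (Z x) * \<Phi> (Z x) + 1 / s (Z x) + (1 - 2 * Z x)\<^sup>2 / (4 * s (Z x) ^ 3)) * g (Z x)"
      by (simp add: N1_def algebra_simps)
    also have "\<dots> = - (lam + \<gamma>2 * (4 * (s (Z x))\<^sup>2) - \<mu>\<^sup>2 / (4 * (s (Z x))\<^sup>2)) / s (Z x) * g (Z x)"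
      unfolding \<Phi>_def \<alpha>_def s_def lam_def \<gamma>2_def potential_spheroidal[OF z] ..
    also have "\<dots> = - ((lam + (\<gamma>2 * (1 - x\<^sup>2) - \<mu>\<^sup>2 / (1 - x\<^sup>2))) * h (Z x))"
    proof -
      have "- (A + B - C) / R * y = - ((A + (B - C)) * (y / R))" for A B C R y :: real
        by (simp add: algebra_simps diff_divide_distrib add_divide_distrib)
      then show ?thesis unfolding xZ s(2)[OF z] h_def .
    qed
    finally have eq0: "N1 (Z x) / 2 + (lam + (\<gamma>2 * (1 - x\<^sup>2) - \<mu>\<^sup>2 / (1 - x\<^sup>2))) * h (Z x) = 0" by simp
    have "complex_of_real (N1 (Z x) / 2) + (complex_of_real lam + complex_of_real (\<gamma>2 * (1 - x\<^sup>2) - \<mu>\<^sup>2 / (1 - x\<^sup>2))) * complex_of_real (h (Z x))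
      = complex_of_real (N1 (Z x) / 2 + (lam + (\<gamma>2 * (1 - x\<^sup>2) - \<mu>\<^sup>2 / (1 - x\<^sup>2))) * h (Z x))"
      by (simp only: of_real_add of_real_mult)
    also have "\<dots> = 0" unfolding eq0 by simp
    finally have "complex_of_real (N1 (Z x) / 2) + (complex_of_real lam + complex_of_real (\<gamma>2 * (1 - x\<^sup>2) - \<mu>\<^sup>2 / (1 - x\<^sup>2))) * complex_of_real (h (Z x)) = 0" .
    with d show "\<exists>d. ((\<lambda>x. complex_of_real (1 - x\<^sup>2) * complex_of_real (h1 (Z x))) has_vector_derivative d) (at x) \<and>
        d + (complex_of_real lam + complex_of_real (\<gamma>2 * (1 - x\<^sup>2) - \<mu>\<^sup>2 / (1 - x\<^sup>2))) * complex_of_real (h (Z x)) = 0" by blast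
  qed
  moreover have "bounded ((\<lambda>x. complex_of_real (h (Z x))) ` {-1<..<1})"
    unfolding bounded_iff
  proof (intro exI[of _ K] ballI)
    fix y assume "y \<in> (\<lambda>x. complex_of_real (h (Z x))) ` {-1<..<1}"
    then obtain x where x: "x \<in> {-1<..<1}" "y = complex_of_real (h (Z x))" by blast
    show "norm y \<le> K"
      using K[OF Z[OF x(1)]] s(1)[OF Z[OF x(1)]] unfolding x(2) h_def norm_of_real abs_divide
      by (simp add: divide_le_eq s_def)
  qed
  moreover have "\<exists>x\<in>{-1<..<1}. complex_of_real (h (Z x)) \<noteq> 0"
  proof (rule ccontr)
    assume "\<not> ?thesis"
    then have h0: "h (Z x) = 0" if "x \<in> {-1<..<1}" for x using that by auto
    have g0: "g z = 0" if z: "z \<in> {0<..<1}" for z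
    proof -
      have "h (Z (2 * z - 1)) = 0" by (rule h0) (use z in auto)
      then show ?thesis using s(1)[OF z] by (simp add: Z_def h_def)
    qed
    have der: "((\<lambda>_. 0) has_real_derivative g1 z0) (at z0)"
      by (rule has_field_derivative_transform_within_open[OF dg[OF nz(1)], of "{0<..<1}"]) (use nz(1) g0 in auto)
    have "g1 z0 = 0" by (rule DERIV_unique[OF der DERIV_const])
    then show False using g0[OF nz(1)] nz(2) c by (simp add: g1_def)
  qed
  ultimately show ?thesis unfolding spheroidal_eigenvalue_def lam_def \<gamma>2_def by blast
qed

text \<open>The substitution is read backwards: \<open>v\<close> is \<open>s * w\<close>, and \<open>f\<close> is recovered from the equation for \<open>g'\<close>. Since the
  eigenvalue parameter is real, the real or the imaginary part of \<open>w\<close> can be used for \<open>w\<close>.\<close>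

theorem solution_of_spheroidal_eigenvalue:
  assumes c: "c > 0"
    and ev: "spheroidal_eigenvalue \<mu> (c\<^sup>2 - (c * \<tau>)\<^sup>2) (complex_of_real ((\<mu> + 1) * (\<mu> - 2 * (c * \<tau>))))"
  obtains f g M z0 where "canonical_solution ((\<mu> + 1) / 2) (c * \<tau>) c (- 4 * ((\<mu> + 1) / 2) * \<tau>) 0 0 0 f g"
    "\<And>z. z \<in> {0<..<1} \<Longrightarrow> \<bar>g z\<bar> \<le> M * sqrt (z * (1 - z))" "z0 \<in> {0<..<1}" "g z0 \<noteq> 0"
proof -
  define \<alpha> where "\<alpha> = (\<mu> + 1) / 2"
  define lam where "lam = (\<mu> + 1) * (\<mu> - 2 * (c * \<tau>))"
  define \<gamma>2 where "\<gamma>2 = c\<^sup>2 - (c * \<tau>)\<^sup>2"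
  define V where "V x = lam + (\<gamma>2 * (1 - x\<^sup>2) - \<mu>\<^sup>2 / (1 - x\<^sup>2))" for x :: real
  obtain w where w: "spheroidal_solution \<mu> \<gamma>2 (complex_of_real lam) w" "bounded (w ` {-1<..<1})"
    and nz: "\<exists>x\<in>{-1<..<1}. w x \<noteq> 0"
    using ev unfolding spheroidal_eigenvalue_def lam_def \<gamma>2_def by blast
  obtain w' where w': "\<And>x. x \<in> {-1<..<1} \<Longrightarrow> (w has_vector_derivative w' x) (at x)"
    "\<And>x. x \<in> {-1<..<1} \<Longrightarrow> \<exists>d. ((\<lambda>x. complex_of_real (1 - x\<^sup>2) * w' x) has_vector_derivative d) (at x) \<and>
             d + (complex_of_real lam + complex_of_real (\<gamma>2 * (1 - x\<^sup>2) - \<mu>\<^sup>2 / (1 - x\<^sup>2))) * w x = 0"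
    using w(1) unfolding spheroidal_solution_def by blast
  obtain x0 where x0: "x0 \<in> {-1<..<1}" "w x0 \<noteq> 0" using nz by blast
  obtain L :: "complex \<Rightarrow> real" where L: "bounded_linear L" "\<And>r a. L (complex_of_real r * a) = r * L a"
    "\<And>a. \<bar>L a\<bar> \<le> cmod a" "L (w x0) \<noteq> 0"
  proof (cases "Re (w x0) = 0")
    case True
    then have "Im (w x0) \<noteq> 0" using x0(2) by (auto simp: complex_eq_iff)
    then show ?thesis by (intro that[OF bounded_linear_Im]) (auto simp: abs_Im_le_cmod)
  next
    case False
    then show ?thesis by (intro that[OF bounded_linear_Re]) (auto simp: abs_Re_le_cmod)
  qed
  define r where "r x = L (w x)" for x
  define n where "n x = (1 - x\<^sup>2) * L (w' x)" for x
  have dr: "(r has_real_derivative n x / (1 - x\<^sup>2)) (at x)" if x: "x \<in> {-1<..<1}" for x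
  proof -
    have "x\<^sup>2 < 1" using x by (simp add: abs_square_less_1 abs_less_iff)
    then show ?thesis
      using bounded_linear.has_vector_derivative[OF L(1) w'(1)[OF x]]
      by (simp add: has_real_derivative_iff_has_vector_derivative r_def[abs_def] n_def)
  qed
  have dn: "(n has_real_derivative - V x * r x) (at x)" if x: "x \<in> {-1<..<1}" for x
  proof -
    obtain d where d: "((\<lambda>x. complex_of_real (1 - x\<^sup>2) * w' x) has_vector_derivative d) (at x)"
       "d + (complex_of_real lam + complex_of_real (\<gamma>2 * (1 - x\<^sup>2) - \<mu>\<^sup>2 / (1 - x\<^sup>2))) * w x = 0"
      using w'(2)[OF x] by blast
    have "d = complex_of_real (- V x) * w x"
    proof -
      have "complex_of_real (V x) = complex_of_real lam + complex_of_real (\<gamma>2 * (1 - x\<^sup>2) - \<mu>\<^sup>2 / (1 - x\<^sup>2))"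
        by (simp only: V_def of_real_add)
      then have "d + complex_of_real (V x) * w x = 0" using d(2) by simp
      then show ?thesis by (simp add: eq_neg_iff_add_eq_0)
    qed
    then have "L d = - V x * r x" unfolding r_def by (simp only: L(2))
    then show ?thesis
      using bounded_linear.has_vector_derivative[OF L(1) d(1)]
      unfolding n_def[abs_def] L(2) by (simp add: has_real_derivative_iff_has_vector_derivative)
  qed
  define q where "q = diag_coeff \<alpha> (c * \<tau>)"
  define q' where "q' z = \<alpha> / z\<^sup>2 + \<alpha> / (1 - z)\<^sup>2" for z
  define S where "S = offdiag_coeff c (- 4 * \<alpha> * \<tau>) 0"
  define \<Phi> where "\<Phi> = potential \<alpha> c \<tau>"
  have \<Phi>_eq: "\<Phi> z = (q z)\<^sup>2 - q' z - 2 * c * S z" for z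
    by (simp add: \<Phi>_def potential_def q_def q'_def S_def)
  have dq: "(q has_real_derivative q' z) (at z)" if "z \<in> {0<..<1}" for z
    unfolding q_def q'_def by (rule diag_coeff_has_derivative[OF that])
  define s where "s z = sqrt (z * (1 - z))" for z :: real
  have s: "s z > 0" "(s z)\<^sup>2 = z * (1 - z)" if "z \<in> {0<..<1}" for z using that by (auto simp: s_def)
  have ds: "(s has_real_derivative (1 - 2 * z) / (2 * s z)) (at z)" if "z \<in> {0<..<1}" for z
    unfolding s_def by (rule sqrt_unit_has_derivative[OF that])
  define X where "X z = 2 * z - 1" for z :: real
  have X: "X z \<in> {-1<..<1}" if "z \<in> {0<..<1}" for z using that by (auto simp: X_def)
  have dX: "(X has_real_derivative 2) (at z)" for z unfolding X_def by (auto intro!: derivative_eq_intros)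
  have xs: "1 - (X z)\<^sup>2 = 4 * (s z)\<^sup>2" if "z \<in> {0<..<1}" for z
    unfolding s(2)[OF that] by (simp add: X_def power2_eq_square algebra_simps)
  define R where "R z = r (X z)" for z
  define Q where "Q z = n (X z)" for z
  have dR: "(R has_real_derivative Q z / (2 * (s z)\<^sup>2)) (at z)" if z: "z \<in> {0<..<1}" for z
    using DERIV_chain2[OF dr[OF X[OF z]] dX] unfolding R_def[abs_def] Q_def xs[OF z] by simp
  have dQ: "(Q has_real_derivative - 2 * V (X z) * R z) (at z)" if z: "z \<in> {0<..<1}" for z
    using DERIV_chain2[OF dn[OF X[OF z]] dX] unfolding R_def Q_def[abs_def] by (simp add: mult_ac)
  define v where "v z = s z * R z" for z
  define v1 where "v1 z = (1 - 2 * z) / (2 * s z) * R z + Q z / (2 * s z)" for z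
  have dv: "(v has_real_derivative v1 z) (at z)" if z: "z \<in> {0<..<1}" for z
    unfolding v_def v1_def using s(1)[OF z]
    by (auto intro!: derivative_eq_intros ds[OF z] dR[OF z] simp: power2_eq_square field_simps)
  have dv1: "(v1 has_real_derivative \<Phi> z * v z) (at z)" if z: "z \<in> {0<..<1}" for z
  proof -
    have "(v1 has_real_derivative (- 1 / s z - (1 - 2 * z)\<^sup>2 / (4 * s z ^ 3)) * R z - V (X z) / s z * R z) (at z)"
      unfolding v1_def using s(1)[OF z]
      by (auto intro!: derivative_eq_intros ds[OF z] dR[OF z] dQ[OF z] simp: power2_eq_square power3_eq_cube field_simps)
    moreover have "- (V (X z)) / s z = s z * \<Phi> z + 1 / s z + (1 - 2 * z)\<^sup>2 / (4 * s z ^ 3)"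
      unfolding \<Phi>_def \<alpha>_def s_def potential_spheroidal[OF z]
      unfolding V_def xs[OF z] lam_def \<gamma>2_def s_def by (simp add: add_diff_eq)
    then have "- (V (X z)) / s z * R z = (s z * \<Phi> z + 1 / s z + (1 - 2 * z)\<^sup>2 / (4 * s z ^ 3)) * R z" by simp
    then have "(- 1 / s z - (1 - 2 * z)\<^sup>2 / (4 * s z ^ 3)) * R z - V (X z) / s z * R z = \<Phi> z * v z"
      by (simp add: v_def algebra_simps)
    ultimately show ?thesis by simp
  qed
  define f where "f z = - (v1 z + q z * v z) / (2 * c)" for z
  obtain M where M: "\<And>x. x \<in> {-1<..<1} \<Longrightarrow> cmod (w x) \<le> M" using w(2) unfolding bounded_iff by blast
  show ?thesis
  proof (rule that)
    show "canonical_solution ((\<mu> + 1) / 2) (c * \<tau>) c (- 4 * ((\<mu> + 1) / 2) * \<tau>) 0 0 0 f v"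
      unfolding canonical_solution_def \<alpha>_def[symmetric] q_def[symmetric] S_def[symmetric]
    proof (intro ballI conjI)
      fix z :: real assume z: "z \<in> {0<..<1}"
      have "(f has_real_derivative - (\<Phi> z * v z + (q z * v1 z + q' z * v z)) / (2 * c)) (at z)"
        unfolding f_def by (rule DERIV_cdivide[OF DERIV_minus[OF DERIV_add[OF dv1[OF z] DERIV_mult'[OF dq[OF z] dv[OF z]]]]])
      moreover have "- (\<Phi> z * v z + (q z * v1 z + q' z * v z)) / (2 * c) = q z * f z + S z * v z"
        using c by (simp add: \<Phi>_eq f_def field_simps power2_eq_square)
      ultimately show "(f has_real_derivative q z * f z + S z * v z) (at z)" by simp
      have "- offdiag_coeff c 0 0 z * f z - q z * v z = v1 z"
        using c by (simp add: offdiag_coeff_def f_def)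
      then show "(v has_real_derivative - offdiag_coeff c 0 0 z * f z - q z * v z) (at z)"
        using dv[OF z] by simp
    qed
    show "\<bar>v z\<bar> \<le> M * sqrt (z * (1 - z))" if z: "z \<in> {0<..<1}" for z
    proof -
      have "\<bar>R z\<bar> \<le> M" unfolding R_def r_def using L(3)[of "w (X z)"] M[OF X[OF z]] by linarith
      then have "s z * \<bar>R z\<bar> \<le> s z * M" using s(1)[OF z] by (intro mult_left_mono) auto
      then show ?thesis using s(1)[OF z] by (simp add: v_def abs_mult mult.commute s_def)
    qed
    show "(x0 + 1) / 2 \<in> {0<..<1}" using x0(1) by auto
    moreover have "X ((x0 + 1) / 2) = x0" by (simp add: X_def field_simps)
    ultimately show "v ((x0 + 1) / 2) \<noteq> 0"
      using s(1)[of "(x0 + 1) / 2"] L(4) by (simp add: v_def R_def r_def)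
  qed
qed

section \<open>Analytic eigenvalues\<close>

lemma power_series_has_derivative_at_center:
  fixes f :: "real \<Rightarrow> real"
  assumes r: "r > 0" and S: "\<And>h. \<bar>h\<bar> < r \<Longrightarrow> (\<lambda>n. a n * h ^ n) sums f (t + h)"
  shows "\<exists>d. (f has_real_derivative d) (at t)"
proof -
  have "((\<lambda>h. \<Sum>n. a n * h ^ n) has_real_derivative (\<Sum>n. diffs a n * 0 ^ n)) (at 0)"
    by (rule termdiffs_strong'[of r]) (use S r in \<open>auto simp: sums_iff\<close>)
  then have "((\<lambda>h. f (h + t)) has_real_derivative (\<Sum>n. diffs a n * 0 ^ n)) (at 0)"
    by (rule has_field_derivative_transform_within_open[of _ _ _ "{-r<..<r}"])
       (use r S in \<open>auto simp: sums_iff add.commute abs_less_iff\<close>)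
  then show ?thesis using DERIV_shift[of f "\<Sum>n. diffs a n * 0 ^ n" 0 t] by auto
qed

text \<open>For \<open>k = 0\<close> only the terms with \<open>j = 0\<close> remain of the double series, which is then a power series in \<open>h\<close>;
  likewise with the variables exchanged.\<close>

lemma real_analytic2_partial_derivatives:
  assumes an: "real_analytic2_on \<omega> S" and tu: "(t, u) \<in> S"
  shows "\<exists>d. ((\<lambda>s. \<omega> (s, u)) has_real_derivative d) (at t)"
    and "\<exists>d. ((\<lambda>v. \<omega> (t, v)) has_real_derivative d) (at u)"
proof -
  from an tu obtain r a where r: "r > 0" and S: "\<And>h k. \<bar>h\<bar> < r \<Longrightarrow> \<bar>k\<bar> < r \<Longrightarrow>
        ((\<lambda>(i, j). a i j * h ^ i * k ^ j) has_sum \<omega> (t + h, u + k)) (UNIV :: (nat \<times> nat) set)"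
    unfolding real_analytic2_on_def by fast
  have "(\<lambda>i. a i 0 * h ^ i) sums \<omega> (t + h, u)" if "\<bar>h\<bar> < r" for h
  proof (rule has_sum_imp_sums)
    have "((\<lambda>(i, j). a i j * h ^ i * 0 ^ j) has_sum \<omega> (t + h, u)) UNIV" using S[OF that, of 0] r by simp
    then have "((\<lambda>(i, j). a i j * h ^ i * 0 ^ j) has_sum \<omega> (t + h, u)) (range (\<lambda>i. (i, 0)))"
      by (rule has_sum_cong_neutral[THEN iffD1, rotated -1]) (auto simp: image_iff)
    then show "((\<lambda>i. a i 0 * h ^ i) has_sum \<omega> (t + h, u)) UNIV"
      by (subst (asm) has_sum_reindex) (auto simp: inj_on_def o_def)
  qed
  then show "\<exists>d. ((\<lambda>s. \<omega> (s, u)) has_real_derivative d) (at t)"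
    by (rule power_series_has_derivative_at_center[OF r, of _ "\<lambda>s. \<omega> (s, u)"])
  have "(\<lambda>j. a 0 j * k ^ j) sums \<omega> (t, u + k)" if "\<bar>k\<bar> < r" for k
  proof (rule has_sum_imp_sums)
    have "((\<lambda>(i, j). a i j * 0 ^ i * k ^ j) has_sum \<omega> (t, u + k)) UNIV" using S[OF _ that, of 0] r by simp
    then have "((\<lambda>(i, j). a i j * 0 ^ i * k ^ j) has_sum \<omega> (t, u + k)) (range (\<lambda>j. (0, j)))"
      by (rule has_sum_cong_neutral[THEN iffD1, rotated -1]) (auto simp: image_iff)
    then show "((\<lambda>j. a 0 j * k ^ j) has_sum \<omega> (t, u + k)) UNIV"
      by (subst (asm) has_sum_reindex) (auto simp: inj_on_def o_def)
  qed
  then show "\<exists>d. ((\<lambda>v. \<omega> (t, v)) has_real_derivative d) (at u)"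
    by (rule power_series_has_derivative_at_center[OF r, of _ "\<lambda>v. \<omega> (t, v)"])
qed

lemma exp_cosh_tanh:
  fixes t u :: real
  shows "exp t * cosh u * tanh u = exp t * sinh u"
    "(exp t * cosh u)\<^sup>2 - (exp t * sinh u)\<^sup>2 = (exp t)\<^sup>2"
  by (simp_all add: tanh_def power_mult_distrib cosh_square_eq algebra_simps)

text \<open>An eigenfunction is recessive at both ends, hence of the order of \<open>sqrt (z * (1 - z))\<close>, which is what makes
  \<open>w\<close> bounded.\<close>

theorem spheroidal_eigenvalue_of_ham_eigenvalue:
  assumes \<mu>: "\<mu> \<ge> 0"
    and ev: "ham_eigenvalue \<mu> t u (complex_of_real (exp t * cosh u - (\<mu> + 1) * tanh u))"
  shows "spheroidal_eigenvalue \<mu> ((exp t)\<^sup>2) (complex_of_real ((\<mu> + 1) * (\<mu> - 2 * exp t * sinh u)))"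
proof -
  define \<alpha> where "\<alpha> = (\<mu> + 1) / 2"
  define c where "c = exp t * cosh u"
  define \<tau> where "\<tau> = tanh u"
  have \<alpha>: "\<alpha> \<ge> 1 / 2" using \<mu> by (simp add: \<alpha>_def)
  have c0: "c > 0" by (simp add: c_def)
  have \<sigma>: "exp t * sinh u = c * \<tau>" by (simp add: c_def \<tau>_def exp_cosh_tanh)
  have km: "c - (\<mu> + 1) * \<tau> - (\<mu> + 1) * \<tau> - c = - 4 * \<alpha> * \<tau>" "c - (\<mu> + 1) * \<tau> + (\<mu> + 1) * \<tau> - c = 0"
    by (simp_all add: \<alpha>_def field_simps)
  obtain f g where sol: "square_integrable_solution \<alpha> (c * \<tau>) c (- 4 * \<alpha> * \<tau>) 0 f g"
    using square_integrable_of_ham_eigenvalue[OF \<mu> ev]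
    unfolding \<sigma> c_def[symmetric] \<tau>_def[symmetric] \<alpha>_def[symmetric] km by blast
  obtain b \<beta> where b: "\<And>z. z \<in> {0<..<1} \<Longrightarrow>
      f z = b * recessive_f \<alpha> (c * \<tau>) c (- 4 * \<alpha> * \<tau>) 0 0 0 z \<and> g z = b * recessive_g \<alpha> (c * \<tau>) c (- 4 * \<alpha> * \<tau>) 0 0 0 z"
    by (rule square_integrable_connects[OF \<alpha> sol]) auto
  have ex: "\<exists>f g. square_integrable_solution \<alpha> (c * \<tau>) c (- 4 * \<alpha> * \<tau>) 0 f g" using sol by blast
  obtain K where K: "K \<ge> 0" "\<And>z. z \<in> {0<..<1} \<Longrightarrow>
    \<bar>recessive_g \<alpha> (c * \<tau>) c (- 4 * \<alpha> * \<tau>) 0 0 0 z\<bar> \<le> K * sqrt (min z (1 - z))"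
    by (rule recessive_uniform_envelope[OF \<alpha> tendsto_const[of "c * \<tau>"] tendsto_const[of c]
          tendsto_const[of "- 4 * \<alpha> * \<tau>"] tendsto_const[of 0] ex]) auto
  have s: "canonical_solution \<alpha> (c * \<tau>) c (- 4 * \<alpha> * \<tau>) 0 0 0 f g" and nz: "\<exists>z\<in>{0<..<1}. f z \<noteq> 0 \<or> g z \<noteq> 0"
    using sol unfolding square_integrable_solution_def by auto
  obtain z0 where z0: "z0 \<in> {0<..<1}" "f z0 \<noteq> 0 \<or> g z0 \<noteq> 0" using nz by blast
  have "spheroidal_eigenvalue \<mu> (c\<^sup>2 - (c * \<tau>)\<^sup>2) (complex_of_real ((\<mu> + 1) * (\<mu> - 2 * (c * \<tau>))))"
  proof (rule spheroidal_eigenvalue_of_envelope[OF s[unfolded \<alpha>_def] _ _ z0])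
    fix z :: real assume z: "z \<in> {0<..<1}"
    have "min z (1 - z) \<le> 2 * (z * (1 - z))"
    proof (cases "z \<le> 1 / 2")
      case True
      then have "z * 1 \<le> z * (2 * (1 - z))" using z by (intro mult_left_mono) auto
      then show ?thesis by (simp add: mult_ac min_le_iff_disj)
    next
      case False
      then have "(1 - z) * 1 \<le> (1 - z) * (2 * z)" using z by (intro mult_left_mono) auto
      then show ?thesis by (simp add: mult_ac min_le_iff_disj)
    qed
    then have "sqrt (min z (1 - z)) \<le> sqrt 2 * sqrt (z * (1 - z))" by (simp flip: real_sqrt_mult)
    then have "K * sqrt (min z (1 - z)) \<le> K * (sqrt 2 * sqrt (z * (1 - z)))"
      by (intro mult_left_mono K(1))
    then have "\<bar>recessive_g \<alpha> (c * \<tau>) c (- 4 * \<alpha> * \<tau>) 0 0 0 z\<bar> \<le> K * (sqrt 2 * sqrt (z * (1 - z)))"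
      using K(2)[OF z] by linarith
    then have "\<bar>b\<bar> * \<bar>recessive_g \<alpha> (c * \<tau>) c (- 4 * \<alpha> * \<tau>) 0 0 0 z\<bar> \<le> \<bar>b\<bar> * (K * (sqrt 2 * sqrt (z * (1 - z))))"
      by (intro mult_left_mono) auto
    then show "\<bar>g z\<bar> \<le> (\<bar>b\<bar> * K * sqrt 2) * sqrt (z * (1 - z))" using b[OF z] by (simp add: abs_mult mult.assoc)
  qed (use c0 in simp)
  moreover have "c\<^sup>2 - (c * \<tau>)\<^sup>2 = (exp t)\<^sup>2" unfolding \<sigma>[symmetric] unfolding c_def by (rule exp_cosh_tanh)
  ultimately show ?thesis unfolding mult.assoc[of 2 "exp t"] \<sigma> by simp
qed

text \<open>The solution obtained from \<open>w\<close> is bounded by a multiple of \<open>sqrt (z * (1 - z))\<close> in its second component. This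
  forces it to be recessive at both ends, which in turn controls the first component.\<close>

theorem ham_eigenvalue_of_spheroidal_eigenvalue:
  assumes \<mu>: "\<mu> \<ge> 0"
    and ev: "spheroidal_eigenvalue \<mu> ((exp t)\<^sup>2) (complex_of_real ((\<mu> + 1) * (\<mu> - 2 * exp t * sinh u)))"
  shows "ham_eigenvalue \<mu> t u (complex_of_real (exp t * cosh u - (\<mu> + 1) * tanh u))"
proof -
  define \<alpha> where "\<alpha> = (\<mu> + 1) / 2"
  define c where "c = exp t * cosh u"
  define \<tau> where "\<tau> = tanh u"
  have \<alpha>: "\<alpha> \<ge> 1 / 2" using \<mu> by (simp add: \<alpha>_def)
  then have \<alpha>0: "\<alpha> > 0" by simp
  have c0: "c > 0" by (simp add: c_def)
  have \<sigma>: "exp t * sinh u = c * \<tau>" by (simp add: c_def \<tau>_def exp_cosh_tanh)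
  have km: "c - (\<mu> + 1) * \<tau> - (\<mu> + 1) * \<tau> - c = - 4 * \<alpha> * \<tau>" "c - (\<mu> + 1) * \<tau> + (\<mu> + 1) * \<tau> - c = 0"
    by (simp_all add: \<alpha>_def field_simps)
  have \<gamma>: "c\<^sup>2 - (c * \<tau>)\<^sup>2 = (exp t)\<^sup>2" unfolding \<sigma>[symmetric] unfolding c_def by (rule exp_cosh_tanh)
  have ev': "spheroidal_eigenvalue \<mu> (c\<^sup>2 - (c * \<tau>)\<^sup>2) (complex_of_real ((\<mu> + 1) * (\<mu> - 2 * (c * \<tau>))))"
    using ev unfolding mult.assoc[of 2 "exp t"] \<sigma> \<gamma> .
  obtain f g M z0 where s: "canonical_solution \<alpha> (c * \<tau>) c (- 4 * \<alpha> * \<tau>) 0 0 0 f g"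
    and M: "\<And>z. z \<in> {0<..<1} \<Longrightarrow> \<bar>g z\<bar> \<le> M * sqrt (z * (1 - z))" and z0: "z0 \<in> {0<..<1}" "g z0 \<noteq> 0"
    by (rule solution_of_spheroidal_eigenvalue[OF c0 ev', folded \<alpha>_def]) auto
  have M0: "\<bar>g z\<bar> \<le> \<bar>M\<bar> * sqrt z" "\<bar>- g (1 - z)\<bar> \<le> \<bar>M\<bar> * sqrt z" if z: "z \<in> {0<..<1}" for z
  proof -
    have le: "M * sqrt (z * (1 - z)) \<le> \<bar>M\<bar> * sqrt z"
      using z by (intro mult_mono) (auto simp: mult_left_le)
    show "\<bar>g z\<bar> \<le> \<bar>M\<bar> * sqrt z" using M[OF z] le by linarith
    have "1 - z \<in> {0<..<1}" using z by auto
    from M[OF this] le show "\<bar>- g (1 - z)\<bar> \<le> \<bar>M\<bar> * sqrt z" by (simp add: mult.commute)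
  qed
  obtain b where b: "\<And>z. z \<in> {0<..<1} \<Longrightarrow> f z = b * recessive_f \<alpha> (c * \<tau>) c (- 4 * \<alpha> * \<tau>) 0 0 0 z"
    "\<And>z. z \<in> {0<..<1} \<Longrightarrow> g z = b * recessive_g \<alpha> (c * \<tau>) c (- 4 * \<alpha> * \<tau>) 0 0 0 z"
    by (rule limit_point_sqrt_bound[OF \<alpha> c0 s M0(1)]) auto
  obtain b' where b': "\<And>z. z \<in> {0<..<1} \<Longrightarrow> f (1 - z) = b' * recessive_f \<alpha> (- (c * \<tau>)) c 0 (- 4 * \<alpha> * \<tau>) 0 0 z"
    "\<And>z. z \<in> {0<..<1} \<Longrightarrow> - g (1 - z) = b' * recessive_g \<alpha> (- (c * \<tau>)) c 0 (- 4 * \<alpha> * \<tau>) 0 0 z"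
    by (rule limit_point_sqrt_bound[OF \<alpha> c0 canonical_solution_reflect[OF s] M0(2)]) auto
  obtain K1 where K1: "K1 > 0" "\<And>z. 0 < z \<Longrightarrow> z \<le> 1 / 2 \<Longrightarrow> \<bar>recessive_f \<alpha> (c * \<tau>) c (- 4 * \<alpha> * \<tau>) 0 0 0 z\<bar> \<le> K1 * z powr \<alpha>"
    "\<And>z. 0 < z \<Longrightarrow> z \<le> 1 / 2 \<Longrightarrow> \<bar>recessive_g \<alpha> (c * \<tau>) c (- 4 * \<alpha> * \<tau>) 0 0 0 z\<bar> \<le> K1 * z powr \<alpha>"
    by (rule recessive_bound_fixed[OF \<alpha>0, of "c * \<tau>" c "- 4 * \<alpha> * \<tau>" 0 0 0]) auto
  obtain K2 where K2: "K2 > 0" "\<And>z. 0 < z \<Longrightarrow> z \<le> 1 / 2 \<Longrightarrow> \<bar>recessive_f \<alpha> (- (c * \<tau>)) c 0 (- 4 * \<alpha> * \<tau>) 0 0 z\<bar> \<le> K2 * z powr \<alpha>"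
    "\<And>z. 0 < z \<Longrightarrow> z \<le> 1 / 2 \<Longrightarrow> \<bar>recessive_g \<alpha> (- (c * \<tau>)) c 0 (- 4 * \<alpha> * \<tau>) 0 0 z\<bar> \<le> K2 * z powr \<alpha>"
    by (rule recessive_bound_fixed[OF \<alpha>0, of "- (c * \<tau>)" c 0 "- 4 * \<alpha> * \<tau>" 0 0]) auto
  define K where "K = \<bar>b\<bar> * K1 + \<bar>b'\<bar> * K2"
  have est: "\<bar>d * x\<bar> \<le> K * sqrt y" if "\<bar>x\<bar> \<le> C * y powr \<alpha>" "\<bar>d\<bar> * C \<le> K" "C > 0" "0 < y" "y \<le> 1 / 2" for d x C y
  proof -
    have "\<bar>x\<bar> \<le> C * sqrt y"
    proof -
      have "C * y powr \<alpha> \<le> C * sqrt y" using powr_le_sqrt[OF \<alpha>, of y] that by (intro mult_left_mono) auto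
      then show ?thesis using that(1) by linarith
    qed
    then have "\<bar>d\<bar> * \<bar>x\<bar> \<le> \<bar>d\<bar> * (C * sqrt y)" by (intro mult_left_mono) auto
    also have "\<dots> = (\<bar>d\<bar> * C) * sqrt y" by simp
    also have "\<dots> \<le> K * sqrt y" using that by (intro mult_right_mono) auto
    finally show ?thesis by (simp add: abs_mult)
  qed
  have bK: "\<bar>b\<bar> * K1 \<le> K" "\<bar>b'\<bar> * K2 \<le> K" using K1(1) K2(1) by (simp_all add: K_def)
  show ?thesis
  proof (rule ham_eigenvalue_of_envelope[where f = f and g = g and K = K, OF _ _ z0(1)])
    show "canonical_solution ((\<mu> + 1) / 2) (exp t * sinh u) (exp t * cosh u)
       (exp t * cosh u - (\<mu> + 1) * tanh u - (\<mu> + 1) * tanh u - exp t * cosh u) 0 0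
       (exp t * cosh u - (\<mu> + 1) * tanh u + (\<mu> + 1) * tanh u - exp t * cosh u) f g"
      unfolding \<sigma> c_def[symmetric] \<tau>_def[symmetric] \<alpha>_def[symmetric] km by (rule s)
    fix z :: real assume z: "z \<in> {0<..<1}"
    show "\<bar>f z\<bar> \<le> K * sqrt (min z (1 - z)) \<and> \<bar>g z\<bar> \<le> K * sqrt (min z (1 - z))"
    proof (cases "z \<le> 1 / 2")
      case True
      have z': "0 < z" using z by simp
      have "min z (1 - z) = z" using True by simp
      then show ?thesis unfolding b(1)[OF z] b(2)[OF z]
        using est[OF K1(2)[OF z' True] bK(1) K1(1) z' True] est[OF K1(3)[OF z' True] bK(1) K1(1) z' True] by simp
    next
      case False
      have z': "0 < 1 - z" "1 - z \<le> 1 / 2" "1 - z \<in> {0<..<1}" using z False by auto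
      have "min z (1 - z) = 1 - z" using False by simp
      moreover have "\<bar>f z\<bar> \<le> K * sqrt (1 - z)"
        using est[OF K2(2)[OF z'(1,2)] bK(2) K2(1) z'(1,2)] b'(1)[OF z'(3)] by simp
      moreover have "\<bar>- g z\<bar> \<le> K * sqrt (1 - z)"
        using est[OF K2(3)[OF z'(1,2)] bK(2) K2(1) z'(1,2)] b'(2)[OF z'(3)] by simp
      ultimately show ?thesis by simp
    qed
  qed (use z0 in simp)
qed

theorem theorem5:
  fixes \<mu> :: real and S :: "(real \<times> real) set" and \<omega> :: "real \<times> real \<Rightarrow> real"
  assumes "\<mu> \<ge> 0"
    and "open S" and "connected S" and "S \<noteq> {}"
    and "\<And>t u. (t, u) \<in> S \<Longrightarrow> ham_eigenvalue \<mu> t u (complex_of_real (\<omega> (t, u)))"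
    and "real_analytic2_on \<omega> S"
  shows "(\<forall>(t, u) \<in> S.
            deriv (\<lambda>s. \<omega> (s, u)) t + 2 * \<omega> (t, u) * deriv (\<lambda>v. \<omega> (t, v)) u
              = 2 * (\<mu> + 1)\<^sup>2 * (tanh u / (cosh u)\<^sup>2) + exp (2 * t) * sinh (2 * u) + exp t * cosh u)
       \<and> (\<forall>(t, u) \<in> S.
            \<omega> (t, u) = exp t * cosh u - (\<mu> + 1) * tanh u \<longrightarrow>
            spheroidal_eigenvalue \<mu> ((exp t)\<^sup>2)
              (complex_of_real ((\<mu> + 1) * (\<mu> - 2 * exp t * sinh u))))
       \<and> (\<forall>(t, u) \<in> S.
            spheroidal_eigenvalue \<mu> ((exp t)\<^sup>2)
              (complex_of_real ((\<mu> + 1) * (\<mu> - 2 * exp t * sinh u))) \<longleftrightarrow>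
            (\<exists>\<omega>\<^sub>0. ham_eigenvalue \<mu> t u (complex_of_real \<omega>\<^sub>0) \<and>
                  \<omega>\<^sub>0 = exp t * cosh u - (\<mu> + 1) * tanh u))"
proof -
  have pde: "deriv (\<lambda>s. \<omega> (s, u)) t + 2 * \<omega> (t, u) * deriv (\<lambda>v. \<omega> (t, v)) u
      = 2 * (\<mu> + 1)\<^sup>2 * (tanh u / (cosh u)\<^sup>2) + exp (2 * t) * sinh (2 * u) + exp t * cosh u"
    if tu: "(t, u) \<in> S" for t u
  proof -
    obtain \<omega>t \<omega>u where d: "((\<lambda>s. \<omega> (s, u)) has_real_derivative \<omega>t) (at t)"
      "((\<lambda>v. \<omega> (t, v)) has_real_derivative \<omega>u) (at u)"
      using real_analytic2_partial_derivatives[OF assms(6) tu] by blast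
    obtain r where r: "r > 0" "ball (t, u) r \<subseteq> S" using \<open>open S\<close> tu openE by blast
    have two: "2 * ((\<mu> + 1) / 2) = \<mu> + 1" by simp
    have "\<omega>t + 2 * \<omega> (t, u) * \<omega>u
        = 8 * ((\<mu> + 1) / 2)\<^sup>2 * (tanh u / (cosh u)\<^sup>2) + exp (2 * t) * sinh (2 * u) + exp t * cosh u"
    proof (rule eigenvalue_pde[where \<Omega> = "\<lambda>s v. \<omega> (s, v)", OF _ r(1) d], unfold two)
      show "1 / 2 \<le> (\<mu> + 1) / 2" using assms(1) by simp
      show "\<exists>f g. square_integrable_solution ((\<mu> + 1) / 2) (exp s * sinh u) (exp s * cosh u)
          (\<omega> (s, u) - (\<mu> + 1) * tanh u - exp s * cosh u) (\<omega> (s, u) + (\<mu> + 1) * tanh u - exp s * cosh u) f g"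
        if "\<bar>s - t\<bar> < r" for s
      proof (rule square_integrable_of_ham_eigenvalue[OF assms(1) assms(5)])
        have "(s, u) \<in> ball (t, u) r" using that by (simp add: dist_Pair_Pair dist_real_def abs_minus_commute)
        then show "(s, u) \<in> S" using r(2) by blast
      qed
      show "\<exists>f g. square_integrable_solution ((\<mu> + 1) / 2) (exp t * sinh v) (exp t * cosh v)
          (\<omega> (t, v) - (\<mu> + 1) * tanh v - exp t * cosh v) (\<omega> (t, v) + (\<mu> + 1) * tanh v - exp t * cosh v) f g"
        if "\<bar>v - u\<bar> < r" for v
      proof (rule square_integrable_of_ham_eigenvalue[OF assms(1) assms(5)])
        have "(t, v) \<in> ball (t, u) r" using that by (simp add: dist_Pair_Pair dist_real_def abs_minus_commute)
        then show "(t, v) \<in> S" using r(2) by blast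
      qed
    qed
    then show ?thesis unfolding DERIV_imp_deriv[OF d(1)] DERIV_imp_deriv[OF d(2)] by (simp add: power_divide)
  qed
  have spheroidal: "spheroidal_eigenvalue \<mu> ((exp t)\<^sup>2) (complex_of_real ((\<mu> + 1) * (\<mu> - 2 * exp t * sinh u)))
      \<longleftrightarrow> ham_eigenvalue \<mu> t u (complex_of_real (exp t * cosh u - (\<mu> + 1) * tanh u))" for t u
    using spheroidal_eigenvalue_of_ham_eigenvalue[OF assms(1)] ham_eigenvalue_of_spheroidal_eigenvalue[OF assms(1)]
    by blast
  have "spheroidal_eigenvalue \<mu> ((exp t)\<^sup>2) (complex_of_real ((\<mu> + 1) * (\<mu> - 2 * exp t * sinh u)))"
    if "(t, u) \<in> S" "\<omega> (t, u) = exp t * cosh u - (\<mu> + 1) * tanh u" for t u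
    using assms(5)[OF that(1)] unfolding spheroidal that(2) .
  with pde show ?thesis unfolding spheroidal by blast
qed

end
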